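(* Let $(a_\nu)_{\nu\in\mathbf Z}$ be complex numbers such that $|a_\nu|\le C\,m(\nu)$ for all $\nu\in\mathbf Z$ and some constant $C>0$, where $m:\mathbf Z\to\,]0,+\infty[$ satisfies $\sum_{\nu\in\mathbf Z}(1+|\nu|)m(\nu)<\infty$ and $m(-\nu)=m(\nu)$ for all $\nu$. Let $p(\zeta)=\sum_{\nu\in\mathbf Z}a_\nu\zeta^\nu$, $\zeta\in S^1$, viewed as a ($C^1$) map $S^1\to\mathbf C$. Let $P_N=(a_{j-k})_{0\le j,k<N}$ be the associated $N\times N$ Toeplitz matrix, let $Q_\omega=Q_\omega(N)$ be an $N\times N$ random matrix whose entries are independent complex Gaussian random variables of law $\mathcal N_{\mathbf C}(0,1)$, and put $P_N^\delta=P_N+\delta Q_\omega$. Let $\Omega\Subset\mathbf C$ be an open, relatively compact, simply connected set with smooth boundary $\partial\Omega$, independent of $N$, such that: (1) $\partial\Omega$ intersects $p(S^1)$ in at most finitely many points; (2) $p(S^1)$ does not self-intersect at these points of intersection; (3) these points of intersection are non-critical, i.e. $\partial_\zeta p\neq 0$ on $p^{-1}(\partial\Omega\cap p(S^1))$; (4) $\partial\Omega$ and $p(S^1)$ are transversal at every point of the intersection. Let $\delta_0\in\,]0,1[$ and $\delta_1>3/2$. If $\delta=\delta(N)$ satisfies $$e^{-N^{\delta_0}}\le\delta\ll N^{-\delta_1},$$ then there exists $\varepsilon_N=o(1)$ as $N\to\infty$ such that, for $N$ sufficiently large, $$\left|\#(\sigma(P_N^\delta)\cap\Omega)-\frac{N}{2\pi}\int_{S^1\cap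 p^{-1}(\Omega)}L_{S^1}(d\theta)\right|\le\varepsilon_N N$$ with probability $\ge 1-e^{-N^{\delta_0}}$.
   Context: The law $\mathcal N_{\mathbf C}(0,1)$ is $\pi^{-1}e^{-|\alpha|^2}L(d\alpha)$, with $L$ the Lebesgue measure on $\mathbf C$. $\sigma(\cdot)$ is the spectrum and eigenvalues are counted with algebraic multiplicity. $L_{S^1}$ is the Lebesgue (arc length) measure on the unit circle $S^1$, of total mass $2\pi$. $\partial_\zeta p$ is the derivative of $p$ along $S^1$ (equivalently, that of $\xi\mapsto p(e^{-i\xi})$). That $p(S^1)$ does not self-intersect at a point means that the point has exactly one preimage under $p:S^1\to\mathbf C$. $A\ll B$ means $A\le cB$ with a sufficiently small constant $c>0$ independent of $N$. *)

theory Defs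
  imports
    "HOL-Probability.Probability"
    "Jordan_Normal_Form.Matrix"
    "Jordan_Normal_Form.Char_Poly"
    "Jordan_Normal_Form.Spectral_Radius"
begin

definition laurent_symbol :: "(int \<Rightarrow> complex) \<Rightarrow> complex \<Rightarrow> complex" where
  "laurent_symbol a \<zeta> = (\<Sum>\<^sub>\<infinity>\<nu>\<in>UNIV. a \<nu> * \<zeta> powi \<nu>)"

definition toeplitz_mat :: "(int \<Rightarrow> complex) \<Rightarrow> nat \<Rightarrow> complex mat" where
  "toeplitz_mat a N = mat N N (\<lambda>(j, k). a (int j - int k))"

definition gaussian_random_mat :: "'w measure \<Rightarrow> nat \<Rightarrow> ('w \<Rightarrow> complex mat) \<Rightarrow> bool" where
  "gaussian_random_mat M N Q \<longleftrightarrow>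
     prob_space M \<and>
     (\<forall>\<omega>\<in>space M. Q \<omega> \<in> carrier_mat N N) \<and>
     (\<forall>j<N. \<forall>k<N. distributed M lborel (\<lambda>\<omega>. Q \<omega> $$ (j, k))
        (\<lambda>\<alpha>. ennreal (exp (- (cmod \<alpha>)\<^sup>2) / pi))) \<and>
     prob_space.indep_vars M (\<lambda>_. borel) (\<lambda>jk \<omega>. Q \<omega> $$ jk) ({..<N} \<times> {..<N})"

text \<open>Eigenvalues are weighted by their algebraic multiplicity, i.e. their order as zeros of the
  characteristic polynomial.\<close>

definition eigenvalue_count :: "complex mat \<Rightarrow> complex set \<Rightarrow> nat" where
  "eigenvalue_count A \<Omega> = (\<Sum>z\<in>spectrum A \<inter> \<Omega>. Polynomial.order z (char_poly A))"

text \<open>Arc length measure on the unit circle, as a Borel measure on the plane of total mass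
  \<open>2 * pi\<close> that is carried by \<open>sphere 0 1\<close>.\<close>

definition circle_measure :: "complex measure" where
  "circle_measure = distr (restrict_space lborel {0..<2 * pi}) borel cis"

text \<open>Derivative with respect to arc length, counterclockwise. The derivative of
  \<open>\<xi> \<mapsto> p (e\<^sup>-\<^sup>i\<^sup>\<xi>)\<close> is its negative at the corresponding point.\<close>

definition circle_deriv :: "(complex \<Rightarrow> complex) \<Rightarrow> complex \<Rightarrow> complex" where
  "circle_deriv p \<zeta> = vector_derivative (\<lambda>t. p (\<zeta> * cis t)) (at 0)"

definition smooth_fun :: "(real \<Rightarrow> real) \<Rightarrow> bool" where
  "smooth_fun f \<longleftrightarrow> (\<forall>n. (deriv ^^ n) f differentiable_on UNIV)"

text \<open>Near each boundary point, and after a rotation of the axes (multiplication by a unimodular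
  \<open>u\<close>), the open set is the part of the plane lying strictly above the graph of a smooth function.\<close>

definition smooth_boundary :: "complex set \<Rightarrow> bool" where
  "smooth_boundary \<Omega> \<longleftrightarrow>
     (\<forall>z0\<in>frontier \<Omega>. \<exists>r>0. \<exists>u f. cmod u = 1 \<and> smooth_fun f \<and>
        \<Omega> \<inter> ball z0 r = {z \<in> ball z0 r. Im (u * z) > f (Re (u * z))})"

text \<open>Velocities at \<open>z\<close> of curves in \<open>S\<close> through \<open>z\<close>. Where \<open>S\<close> is locally an embedded \<open>C\<^sup>1\<close> curve,
  this is its tangent line; asking only for differentiability of \<open>\<gamma>\<close> at \<open>0\<close> gives the same set as
  asking for \<open>C\<^sup>1\<close> curves.\<close>

definition tangent_vectors :: "complex set \<Rightarrow> complex \<Rightarrow> complex set" where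
  "tangent_vectors S z =
     {v. \<exists>\<gamma> :: real \<Rightarrow> complex. \<gamma> 0 = z \<and> (\<forall>\<^sub>F t in nhds 0. \<gamma> t \<in> S) \<and>
           (\<gamma> has_vector_derivative v) (at 0)}"

text \<open>The tangent spaces together span the plane over the reals.\<close>

definition transversal_at :: "complex set \<Rightarrow> complex set \<Rightarrow> complex \<Rightarrow> bool" where
  "transversal_at S T z \<longleftrightarrow>
     real_vector.span (tangent_vectors S z \<union> tangent_vectors T z) = UNIV"

end

theory Submission
  imports Defs "HOL-Real_Asymp.Real_Asymp"
begin

text \<open>The empirical spectral measure of \<open>P + \<delta> Q\<close> is compared with that of the circulant matrix with
  the same symbol, whose eigenvalues are the values of \<open>p\<close> at the \<open>N\<close>-th roots of unity.

  Fix \<open>z\<close> at positive distance from the curve. If the first and last \<open>D\<close> rows of \<open>P + \<delta> Q - z\<close> are replaced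
  by those of the circulant matrix, the result is a Hilbert-Schmidt perturbation of size \<open>O(1 / sqrt D) + o(1)\<close>
  of the normal, boundedly invertible matrix \<open>circulant - z\<close>, so the determinants agree up to a factor
  \<open>exp (o(N))\<close>. Putting the \<open>2 D\<close> rows back one at a time costs at most a factor polynomial in \<open>N\<close> from above,
  and, by the small-ball estimate for one Gaussian entry, a factor about \<open>\<delta> exp (- 2 N\<^sup>\<delta>\<^sup>0)\<close> from below; as \<open>D\<close>
  is bounded this is again \<open>exp (o(N))\<close>. By Fubini's theorem the logarithmic potentials are then close outside
  a set of \<open>z\<close> of small area, and the logarithm is uniformly integrable.

  To pass from potentials to measures without derivatives, let \<open>\<Delta>\<^sub>h\<close> be the four-point difference operator.
  Then \<open>h\<^sup>-\<^sup>2 \<Delta>\<^sub>h ln \<bar>z\<bar>\<close> is an approximate identity, up to a positive constant, because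
  \<open>\<Delta>\<^sub>1 ln \<bar>z\<bar> = ln \<bar>1 - z\<^sup>-\<^sup>4\<bar>\<close> is integrable. Summation by parts therefore turns \<open>L\<^sup>1\<close>-closeness of the
  potentials into closeness of the sums of Lipschitz test functions over the two spectra. Only finitely many
  angles are mapped to \<open>\<partial>\<Omega>\<close>, so squeezing the indicator function of \<open>\<Omega>\<close> between such functions counts the
  eigenvalues.\<close>

section \<open>Linear algebra\<close>

text \<open>The determinant estimate at a fixed z fails on an event that depends on z, and nothing
  makes it uniform in z. Hence the detour through areas: for one outcome the comparison may break
  down on a small set of z, which may well contain eigenvalues, and there uniform integrability is
  the only control. The two directions differ in nature. Once all entries are at most
  \<open>4 * real N powr (\<delta>0 / 2)\<close>, the upper bound is deterministic; only the lower
  bound, which excludes near-cancellation, uses the randomness of the end rows. D can be independent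
  of N because the weight 1 + |nu| makes the mismatch of a row decay like the inverse distance to
  the nearer end, and inverse squares are summable. The noise in the other rows has Hilbert-Schmidt
  norm at most \<delta> N \<tau>, of order at most N to the power 1 + \<delta>0/2 - \<delta>1, which
  is negative since \<delta>0 < 1 and \<delta>1 > 3/2. Eigenvalues are never selected measurably:
  sums over the spectrum are limits of integrals of the logarithm of the determinant, and this makes
  the counting event measurable.\<close>

definition vnorm :: "complex vec \<Rightarrow> real" where
  "vnorm v = L2_set (\<lambda>i. cmod (v $ i)) {..<dim_vec v}"

lemma vnorm_nonneg: "0 \<le> vnorm v"
  by (simp add: vnorm_def L2_set_nonneg)

lemma vnorm_eq_0_imp: "v \<in> carrier_vec n \<Longrightarrow> vnorm v = 0 \<Longrightarrow> v = 0\<^sub>v n"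
  by (intro eq_vecI) (auto simp: vnorm_def L2_set_eq_0_iff)

lemma vnorm_smult: "vnorm (k \<cdot>\<^sub>v v) = cmod k * vnorm v"
proof -
  have "vnorm (k \<cdot>\<^sub>v v) = L2_set (\<lambda>i. cmod k * cmod (v $ i)) {..<dim_vec v}"
    unfolding vnorm_def by (intro L2_set_cong) (auto simp: norm_mult)
  also have "\<dots> = cmod k * vnorm v"
    unfolding vnorm_def by (subst L2_set_right_distrib) auto
  finally show ?thesis .
qed

lemma vnorm_triangle:
  assumes "v \<in> carrier_vec n" "w \<in> carrier_vec n"
  shows "vnorm (v + w) \<le> vnorm v + vnorm w"
proof -
  have "vnorm (v + w) \<le> L2_set (\<lambda>i. cmod (v $ i) + cmod (w $ i)) {..<n}"
    unfolding vnorm_def using assms by (auto intro!: L2_set_mono norm_triangle_ineq)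
  also have "\<dots> \<le> vnorm v + vnorm w"
    unfolding vnorm_def using assms by (auto intro!: L2_set_triangle_ineq)
  finally show ?thesis .
qed

lemma cmod_le_vnorm: "i < dim_vec v \<Longrightarrow> cmod (v $ i) \<le> vnorm v"
  unfolding vnorm_def by (rule member_le_L2_set) auto

lemma vnorm_unit_vec: "j < n \<Longrightarrow> vnorm (unit_vec n j) = 1"
proof -
  assume j: "j < n"
  have "(\<Sum>i<n. (cmod (unit_vec n j $ i))\<^sup>2) = (\<Sum>i<n. if i = j then 1 else 0)"
    using j by (intro sum.cong) (auto simp: unit_vec_def)
  also have "\<dots> = 1" using j by simp
  finally show ?thesis by (simp add: vnorm_def L2_set_def)
qed

text \<open>Cauchy-Schwarz in each row: the Hilbert-Schmidt norm dominates the operator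
  norm.\<close>

lemma vnorm_mult_mat_vec_le:
  assumes A: "A \<in> carrier_mat n n" and v: "v \<in> carrier_vec n"
  shows "vnorm (A *\<^sub>v v) \<le> sqrt (\<Sum>i<n. \<Sum>j<n. (cmod (A $$ (i,j)))\<^sup>2) * vnorm v"
proof -
  have row: "(cmod ((A *\<^sub>v v) $ i))\<^sup>2 \<le> (\<Sum>j<n. (cmod (A $$ (i,j)))\<^sup>2) * (vnorm v)\<^sup>2" if i: "i < n" for i
  proof -
    have "(A *\<^sub>v v) $ i = (\<Sum>j<n. A $$ (i,j) * v $ j)"
      using A v i by (auto simp: scalar_prod_def atLeast0LessThan intro!: sum.cong)
    hence "cmod ((A *\<^sub>v v) $ i) \<le> (\<Sum>j<n. \<bar>cmod (A $$ (i,j))\<bar> * \<bar>cmod (v $ j)\<bar>)"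
      by (auto simp: norm_mult intro!: order.trans[OF norm_sum] sum_mono)
    also have "\<dots> \<le> L2_set (\<lambda>j. cmod (A $$ (i,j))) {..<n} * L2_set (\<lambda>j. cmod (v $ j)) {..<n}"
      by (rule L2_set_mult_ineq)
    also have "\<dots> = L2_set (\<lambda>j. cmod (A $$ (i,j))) {..<n} * vnorm v"
      using v by (simp add: vnorm_def)
    finally have "(cmod ((A *\<^sub>v v) $ i))\<^sup>2 \<le> (L2_set (\<lambda>j. cmod (A $$ (i,j))) {..<n} * vnorm v)\<^sup>2"
      by (intro power_mono) auto
    thus ?thesis by (simp add: power_mult_distrib L2_set_def sum_nonneg)
  qed
  have "vnorm (A *\<^sub>v v) = sqrt (\<Sum>i<n. (cmod ((A *\<^sub>v v) $ i))\<^sup>2)"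
    using A by (simp add: vnorm_def L2_set_def)
  also have "\<dots> \<le> sqrt (\<Sum>i<n. (\<Sum>j<n. (cmod (A $$ (i,j)))\<^sup>2) * (vnorm v)\<^sup>2)"
    using row by (intro real_sqrt_le_mono sum_mono) auto
  also have "\<dots> = sqrt (\<Sum>i<n. \<Sum>j<n. (cmod (A $$ (i,j)))\<^sup>2) * vnorm v"
    by (simp add: sum_distrib_right[symmetric] real_sqrt_mult vnorm_nonneg)
  finally show ?thesis .
qed

text \<open>Expanding the product of row sums yields one term for each map of the index set into
  itself; the Leibniz formula contains just the bijective ones. A row of the identity matrix
  contributes a factor 1, which \<open>det_replace_rows_le\<close> exploits.\<close>

lemma cmod_det_le_prod_row_sums:
  fixes A :: "complex mat"
  assumes A: "A \<in> carrier_mat n n"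
  shows "cmod (Determinant.det A) \<le> (\<Prod>i<n. \<Sum>j<n. cmod (A $$ (i,j)))"
proof -
  let ?P = "{p. p permutes {0..<n}}"
  let ?g = "\<lambda>p. \<Prod>i<n. cmod (A $$ (i, p i))"
  have "cmod (Determinant.det A) \<le> (\<Sum>p\<in>?P. cmod (signof p * (\<Prod>i=0..<n. A $$ (i, p i))))"
    unfolding det_def'[OF A] by (rule norm_sum)
  also have "\<dots> = (\<Sum>p\<in>?P. ?g p)"
    by (intro sum.cong refl) (auto simp: norm_mult prod_norm atLeast0LessThan sign_def)
  \<comment> \<open>Outside the index set a permutation is the identity, whereas members of
    \<open>PiE\<close> are \<open>undefined\<close>; restriction reconciles the two conventions
    without losing injectivity.\<close>
  also have "\<dots> = (\<Sum>f\<in>(\<lambda>p. restrict p {..<n}) ` ?P. ?g f)"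
  proof (subst sum.reindex)
    show "inj_on (\<lambda>p. restrict p {..<n}) ?P"
    proof (rule inj_onI)
      fix p q assume p: "p \<in> ?P" and q: "q \<in> ?P" and eq: "restrict p {..<n} = restrict q {..<n}"
      show "p = q"
      proof
        fix x show "p x = q x"
        proof (cases "x < n")
          case True thus ?thesis using fun_cong[OF eq, of x] by simp
        next
          case False
          hence "p x = x" "q x = x" using p q by (auto simp: permutes_def)
          thus ?thesis by simp
        qed
      qed
    qed
    show "(\<Sum>p\<in>?P. ?g p) = sum (?g \<circ> (\<lambda>p. restrict p {..<n})) ?P"
      by (intro sum.cong) auto
  qed
  also have "\<dots> \<le> (\<Sum>f\<in>PiE {..<n} (\<lambda>_. {..<n}). ?g f)"
  proof (rule sum_mono2)
    show "finite (PiE {..<n} (\<lambda>_. {..<n}))" by (intro finite_PiE) auto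
    show "(\<lambda>p. restrict p {..<n}) ` ?P \<subseteq> PiE {..<n} (\<lambda>_. {..<n})"
    proof (intro image_subsetI)
      fix p assume "p \<in> ?P"
      hence "p permutes {..<n}" by (simp add: atLeast0LessThan)
      thus "restrict p {..<n} \<in> PiE {..<n} (\<lambda>_. {..<n})"
        by (auto dest: permutes_in_image)
    qed
  qed (auto intro: prod_nonneg)
  also have "\<dots> = (\<Prod>i<n. \<Sum>j<n. cmod (A $$ (i,j)))"
    by (subst prod_sum_PiE) auto
  finally show ?thesis .
qed

text \<open>Passing to moduli removes the sign (-1)^n between det (z - A) and det (A - z).\<close>

lemma cmod_poly_char_poly:
  fixes A :: "complex mat"
  assumes A: "A \<in> carrier_mat n n"
  shows "cmod (poly (char_poly A) z)
       = cmod (Determinant.det (mat n n (\<lambda>(i,j). A $$ (i,j) - (if i = j then z else 0))))"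
proof -
  have "char_matrix A z = mat n n (\<lambda>(i,j). A $$ (i,j) - (if i = j then z else 0))"
    using A by (intro eq_matI) (auto simp: char_matrix_def)
  moreover have "- char_matrix A z = (-1) \<cdot>\<^sub>m char_matrix A z"
    by (intro eq_matI) auto
  ultimately show ?thesis
    unfolding char_poly_matrix[OF A] by (simp add: norm_mult norm_power)
qed

lemma cmod_poly_prod_list:
  "cmod (poly (\<Prod>a\<leftarrow>as. [:- a, 1:]) z) = (\<Prod>a\<leftarrow>as. cmod (z - a))" for as :: "complex list"
proof (induction as)
  case (Cons a as)
  have "poly (\<Prod>a\<leftarrow>a # as. [:- a, 1:]) z = (z - a) * poly (\<Prod>a\<leftarrow>as. [:- a, 1:]) z"
    by (simp add: algebra_simps)
  thus ?case using Cons by (simp only: norm_mult list.map prod_list.Cons)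
qed simp

lemma order_prod_list_linear:
  "Polynomial.order z (\<Prod>a\<leftarrow>as. [:- a, 1:]) = count_list as z" for as :: "complex list"
proof (induction as)
  case Nil thus ?case by simp
next
  case (Cons a as)
  have nz: "(\<Prod>a\<leftarrow>as. [:- a, 1:]) \<noteq> (0 :: complex poly)"
    by (auto simp: prod_list_zero_iff)
  have "Polynomial.order z [:- a, 1:] = (if a = z then 1 else 0)"
    using order_power_n_n[of z 1] by (auto simp: order_0I)
  moreover have "[:- a, 1:] * (\<Prod>a\<leftarrow>as. [:- a, 1:]) \<noteq> 0" using nz by (metis mult_eq_0_iff pCons_eq_0_iff zero_neq_one)
  ultimately show ?case using Cons by (simp add: order_mult del: mult_pCons_left)
qed

lemma eigenvalue_count_eq_length_filter:
  assumes A: "A \<in> carrier_mat n n" and as: "char_poly A = (\<Prod>a\<leftarrow>as. [:- a, 1:])"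
  shows "eigenvalue_count A \<Omega> = length (filter (\<lambda>a. a \<in> \<Omega>) as)"
proof -
  have spec: "spectrum A = set as"
    unfolding spectrum_root_char_poly[OF A] as by (induction as) auto
  have "eigenvalue_count A \<Omega> = (\<Sum>z\<in>set as \<inter> \<Omega>. count_list as z)"
    unfolding eigenvalue_count_def spec as order_prod_list_linear ..
  also have "\<dots> = (\<Sum>z\<in>set as \<inter> \<Omega>. count_list (filter (\<lambda>a. a \<in> \<Omega>) as) z)"
  proof (intro sum.cong refl)
    fix z assume "z \<in> set as \<inter> \<Omega>"
    hence "z \<in> \<Omega>" by simp
    thus "count_list as z = count_list (filter (\<lambda>a. a \<in> \<Omega>) as) z" by (induction as) auto
  qed
  also have "\<dots> = length (filter (\<lambda>a. a \<in> \<Omega>) as)"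
    by (rule sum_count_set) auto
  finally show ?thesis .
qed

text \<open>Read the eigenvector equation at a coordinate of largest modulus.\<close>

lemma eigenvalue_le_row_sum:
  fixes A :: "complex mat"
  assumes A: "A \<in> carrier_mat n n" and ev: "eigenvalue A k"
    and K: "\<And>i. i < n \<Longrightarrow> (\<Sum>j<n. cmod (A $$ (i,j))) \<le> K"
  shows "cmod k \<le> K"
proof -
  obtain v where v: "v \<in> carrier_vec n" "v \<noteq> 0\<^sub>v n" "A *\<^sub>v v = k \<cdot>\<^sub>v v"
    using ev A unfolding eigenvalue_def eigenvector_def by auto
  have n: "n > 0" using v(1,2) by (cases n) auto
  define m where "m = Max ((\<lambda>i. cmod (v $ i)) ` {..<n})"
  have "m \<in> (\<lambda>i. cmod (v $ i)) ` {..<n}"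
    unfolding m_def using n by (intro Max_in) auto
  then obtain i where i: "i < n" "m = cmod (v $ i)" by auto
  have le: "cmod (v $ j) \<le> m" if "j < n" for j
    unfolding m_def using that by (intro Max_ge) auto
  have "m \<noteq> 0"
  proof
    assume "m = 0"
    hence "v = 0\<^sub>v n" using v(1) le by (intro eq_vecI) auto
    thus False using v(2) by simp
  qed
  hence m: "m > 0" using i by simp
  have "k * v $ i = (\<Sum>j<n. A $$ (i,j) * v $ j)"
    using arg_cong[OF v(3), of "\<lambda>w. w $ i"] A v(1) i(1)
    by (auto simp: scalar_prod_def atLeast0LessThan intro!: sum.cong)
  hence "cmod k * m \<le> (\<Sum>j<n. cmod (A $$ (i,j)) * cmod (v $ j))"
    by (metis (no_types, lifting) i(2) norm_mult norm_sum sum.cong)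
  also have "\<dots> \<le> (\<Sum>j<n. cmod (A $$ (i,j)) * m)"
    using le by (intro sum_mono mult_left_mono) auto
  also have "\<dots> \<le> K * m"
    unfolding sum_distrib_right[symmetric] using K[OF i(1)] m by (intro mult_right_mono) auto
  finally show ?thesis using m by simp
qed

section \<open>Determinants under relative perturbation and under replacement of rows\<close>

lemma exists_inverse_mat:
  fixes A :: "complex mat"
  assumes A: "A \<in> carrier_mat n n" and d: "Determinant.det A \<noteq> 0"
  obtains B where "B \<in> carrier_mat n n" "A * B = 1\<^sub>m n" "B * A = 1\<^sub>m n"
  using det_non_zero_imp_unit[OF A d, of undefined] unfolding Units_def ring_mat_def by auto

lemma det_nonzero_of_vnorm_bound:
  fixes A :: "complex mat"
  assumes A: "A \<in> carrier_mat n n" and r: "r > 0"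
    and b: "\<And>v. v \<in> carrier_vec n \<Longrightarrow> r * vnorm v \<le> vnorm (A *\<^sub>v v)"
  shows "Determinant.det A \<noteq> 0"
proof
  assume "Determinant.det A = 0"
  then obtain v where v: "v \<in> carrier_vec n" "v \<noteq> 0\<^sub>v n" "A *\<^sub>v v = 0\<^sub>v n"
    using det_0_iff_vec_prod_zero[OF A] by auto
  have "r * vnorm v \<le> 0" using b[OF v(1)] v(3) by (simp add: vnorm_def L2_set_def)
  hence "vnorm v = 0" using r vnorm_nonneg[of v] by (smt (verit) mult_pos_pos)
  thus False using vnorm_eq_0_imp v by blast
qed

text \<open>The quotient of the determinants is the determinant of W, the inverse of A times X,
  hence a product of n eigenvalues of W. If W v = a v, then (X - A) v = (a - 1) A v, and comparing
  the two hypotheses at this v gives |a - 1| \<le> u. Working with eigenvalues avoids singular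
  values altogether.\<close>

lemma det_relative_perturbation:
  fixes A X :: "complex mat"
  assumes A: "A \<in> carrier_mat n n" and X: "X \<in> carrier_mat n n"
    and r: "r > 0" and u: "0 \<le> u" "u < 1"
    and b: "\<And>v. v \<in> carrier_vec n \<Longrightarrow> r * vnorm v \<le> vnorm (A *\<^sub>v v)"
    and p: "\<And>v. v \<in> carrier_vec n \<Longrightarrow> vnorm ((X - A) *\<^sub>v v) \<le> u * r * vnorm v"
  shows "(1 - u) ^ n * cmod (Determinant.det A) \<le> cmod (Determinant.det X)"
    and "cmod (Determinant.det X) \<le> (1 + u) ^ n * cmod (Determinant.det A)"
proof -
  have dA: "Determinant.det A \<noteq> 0" by (rule det_nonzero_of_vnorm_bound[OF A r b])
  obtain V where V: "V \<in> carrier_mat n n" "A * V = 1\<^sub>m n" "V * A = 1\<^sub>m n"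
    using exists_inverse_mat[OF A dA] .
  define W where "W = V * X"
  have W: "W \<in> carrier_mat n n" unfolding W_def using V X by simp
  have "A * W = X" unfolding W_def using A V X
    by (metis assoc_mult_mat left_mult_one_mat)
  hence dX: "Determinant.det X = Determinant.det A * Determinant.det W" using det_mult[OF A W] by simp
  obtain as where as: "char_poly W = (\<Prod>a\<leftarrow>as. [:- a, 1:])" "length as = n"
    using char_poly_factorized[OF W] by auto
  have ev: "cmod (a - 1) \<le> u" if "a \<in> set as" for a
  proof -
    have "poly (char_poly W) a = 0" unfolding as(1) using that by (induction as) auto
    hence "eigenvalue W a" using eigenvalue_root_char_poly[OF W] by simp
    then obtain v where v: "v \<in> carrier_vec n" "v \<noteq> 0\<^sub>v n" "W *\<^sub>v v = a \<cdot>\<^sub>v v"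
      using W unfolding eigenvalue_def eigenvector_def by auto
    have "X *\<^sub>v v = A *\<^sub>v (W *\<^sub>v v)"
      using \<open>A * W = X\<close> A W v(1) by (metis assoc_mult_mat_vec)
    also have "\<dots> = a \<cdot>\<^sub>v (A *\<^sub>v v)" unfolding v(3) using A v(1) by (simp add: mult_mat_vec)
    finally have Xv: "X *\<^sub>v v = a \<cdot>\<^sub>v (A *\<^sub>v v)" .
    have "(X - A) *\<^sub>v v = X *\<^sub>v v - A *\<^sub>v v"
      using X A v(1) by (simp add: minus_mult_distrib_mat_vec)
    also have "\<dots> = (a - 1) \<cdot>\<^sub>v (A *\<^sub>v v)"
      unfolding Xv using A v(1) by (intro eq_vecI) (auto simp: algebra_simps)
    finally have "cmod (a - 1) * vnorm (A *\<^sub>v v) \<le> u * r * vnorm v"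
      using p[OF v(1)] by (simp add: vnorm_smult)
    moreover have "cmod (a - 1) * (r * vnorm v) \<le> cmod (a - 1) * vnorm (A *\<^sub>v v)"
      using b[OF v(1)] by (intro mult_left_mono) auto
    ultimately have "cmod (a - 1) * (r * vnorm v) \<le> u * (r * vnorm v)" by (simp add: mult.assoc)
    moreover have "vnorm v > 0" using vnorm_eq_0_imp[OF v(1)] v(2) vnorm_nonneg[of v] by force
    ultimately show ?thesis using r by simp
  qed
  have "cmod (Determinant.det W) = cmod (poly (char_poly W) 0)"
    unfolding cmod_poly_char_poly[OF W]
    by (intro arg_cong[where f = "\<lambda>A. cmod (Determinant.det A)"] eq_matI) (use W in auto)
  hence dW: "cmod (Determinant.det W) = (\<Prod>a\<leftarrow>as. cmod a)" unfolding as(1) by (simp add: cmod_poly_prod_list)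
  have lo: "1 - u \<le> cmod a" and hi: "cmod a \<le> 1 + u" if "a \<in> set as" for a
    using ev[OF that] norm_triangle_ineq2[of 1 a] norm_triangle_ineq2[of a 1]
    by (auto simp: norm_minus_commute)
  have "(1 - u) ^ length as \<le> (\<Prod>a\<leftarrow>as. cmod a) \<and> (\<Prod>a\<leftarrow>as. cmod a) \<le> (1 + u) ^ length as"
    using lo hi
  proof (induction as)
    case (Cons a as)
    have "(1 - u) ^ length as \<le> (\<Prod>a\<leftarrow>as. cmod a)" "(\<Prod>a\<leftarrow>as. cmod a) \<le> (1 + u) ^ length as"
      using Cons by auto
    moreover have "0 \<le> (1 - u) ^ length as" using u by simp
    moreover have "0 \<le> (\<Prod>a\<leftarrow>as. cmod a)" by (intro prod_list_nonneg) auto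
    moreover have "1 - u \<le> cmod a" "cmod a \<le> 1 + u" using Cons.prems by auto
    ultimately show ?case using u by (auto intro!: mult_mono)
  qed auto
  hence W2: "(1 - u) ^ n \<le> cmod (Determinant.det W)" "cmod (Determinant.det W) \<le> (1 + u) ^ n"
    using as(2) dW by auto
  show "(1 - u) ^ n * cmod (Determinant.det A) \<le> cmod (Determinant.det X)"
    unfolding dX norm_mult using W2(1) by (metis mult.commute mult_right_mono norm_ge_zero)
  show "cmod (Determinant.det X) \<le> (1 + u) ^ n * cmod (Determinant.det A)"
    unfolding dX norm_mult using W2(2) by (metis mult.commute mult_right_mono norm_ge_zero)
qed

text \<open>Y times the inverse of X has the rows of the identity outside \<open>J\<close>. The
  columns of the inverse have norm at most 1 / r, so the entries of the remaining rows are at most K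
  / r. Only rows in \<open>J\<close> cost anything in the row-sum bound for the determinant.\<close>

lemma det_replace_rows_le:
  fixes X Y :: "complex mat"
  assumes X: "X \<in> carrier_mat n n" and Y: "Y \<in> carrier_mat n n"
    and r: "r > 0"
    and b: "\<And>v. v \<in> carrier_vec n \<Longrightarrow> r * vnorm v \<le> vnorm (X *\<^sub>v v)"
    and J: "J \<subseteq> {..<n}"
    and eq: "\<And>i j. i < n \<Longrightarrow> i \<notin> J \<Longrightarrow> j < n \<Longrightarrow> Y $$ (i,j) = X $$ (i,j)"
    and K: "\<And>i. i \<in> J \<Longrightarrow> (\<Sum>j<n. cmod (Y $$ (i,j))) \<le> K"
  shows "cmod (Determinant.det Y) \<le> (real n * K / r) ^ card J * cmod (Determinant.det X)"
proof -
  have dX: "Determinant.det X \<noteq> 0" by (rule det_nonzero_of_vnorm_bound[OF X r b])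
  obtain V where V: "V \<in> carrier_mat n n" "X * V = 1\<^sub>m n" "V * X = 1\<^sub>m n"
    using exists_inverse_mat[OF X dX] .
  define D where "D = Y * V"
  have D: "D \<in> carrier_mat n n" unfolding D_def using V Y by simp
  have "D * X = Y" unfolding D_def using X V Y
    by (metis assoc_mult_mat right_mult_one_mat)
  hence dY: "Determinant.det Y = Determinant.det D * Determinant.det X" using det_mult[OF D X] by simp
  have Vb: "cmod (V $$ (l,j)) \<le> 1 / r" if l: "l < n" and j: "j < n" for l j
  proof -
    have c: "col V j \<in> carrier_vec n" using V by auto
    have "X *\<^sub>v col V j = col (X * V) j" using X V j by (subst col_mult2[of _ n n _ n]) auto
    hence "X *\<^sub>v col V j = unit_vec n j" using V(2) j by simp
    hence "r * vnorm (col V j) \<le> 1" using b[OF c] vnorm_unit_vec[OF j] by simp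
    moreover have "cmod (col V j $ l) \<le> vnorm (col V j)" using V l by (intro cmod_le_vnorm) auto
    ultimately show ?thesis using r V l j by (simp add: field_simps)
      (smt (verit) mult_left_mono mult.commute)
  qed
  have Dij: "D $$ (i,j) = (\<Sum>l<n. Y $$ (i,l) * V $$ (l,j))" if "i < n" "j < n" for i j
    unfolding D_def using Y V that by (auto simp: scalar_prod_def atLeast0LessThan intro!: sum.cong)
  have good: "(\<Sum>j<n. cmod (D $$ (i,j))) = 1" if i: "i < n" "i \<notin> J" for i
  proof -
    have "D $$ (i,j) = (if i = j then 1 else 0)" if j: "j < n" for j
    proof -
      have "D $$ (i,j) = (X * V) $$ (i,j)"
        unfolding Dij[OF i(1) j] using eq[OF i] X V(1) i j
        by (auto simp: scalar_prod_def atLeast0LessThan intro!: sum.cong)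
      thus ?thesis unfolding V(2) using i j by simp
    qed
    hence "(\<Sum>j<n. cmod (D $$ (i,j))) = (\<Sum>j<n. if i = j then 1 else 0)"
      by (intro sum.cong) auto
    thus ?thesis using i by simp
  qed
  have bad: "(\<Sum>j<n. cmod (D $$ (i,j))) \<le> real n * K / r" if i: "i \<in> J" for i
  proof -
    have i': "i < n" using J i by auto
    have "cmod (D $$ (i,j)) \<le> K / r" if j: "j < n" for j
    proof -
      have "cmod (D $$ (i,j)) \<le> (\<Sum>l<n. cmod (Y $$ (i,l)) * cmod (V $$ (l,j)))"
        unfolding Dij[OF i' j] by (rule order.trans[OF norm_sum]) (simp add: norm_mult)
      also have "\<dots> \<le> (\<Sum>l<n. cmod (Y $$ (i,l)) * (1 / r))"
        using Vb j by (intro sum_mono mult_left_mono) auto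
      also have "\<dots> \<le> K / r"
        unfolding sum_distrib_right[symmetric] using K[OF i] r by (simp add: divide_right_mono)
      finally show ?thesis .
    qed
    hence "(\<Sum>j<n. cmod (D $$ (i,j))) \<le> (\<Sum>j<n. K / r)" by (intro sum_mono) auto
    thus ?thesis by simp
  qed
  have "cmod (Determinant.det D) \<le> (\<Prod>i<n. \<Sum>j<n. cmod (D $$ (i,j)))"
    by (rule cmod_det_le_prod_row_sums[OF D])
  also have "\<dots> \<le> (\<Prod>i<n. if i \<in> J then real n * K / r else 1)"
    using good bad by (intro prod_mono) (auto intro: sum_nonneg)
  also have "\<dots> = (\<Prod>i\<in>{..<n} \<inter> J. real n * K / r)"
    by (subst prod.inter_restrict) auto
  also have "\<dots> = (real n * K / r) ^ card J" using J by (simp add: Int_absorb1)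
  finally show ?thesis unfolding dY norm_mult by (intro mult_right_mono) auto
qed

section \<open>The logarithm in the plane\<close>

lemma emeasure_ball_complex: "0 \<le> r \<Longrightarrow> emeasure lborel (ball (c::complex) r) = ennreal (pi * r\<^sup>2)"
  by (simp add: emeasure_ball unit_ball_vol_2)

lemma emeasure_cball_complex: "0 \<le> r \<Longrightarrow> emeasure lborel (cball (c::complex) r) = ennreal (pi * r\<^sup>2)"
  by (simp add: emeasure_cball unit_ball_vol_2)

lemma measure_cball_complex: "0 \<le> r \<Longrightarrow> measure lborel (cball (c::complex) r) = pi * r\<^sup>2"
  by (simp add: measure_def emeasure_cball_complex)

lemma measure_ball_complex: "0 \<le> r \<Longrightarrow> measure lborel (ball (c::complex) r) = pi * r\<^sup>2"
  by (simp add: measure_def emeasure_ball_complex)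

lemma borel_measurable_ln_cmod [measurable]: "(\<lambda>z::complex. ln (cmod z)) \<in> borel_measurable borel"
  by (intro borel_measurable_ln borel_measurable_norm)

lemma cball_sets_borel [measurable]: "cball (c::complex) r \<in> sets borel"
  by (simp add: borel_closed)

lemma ball_sets_borel [measurable]: "ball (c::complex) r \<in> sets borel"
  by (simp add: borel_open)

lemma integrable_translate:
  fixes f :: "complex \<Rightarrow> real"
  assumes "integrable lborel f"
  shows "integrable lborel (\<lambda>x. f (x + a))"
proof -
  have "integrable (distr lborel borel ((+) a)) f"
    unfolding lborel_distr_plus by (rule assms)
  from integrable_distr[OF _ this] show ?thesis by (simp add: add.commute)
qed

lemma integral_translate:
  fixes f :: "complex \<Rightarrow> real"
  assumes "f \<in> borel_measurable borel"
  shows "(LINT x|lborel. f (x + a)) = (LINT x|lborel. f x)"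
proof -
  have "(LINT x|lborel. f x) = (LINT x|distr lborel borel ((+) a). f x)"
    unfolding lborel_distr_plus ..
  also have "\<dots> = (LINT x|lborel. f (a + x))"
    using assms by (intro integral_distr) auto
  finally show ?thesis by (simp add: add.commute)
qed

lemma integral_affine:
  fixes f :: "complex \<Rightarrow> real"
  assumes "f \<in> borel_measurable borel" and h: "h > 0"
  shows "(LINT x|lborel. f x) = h\<^sup>2 * (LINT y|lborel. f (l + of_real h * y))"
proof -
  have "(LINT x|lborel. f x) = (LINT x|density (distr lborel borel (\<lambda>x. l + h *\<^sub>R x)) (\<lambda>x. ennreal (\<bar>h\<bar> ^ DIM(complex))). f x)"
    using h by (subst lborel_affine[of h l]) auto
  also have "\<dots> = (LINT x|distr lborel borel (\<lambda>x. l + h *\<^sub>R x). h\<^sup>2 * f x)"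
    using assms by (subst integral_density) auto
  also have "\<dots> = (LINT y|lborel. h\<^sup>2 * f (l + h *\<^sub>R y))"
    using assms by (subst integral_distr) auto
  also have "\<dots> = h\<^sup>2 * (LINT y|lborel. f (l + of_real h * y))"
    by (simp add: scaleR_conv_of_real)
  finally show ?thesis .
qed

text \<open>Layer-cake bound: \<open>\<bar>ln \<bar>z\<bar>\<bar>\<close> is dominated near \<open>0\<close> by the number of balls
  \<open>\<bar>z\<bar> < e\<^sup>-\<^sup>n\<close> that contain \<open>z\<close>.\<close>

lemma integrable_ln_cmod:
  "integrable lborel (\<lambda>z::complex. indicator (cball 0 R) z * ln (cmod z))"
proof (rule integrableI_bounded)
  show "(\<lambda>z::complex. indicator (cball 0 R) z * ln (cmod z)) \<in> borel_measurable lborel"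
    by simp
  let ?B = "\<lambda>n. ball (0::complex) (exp (- real n))"
  let ?L = "\<bar>ln R\<bar>"
  have le: "ennreal (norm (indicator (cball 0 R) z * ln (cmod z)))
      \<le> (\<Sum>n. indicator (?B n) z) + ennreal ?L * indicator (cball 0 R) z" for z :: complex
  proof (cases "z = 0 \<or> z \<notin> cball 0 R")
    case True thus ?thesis by auto
  next
    case False
    hence z: "cmod z > 0" "cmod z \<le> R" by auto
    show ?thesis
    proof (cases "cmod z \<ge> 1")
      case True
      hence "0 \<le> ln (cmod z)" "ln (cmod z) \<le> ln R" using z by simp_all
      hence "norm (ln (cmod z)) \<le> ?L" by simp
      hence "ennreal (norm (indicator (cball 0 R) z * ln (cmod z))) \<le> ennreal ?L * indicator (cball 0 R) z"
        using z by (auto simp: ennreal_leI)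
      thus ?thesis by (rule order.trans) auto
    next
      case F: False
      \<comment> \<open>Rounding up makes the number of balls that contain z at least
        \<open>- ln (cmod z)\<close>.\<close>
      define m where "m = nat \<lceil>- ln (cmod z)\<rceil>"
      have pos: "- ln (cmod z) > 0" using F z by simp
      have "z \<in> ?B n" if "n < m" for n
      proof -
        have "real n < - ln (cmod z)" using that pos unfolding m_def by linarith
        hence "ln (cmod z) < - real n" by simp
        hence "cmod z < exp (- real n)" using z(1) by (metis exp_less_mono exp_ln)
        thus ?thesis by simp
      qed
      hence "(\<Sum>n<m. indicator (?B n) z :: ennreal) = (\<Sum>n<m. 1)" by (intro sum.cong) auto
      also have "\<dots> = ennreal (real m)" by (simp add: ennreal_of_nat_eq_real_of_nat)
      finally have "ennreal (real m) \<le> (\<Sum>n. indicator (?B n) z)"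
        by (metis sum_le_suminf summableI finite_lessThan zero_le)
      moreover have "norm (indicator (cball 0 R) z * ln (cmod z)) \<le> real m"
      proof -
        have "norm (indicator (cball 0 R) z * ln (cmod z)) = - ln (cmod z)" using z pos by simp
        also have "\<dots> \<le> real m" unfolding m_def using pos by linarith
        finally show ?thesis .
      qed
      ultimately show ?thesis
        by (meson add_increasing2 dual_order.trans ennreal_leI zero_le)
    qed
  qed
  have "(\<integral>\<^sup>+ z. ennreal (norm (indicator (cball 0 R) z * ln (cmod z))) \<partial>lborel)
      \<le> (\<integral>\<^sup>+ z. (\<Sum>n. indicator (?B n) z) + ennreal ?L * indicator (cball 0 R) z \<partial>lborel)"
    by (intro nn_integral_mono le)
  also have "\<dots> = (\<Sum>n. emeasure lborel (?B n)) + ennreal ?L * emeasure lborel (cball (0::complex) R)"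
    by (subst nn_integral_add) (auto simp: nn_integral_suminf nn_integral_cmult)
  also have "\<dots> < \<infinity>"
  proof -
    have "(\<Sum>n. emeasure lborel (?B n)) = (\<Sum>n. ennreal (pi * (exp (-2)) ^ n))"
      by (intro suminf_cong) (simp add: emeasure_ball_complex exp_of_nat_mult[symmetric] power2_eq_square exp_add[symmetric])
    also have "\<dots> = ennreal (\<Sum>n. pi * (exp (-2)) ^ n)"
      by (intro suminf_ennreal2 summable_mult summable_geometric) auto
    finally have "(\<Sum>n. emeasure lborel (?B n)) < \<infinity>" by simp
    moreover have "emeasure lborel (cball (0::complex) R) < \<infinity>" by (rule emeasure_lborel_cball_finite)
    ultimately show ?thesis by (simp add: ennreal_mult_less_top)
  qed
  finally show "(\<integral>\<^sup>+ z. ennreal (norm (indicator (cball 0 R) z * ln (cmod z))) \<partial>lborel) < \<infinity>" .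
qed

lemma integrable_bounded_mult_ln:
  fixes f :: "complex \<Rightarrow> real"
  assumes f: "f \<in> borel_measurable borel" and B: "\<And>z. \<bar>f z\<bar> \<le> B"
    and supp: "\<And>z. cmod z > R \<Longrightarrow> f z = 0"
  shows "integrable lborel (\<lambda>z. f z * ln (cmod (z - l)))"
proof -
  have i: "integrable lborel (\<lambda>z. B * (indicator (cball 0 (R + cmod l)) (z + - l) * ln (cmod (z + - l))))"
    by (intro integrable_mult_right integrable_translate[OF integrable_ln_cmod])
  have le: "\<bar>f z * ln (cmod (z - l))\<bar> \<le> \<bar>B * (indicator (cball 0 (R + cmod l)) (z + - l) * ln (cmod (z + - l)))\<bar>" for z
  proof (cases "cmod z > R")
    case True thus ?thesis by (simp add: supp)
  next
    case False
    hence "cmod (z - l) \<le> R + cmod l" using norm_triangle_ineq4[of z l] by linarith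
    moreover have "B \<ge> 0" using B[of 0] by linarith
    ultimately show ?thesis using B[of z] by (auto simp: abs_mult intro!: mult_right_mono)
  qed
  have "(\<lambda>z. ln (cmod (z + - l))) \<in> borel_measurable borel"
    using measurable_compose[of "\<lambda>z. z + - l" borel borel "\<lambda>z. ln (cmod z)"] by simp
  hence m: "(\<lambda>z. f z * ln (cmod (z - l))) \<in> borel_measurable lborel"
    using f by (simp add: borel_measurable_times)
  show ?thesis
    by (rule Bochner_Integration.integrable_bound[OF i m AE_I2]) (simp only: real_norm_def le)
qed

text \<open>Translation by l turns every one of these logarithms into the same function on the disc
  of radius 2 R, so one truncation height n serves all l: the part above n has integral below
  \<epsilon>/2, and the part below n contributes at most n times the area of S.\<close>

lemma ln_uniformly_integrable:
  assumes eps: "\<epsilon> > 0"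
  obtains \<kappa> where "\<kappa> > 0"
    "\<And>S l. S \<in> sets borel \<Longrightarrow> S \<subseteq> cball 0 R \<Longrightarrow> measure lborel S \<le> \<kappa> \<Longrightarrow> cmod l \<le> R \<Longrightarrow>
       (LINT z|lborel. indicator S z * \<bar>ln (cmod (z - l))\<bar>) \<le> \<epsilon>"
proof -
  define g where "g = (\<lambda>z::complex. indicator (cball 0 (2 * R)) z * \<bar>ln (cmod z)\<bar>)"
  have g: "integrable lborel g"
    using integrable_abs[OF integrable_ln_cmod[of "2 * R"]]
    by (simp add: g_def abs_mult)
  have gm[measurable]: "g \<in> borel_measurable borel" using g by (simp add: borel_measurable_integrable)
  have "(\<lambda>n. LINT z|lborel. max 0 (g z - real n)) \<longlonglongrightarrow> (LINT z|(lborel :: complex measure). (0::real))"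
  proof (rule integral_dominated_convergence[where w = g])
    show "AE z in lborel. (\<lambda>n. max 0 (g z - real n)) \<longlonglongrightarrow> 0"
    proof (rule AE_I2)
      fix z
      have "eventually (\<lambda>n. max 0 (g z - real n) = 0) sequentially"
        using eventually_ge_at_top[of "nat \<lceil>g z\<rceil>"] by eventually_elim linarith
      thus "(\<lambda>n. max 0 (g z - real n)) \<longlonglongrightarrow> 0" by (rule tendsto_eventually)
    qed
    show "AE z in lborel. norm (max 0 (g z - real n)) \<le> g z" for n
      by (rule AE_I2) (auto simp: g_def)
  qed (use g in auto)
  hence "eventually (\<lambda>n. (LINT z|lborel. max 0 (g z - real n)) < \<epsilon> / 2) sequentially"
    using eps by (intro order_tendstoD) auto
  then obtain n where n: "(LINT z|lborel. max 0 (g z - real n)) < \<epsilon> / 2"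
    by (auto simp: eventually_sequentially)
  \<comment> \<open>The summand 1 keeps the denominator positive when n = 0.\<close>
  define \<kappa> where "\<kappa> = \<epsilon> / (2 * (real n + 1))"
  have \<kappa>: "\<kappa> > 0" using eps by (simp add: \<kappa>_def)
  have ig: "integrable lborel (\<lambda>z. max 0 (g z - real n))"
    by (rule Bochner_Integration.integrable_bound[OF g]) (auto simp: g_def)
  show ?thesis
  proof (rule that[OF \<kappa>])
    fix S :: "complex set" and l :: complex
    assume S[measurable]: "S \<in> sets borel" and SR: "S \<subseteq> cball 0 R" and m: "measure lborel S \<le> \<kappa>"
      and l: "cmod l \<le> R"
    have fin: "emeasure lborel S < \<infinity>"
      by (rule le_less_trans[OF emeasure_mono[OF SR] emeasure_lborel_cball_finite]) simp
    have le: "indicator S z * \<bar>ln (cmod (z - l))\<bar> \<le> real n * indicator S z + max 0 (g (z + - l) - real n)" for z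
    proof (cases "z \<in> S")
      case True
      hence "cmod (z - l) \<le> 2 * R" using SR l norm_triangle_ineq4[of z l] by force
      thus ?thesis using True by (simp add: g_def)
    qed auto
    have "(LINT z|lborel. indicator S z * \<bar>ln (cmod (z - l))\<bar>)
       \<le> (LINT z|lborel. real n * indicator S z + max 0 (g (z + - l) - real n))"
    proof (rule integral_mono[OF _ _ le])
      have "integrable lborel (\<lambda>z. indicator S z * ln (cmod (z - l)))"
        by (rule integrable_bounded_mult_ln[of _ 1 R]) (use SR in \<open>auto simp: indicator_def\<close>)
      from integrable_abs[OF this] show "integrable lborel (\<lambda>z. indicator S z * \<bar>ln (cmod (z - l))\<bar>)"
        by (simp add: abs_mult)
      show "integrable lborel (\<lambda>z. real n * indicator S z + max 0 (g (z + - l) - real n))"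
        using fin by (intro Bochner_Integration.integrable_add integrable_mult_right integrable_translate[OF ig]) auto
    qed
    also have "\<dots> = real n * measure lborel S + (LINT z|lborel. max 0 (g z - real n))"
      using fin integrable_translate[OF ig, of "-l"] integral_translate[of "\<lambda>z. max 0 (g z - real n)" "-l"]
      by (subst Bochner_Integration.integral_add) auto
    also have "\<dots> \<le> real n * \<kappa> + \<epsilon> / 2" using n m by (intro add_mono mult_left_mono) auto
    also have "real n * \<kappa> \<le> \<epsilon> / 2" using eps unfolding \<kappa>_def by (simp add: field_simps)
    finally show "(LINT z|lborel. indicator S z * \<bar>ln (cmod (z - l))\<bar>) \<le> \<epsilon>" by simp
  qed
qed

section \<open>The difference kernel of the logarithm as an approximate identity\<close>

definition log_kernel :: "complex \<Rightarrow> real" where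
  "log_kernel y = ln (cmod (y + 1)) + ln (cmod (y - 1)) + ln (cmod (y + \<i>)) + ln (cmod (y - \<i>))
     - 4 * ln (cmod y)"

definition cross_diff :: "real \<Rightarrow> (complex \<Rightarrow> real) \<Rightarrow> complex \<Rightarrow> real" where
  "cross_diff h f z = f (z + of_real h) + f (z - of_real h) + f (z + of_real h * \<i>) + f (z - of_real h * \<i>)
     - 4 * f z"

lemma log_kernel_measurable [measurable]: "log_kernel \<in> borel_measurable borel"
proof -
  have [measurable]: "(\<lambda>z. ln (cmod (z + a))) \<in> borel_measurable borel" for a
    using measurable_compose[of "\<lambda>z. z + a" borel borel "\<lambda>z. ln (cmod z)"] by simp
  have "(\<lambda>y. ln (cmod (y + 1)) + ln (cmod (y + - 1)) + ln (cmod (y + \<i>)) + ln (cmod (y + - \<i>))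
     - 4 * ln (cmod y)) \<in> borel_measurable borel" by measurable
  thus ?thesis by (simp add: log_kernel_def[abs_def])
qed

lemma abs_ln_one_minus_le:
  fixes u :: complex
  assumes "cmod u \<le> 1 / 2"
  shows "\<bar>ln (cmod (1 - u))\<bar> \<le> 2 * cmod u"
proof -
  let ?t = "cmod u"
  have lo: "1 - ?t \<le> cmod (1 - u)" using norm_triangle_ineq2[of 1 u] by simp
  have hi: "cmod (1 - u) \<le> 1 + ?t" using norm_triangle_ineq4[of 1 u] by simp
  have pos: "0 < 1 - ?t" using assms by simp
  have "ln (cmod (1 - u)) \<le> ln (1 + ?t)" using lo hi pos by (subst ln_le_cancel_iff) linarith+
  also have "\<dots> \<le> ?t" by (rule ln_add_one_self_le_self) simp
  finally have A: "ln (cmod (1 - u)) \<le> 2 * ?t" using norm_ge_zero[of u] by linarith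
  have "?t * ?t \<le> ?t * (1/2)" using assms by (intro mult_left_mono) auto
  hence "- ?t - 2 * ?t\<^sup>2 \<ge> - 2 * ?t" by (simp add: power2_eq_square)
  moreover have "ln (1 - ?t) \<ge> - ?t - 2 * ?t\<^sup>2" using assms by (intro ln_one_minus_pos_lower_bound) auto
  moreover have "ln (1 - ?t) \<le> ln (cmod (1 - u))" using lo pos by (subst ln_le_cancel_iff) linarith+
  ultimately show ?thesis using A by linarith
qed

text \<open>\<open>(y + 1) (y - 1) (y + \<i>) (y - \<i>) = y\<^sup>4 - 1\<close>, so the kernel is \<open>ln \<bar>1 - y\<^sup>-\<^sup>4\<bar>\<close>.\<close>

lemma log_kernel_decay:
  assumes "cmod y \<ge> 2"
  shows "\<bar>log_kernel y\<bar> \<le> 2 * cmod y powr (-4)"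
proof -
  have nz: "y \<noteq> 0" "y + 1 \<noteq> 0" "y - 1 \<noteq> 0" "y + \<i> \<noteq> 0" "y - \<i> \<noteq> 0"
  proof -
    show "y \<noteq> 0" using assms by auto
    have "y \<noteq> w" if "cmod w = 1" for w using assms that by auto
    from this[of "-1"] this[of 1] this[of "-\<i>"] this[of \<i>]
    show "y + 1 \<noteq> 0" "y - 1 \<noteq> 0" "y + \<i> \<noteq> 0" "y - \<i> \<noteq> 0" by (auto simp: add_eq_0_iff2)
  qed
  have "log_kernel y = ln (cmod (1 - inverse y ^ 4))"
  proof -
    have "ln (cmod (y + 1)) + ln (cmod (y - 1)) + ln (cmod (y + \<i>)) + ln (cmod (y - \<i>))
       = ln (cmod ((y + 1) * (y - 1) * ((y + \<i>) * (y - \<i>))))"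
      using nz by (simp add: norm_mult ln_mult)
    also have "(y + 1) * (y - 1) * ((y + \<i>) * (y - \<i>)) = y ^ 4 - 1"
      by (simp add: algebra_simps power4_eq_xxxx)
    also have "y ^ 4 - 1 = y ^ 4 * (1 - inverse y ^ 4)"
      using nz(1) by (simp add: algebra_simps power_inverse)
    also have "cmod \<dots> = cmod y ^ 4 * cmod (1 - inverse y ^ 4)" by (simp add: norm_mult norm_power)
    finally have A: "ln (cmod (y + 1)) + ln (cmod (y - 1)) + ln (cmod (y + \<i>)) + ln (cmod (y - \<i>))
       = ln (cmod y ^ 4 * cmod (1 - inverse y ^ 4))" .
    have "cmod y ^ 4 \<ge> 2 ^ 4" using assms by (intro power_mono) auto
    hence "inverse y ^ 4 \<noteq> 1" by (metis norm_one norm_power norm_inverse inverse_1 inverse_inverse_eq power_inverse one_less_numeral_iff not_le numeral_One one_less_power order.strict_trans1 semiring_norm(76) zero_less_numeral)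
    thus ?thesis unfolding log_kernel_def A using nz(1) by (simp add: ln_mult ln_realpow)
  qed
  moreover have "cmod (inverse y ^ 4) = cmod y powr (-4)"
    using nz(1) by (simp add: norm_power norm_inverse powr_minus power_inverse)
  moreover have "cmod y powr (-4) \<le> 2 powr (-4)" using assms by (intro powr_mono2') auto
  moreover have "(2::real) powr (-4) \<le> 1/2" by (simp add: powr_minus)
  ultimately show ?thesis using abs_ln_one_minus_le[of "inverse y ^ 4"] by simp
qed

text \<open>Inside the disc of radius 2 there are five logarithmic singularities, each integrable.
  Outside, the dyadic shell from 2^n to 2^(n+1) has area of order 4^n and the kernel is at most 2 /
  16^n on it, so the contributions form a geometric series.\<close>

lemma integrable_log_kernel: "integrable lborel log_kernel"
proof -
  define f where "f = (\<lambda>y. indicator (cball 0 2) y * log_kernel y)"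
  define g where "g = (\<lambda>y. indicator (- cball 0 2) y * log_kernel y)"
  have ind: "integrable lborel (\<lambda>y. indicator (cball 0 2) y * ln (cmod (y - l)))" for l :: complex
    by (rule integrable_bounded_mult_ln[of _ 1 2]) (auto simp: indicator_def)
  have f: "integrable lborel f"
  proof -
    have "integrable lborel (\<lambda>y. indicator (cball 0 2) y * ln (cmod (y - (-1))) + indicator (cball 0 2) y * ln (cmod (y - 1))
      + indicator (cball 0 2) y * ln (cmod (y - (-\<i>))) + indicator (cball 0 2) y * ln (cmod (y - \<i>)) - 4 * (indicator (cball 0 2) y * ln (cmod (y - 0))))"
      by (intro Bochner_Integration.integrable_add Bochner_Integration.integrable_diff integrable_mult_right ind)
    thus ?thesis unfolding f_def log_kernel_def by (simp add: algebra_simps)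
  qed
  have g: "integrable lborel g"
  proof (rule integrableI_bounded)
    show "g \<in> borel_measurable lborel" unfolding g_def by simp
    let ?b = "\<lambda>n::nat. ennreal (2 * (1/16) ^ n)"
    have le: "ennreal (norm (g y)) \<le> (\<Sum>n. ?b n * indicator (ball 0 (2 ^ (n+1))) y)" for y
    proof (cases "y \<in> cball 0 2")
      case True thus ?thesis by (simp add: g_def)
    next
      case False
      hence y: "cmod y > 2" by simp
      have "\<exists>n. cmod y < 2 ^ (n+1)"
      proof -
        obtain n where "cmod y < 2 ^ n" using real_arch_pow[of 2 "cmod y"] by auto
        also have "(2::real) ^ n \<le> 2 ^ (n+1)" by simp
        finally show ?thesis by blast
      qed
      define n where "n = (LEAST n. cmod y < 2 ^ (n+1))"
      have n: "cmod y < 2 ^ (n+1)" unfolding n_def by (rule LeastI_ex) fact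
      have n0: "n > 0" using n y by (cases n) auto
      have "\<not> cmod y < 2 ^ ((n - 1) + 1)" using not_less_Least[of "n - 1" "\<lambda>n. cmod y < 2 ^ (n+1)"] n0 unfolding n_def[symmetric] by auto
      hence "2 ^ n \<le> cmod y" using n0 by simp
      hence "cmod y powr (-4) \<le> (2 ^ n) powr (-4)" by (intro powr_mono2') auto
      also have "\<dots> = (1/16) ^ n"
      proof -
        have "((2::real) ^ n) ^ 4 = 16 ^ n"
          using power_mult[of "2::real" n 4] power_mult[of "2::real" 4 n] by (simp add: mult.commute)
        thus ?thesis by (simp add: powr_minus powr_numeral power_divide inverse_eq_divide)
      qed
      finally have "norm (g y) \<le> 2 * (1/16) ^ n"
        using log_kernel_decay[of y] y by (auto simp: g_def)
      hence "ennreal (norm (g y)) \<le> ?b n * indicator (ball 0 (2 ^ (n+1))) y" using n by (simp add: ennreal_leI)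
      also have "\<dots> \<le> (\<Sum>n. ?b n * indicator (ball 0 (2 ^ (n+1))) y)"
      proof -
        define F where "F = (\<lambda>n. ?b n * indicator (ball 0 (2 ^ (n+1))) y)"
        have "sum F {n} \<le> suminf F" by (rule sum_le_suminf) auto
        thus ?thesis by (simp only: F_def sum.insert sum.empty finite.emptyI empty_iff not_False_eq_True add_0_right)
      qed
      finally show ?thesis .
    qed
    have "(\<integral>\<^sup>+ y. ennreal (norm (g y)) \<partial>lborel) \<le> (\<integral>\<^sup>+ y. (\<Sum>n. ?b n * indicator (ball (0::complex) (2 ^ (n+1))) y) \<partial>lborel)"
      by (intro nn_integral_mono le)
    also have "\<dots> = (\<Sum>n. ?b n * emeasure lborel (ball (0::complex) (2 ^ (n+1))))"
      by (subst nn_integral_suminf) (auto simp: nn_integral_cmult)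
    also have "\<dots> = (\<Sum>n. ennreal (8 * pi * (1/4) ^ n))"
    proof (intro suminf_cong)
      fix n :: nat
      have "(2 * (1/16) ^ n) * (pi * (2 ^ (n+1))\<^sup>2) = 8 * pi * (1/4::real) ^ n"
      proof -
        have "((2::real) ^ (n+1))\<^sup>2 = 4 * 4 ^ n"
          using power_mult[of "2::real" n 2] power_mult[of "2::real" 2 n] by (simp add: power_mult_distrib mult.commute)
        moreover have "(1/16) ^ n * 4 ^ n = (1/4::real) ^ n" by (simp add: power_mult_distrib[symmetric])
        ultimately show ?thesis by simp
      qed
      thus "?b n * emeasure lborel (ball (0::complex) (2 ^ (n+1))) = ennreal (8 * pi * (1/4) ^ n)"
        by (simp add: emeasure_ball_complex ennreal_mult[symmetric] del: power_Suc)
    qed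
    also have "\<dots> = ennreal (\<Sum>n. 8 * pi * (1/4) ^ n)"
      by (intro suminf_ennreal2 summable_mult summable_geometric) auto
    also have "\<dots> < \<infinity>" by simp
    finally show "(\<integral>\<^sup>+ y. ennreal (norm (g y)) \<partial>lborel) < \<infinity>" .
  qed
  have "log_kernel = (\<lambda>y. f y + g y)" by (auto simp: f_def g_def indicator_def)
  thus ?thesis using Bochner_Integration.integrable_add[OF f g] by simp
qed

text \<open>The minimum lets \<open>2 * B * \<bar>log_kernel y\<bar>\<close> dominate, so dominated
  convergence applies without an estimate of the first moment of the kernel.\<close>

lemma log_kernel_approx_identity_error:
  fixes B L :: real
  assumes "B \<ge> 0" "L \<ge> 0"
  shows "(\<lambda>n. LINT y|lborel. min (2 * B) (L * inverse (real (Suc n)) * cmod y) * \<bar>log_kernel y\<bar>) \<longlonglongrightarrow> 0"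
proof -
  have "(\<lambda>n. LINT y|lborel. min (2 * B) (L * inverse (real (Suc n)) * cmod y) * \<bar>log_kernel y\<bar>)
     \<longlonglongrightarrow> (LINT y|(lborel :: complex measure). (0::real))"
  proof (rule integral_dominated_convergence[where w = "\<lambda>y. 2 * B * \<bar>log_kernel y\<bar>"])
    show "integrable lborel (\<lambda>y. 2 * B * \<bar>log_kernel y\<bar>)"
      by (intro integrable_mult_right integrable_abs integrable_log_kernel)
    show "AE y in lborel. (\<lambda>n. min (2 * B) (L * inverse (real (Suc n)) * cmod y) * \<bar>log_kernel y\<bar>) \<longlonglongrightarrow> 0"
    proof (rule AE_I2)
      fix y
      have "(\<lambda>n. min (2 * B) (L * inverse (real (Suc n)) * cmod y) * \<bar>log_kernel y\<bar>) \<longlonglongrightarrow> min (2 * B) (L * 0 * cmod y) * \<bar>log_kernel y\<bar>"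
        by (intro tendsto_intros LIMSEQ_inverse_real_of_nat)
      thus "(\<lambda>n. min (2 * B) (L * inverse (real (Suc n)) * cmod y) * \<bar>log_kernel y\<bar>) \<longlonglongrightarrow> 0"
        using assms by simp
    qed
    show "AE y in lborel. norm (min (2 * B) (L * inverse (real (Suc n)) * cmod y) * \<bar>log_kernel y\<bar>) \<le> 2 * B * \<bar>log_kernel y\<bar>" for n
      using assms by (intro AE_I2) (auto simp: abs_mult intro!: mult_right_mono)
  qed auto
  thus ?thesis by simp
qed

text \<open>Near l the Lipschitz bound controls the oscillation of \<phi>, far away its supremum
  does. The error does not depend on l, so it can later be summed over all eigenvalues at a cost
  proportional to N.\<close>

lemma log_kernel_approx_identity:
  fixes \<phi> :: "complex \<Rightarrow> real"
  assumes lip: "L-lipschitz_on UNIV \<phi>" and B: "\<And>z. \<bar>\<phi> z\<bar> \<le> B" and h: "h > 0"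
  shows "\<bar>(LINT y|lborel. \<phi> (l + of_real h * y) * log_kernel y) - (LINT y|lborel. log_kernel y) * \<phi> l\<bar>
    \<le> (LINT y|lborel. min (2 * B) (L * h * cmod y) * \<bar>log_kernel y\<bar>)"
proof -
  have [measurable]: "\<phi> \<in> borel_measurable borel"
    using lip by (intro borel_measurable_continuous_onI lipschitz_on_continuous_on) auto
  have B0: "B \<ge> 0" using B[of 0] by linarith
  have L0: "L \<ge> 0" using lip by (rule lipschitz_on_nonneg)
  have i1: "integrable lborel (\<lambda>y. \<phi> (l + of_real h * y) * log_kernel y)"
    by (rule Bochner_Integration.integrable_bound[OF integrable_mult_right[OF integrable_abs[OF integrable_log_kernel], of B]])
       (use B B0 in \<open>auto simp: abs_mult intro!: mult_right_mono\<close>)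
  have i2: "integrable lborel (\<lambda>y. \<phi> l * log_kernel y)" by (intro integrable_mult_right integrable_log_kernel)
  have i3: "integrable lborel (\<lambda>y. min (2 * B) (L * h * cmod y) * \<bar>log_kernel y\<bar>)"
    by (rule Bochner_Integration.integrable_bound[OF integrable_mult_right[OF integrable_abs[OF integrable_log_kernel], of "2 * B"]])
       (use B0 L0 h in \<open>auto simp: abs_mult intro!: mult_right_mono\<close>)
  have "(LINT y|lborel. \<phi> (l + of_real h * y) * log_kernel y) - (LINT y|lborel. log_kernel y) * \<phi> l
     = (LINT y|lborel. \<phi> (l + of_real h * y) * log_kernel y - \<phi> l * log_kernel y)"
    by (subst Bochner_Integration.integral_diff[OF i1 i2]) (simp add: mult.commute)
  also have "\<bar>\<dots>\<bar> \<le> (LINT y|lborel. \<bar>\<phi> (l + of_real h * y) * log_kernel y - \<phi> l * log_kernel y\<bar>)"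
    by (rule integral_abs_bound)
  also have "\<dots> \<le> (LINT y|lborel. min (2 * B) (L * h * cmod y) * \<bar>log_kernel y\<bar>)"
  proof (rule integral_mono[OF _ i3])
    show "integrable lborel (\<lambda>y. \<bar>\<phi> (l + of_real h * y) * log_kernel y - \<phi> l * log_kernel y\<bar>)"
      by (intro integrable_abs Bochner_Integration.integrable_diff i1 i2)
    fix y
    have "\<bar>\<phi> (l + of_real h * y) - \<phi> l\<bar> \<le> L * h * cmod y"
      using lipschitz_onD[OF lip, of "l + of_real h * y" l] h by (simp add: dist_norm norm_mult)
    moreover have "\<bar>\<phi> (l + of_real h * y) - \<phi> l\<bar> \<le> 2 * B"
      using B[of "l + of_real h * y"] B[of l] by linarith
    ultimately show "\<bar>\<phi> (l + of_real h * y) * log_kernel y - \<phi> l * log_kernel y\<bar> \<le> min (2 * B) (L * h * cmod y) * \<bar>log_kernel y\<bar>"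
      by (simp add: left_diff_distrib[symmetric] abs_mult mult_right_mono)
  qed
  finally show ?thesis .
qed

lemma cross_diff_measurable [measurable]:
  assumes [measurable]: "\<phi> \<in> borel_measurable borel"
  shows "cross_diff h \<phi> \<in> borel_measurable borel"
proof -
  have [measurable]: "(\<lambda>z. \<phi> (z + a)) \<in> borel_measurable borel" for a
    using measurable_compose[of "\<lambda>z. z + a" borel borel \<phi>] by simp
  have "(\<lambda>z. \<phi> (z + of_real h) + \<phi> (z + - of_real h) + \<phi> (z + of_real h * \<i>) + \<phi> (z + - (of_real h * \<i>))
     - 4 * \<phi> z) \<in> borel_measurable borel" by measurable
  thus ?thesis by (simp add: cross_diff_def[abs_def])
qed

lemma cross_diff_bound:
  assumes "\<And>z. \<bar>\<phi> z\<bar> \<le> B"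
  shows "\<bar>cross_diff h \<phi> z\<bar> \<le> 8 * B"
  using assms[of "z + of_real h"] assms[of "z - of_real h"] assms[of "z + of_real h * \<i>"]
    assms[of "z - of_real h * \<i>"] assms[of z]
  unfolding cross_diff_def by linarith

lemma cross_diff_support:
  assumes supp: "\<And>z. cmod z > R \<Longrightarrow> \<phi> z = 0" and h: "h \<ge> 0" and z: "cmod z > R + h"
  shows "cross_diff h \<phi> z = 0"
proof -
  have "cmod (z + w) > R" if "cmod w \<le> h" for w
    using norm_triangle_ineq2[of z "-w"] that z by simp
  from this[of "of_real h"] this[of "- of_real h"] this[of "of_real h * \<i>"] this[of "- (of_real h * \<i>)"] this[of 0]
  show ?thesis using h supp unfolding cross_diff_def by (simp add: norm_mult)
qed

lemma integrable_bounded_support: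
  fixes f :: "complex \<Rightarrow> real"
  assumes f: "f \<in> borel_measurable borel" and B: "\<And>z. \<bar>f z\<bar> \<le> B"
    and supp: "\<And>z. cmod z > R \<Longrightarrow> f z = 0"
  shows "integrable lborel f"
proof (rule Bochner_Integration.integrable_bound[where f = "\<lambda>z. B * indicator (cball 0 R) z"])
  show "integrable lborel (\<lambda>z::complex. B * indicator (cball 0 R) z)"
    using emeasure_lborel_cball_finite[of "0::complex" R] by (intro integrable_mult_right integrable_real_indicator) auto
  show "AE z in lborel. norm (f z) \<le> norm (B * indicator (cball 0 R) z)"
  proof (rule AE_I2)
    fix z
    show "norm (f z) \<le> norm (B * indicator (cball 0 R) z)"
    proof (cases "cmod z > R")
      case True thus ?thesis by (simp add: supp)
    next
      case False thus ?thesis using B[of z] by (simp add: indicator_def)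
    qed
  qed
qed (use f in simp)

text \<open>The weights of the five points add up to 0. This removes the term \<open>ln h\<close>
  that appears when the logarithm is rescaled.\<close>

lemma integral_cross_diff_zero:
  assumes f: "\<phi> \<in> borel_measurable borel" and B: "\<And>z. \<bar>\<phi> z\<bar> \<le> B"
    and supp: "\<And>z. cmod z > R \<Longrightarrow> \<phi> z = 0"
  shows "(LINT z|lborel. cross_diff h \<phi> z) = 0"
proof -
  have i: "integrable lborel (\<lambda>z. \<phi> (z + a))" for a
    by (intro integrable_translate integrable_bounded_support[OF f B supp])
  have e: "(LINT z|lborel. \<phi> (z + a)) = (LINT z|lborel. \<phi> z)" for a
    by (rule integral_translate[OF f])
  have "(LINT z|lborel. cross_diff h \<phi> z) = (LINT z|lborel. \<phi> (z + of_real h) + \<phi> (z + - of_real h) + \<phi> (z + of_real h * \<i>) + \<phi> (z + - (of_real h * \<i>))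
     - 4 * \<phi> (z + 0))" by (simp add: cross_diff_def)
  also have "\<dots> = (LINT z|lborel. \<phi> (z + of_real h)) + (LINT z|lborel. \<phi> (z + - of_real h)) + (LINT z|lborel. \<phi> (z + of_real h * \<i>)) + (LINT z|lborel. \<phi> (z + - (of_real h * \<i>)))
     - 4 * (LINT z|lborel. \<phi> (z + 0))"
    by (simp only: Bochner_Integration.integral_add Bochner_Integration.integral_diff Bochner_Integration.integrable_add
          integral_mult_right_zero integrable_mult_right i)
  also have "\<dots> = 0" by (simp only: e)
  finally show ?thesis .
qed

text \<open>Summation by parts: the difference operator moves from the logarithm to \<open>\<phi>\<close>.\<close>

lemma integral_log_kernel_eq_cross_diff:
  assumes f[measurable]: "\<phi> \<in> borel_measurable borel" and B: "\<And>z. \<bar>\<phi> z\<bar> \<le> B"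
    and supp: "\<And>z. cmod z > R \<Longrightarrow> \<phi> z = 0" and h: "h > 0"
  shows "(LINT y|lborel. \<phi> (l + of_real h * y) * log_kernel y)
       = (LINT z|lborel. cross_diff h \<phi> z * ln (cmod (z - l))) / h\<^sup>2"
proof -
  let ?p = "\<lambda>y. \<phi> (l + of_real h * y)"
  have pm[measurable]: "?p \<in> borel_measurable borel"
    using measurable_compose[of "\<lambda>y. l + of_real h * y" borel borel \<phi>] by simp
  have psupp: "?p y = 0" if "cmod y > (R + cmod l) / h" for y
  proof (rule supp)
    have "R + cmod l < h * cmod y" using that h by (simp add: field_simps)
    moreover have "h * cmod y - cmod l \<le> cmod (l + of_real h * y)"
      using norm_triangle_ineq2[of "of_real h * y" "- l"] h by (simp add: norm_mult add.commute)
    ultimately show "R < cmod (l + of_real h * y)" by linarith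
  qed
  have i: "integrable lborel (\<lambda>y. ?p y * ln (cmod (y - w)))" for w
    by (rule integrable_bounded_mult_ln[OF pm _ psupp]) (rule B)
  have s: "(LINT y|lborel. ?p y * ln (cmod (y - w))) = (LINT y|lborel. ?p (y + w) * ln (cmod y))" for w
  proof -
    have [measurable]: "(\<lambda>z. ln (cmod (z + - w))) \<in> borel_measurable borel"
      using measurable_compose[of "\<lambda>z. z + - w" borel borel "\<lambda>z. ln (cmod z)"] by simp
    have "(\<lambda>y. ?p y * ln (cmod (y + - w))) \<in> borel_measurable borel" by measurable
    from integral_translate[OF this, of w] show ?thesis by simp
  qed
  have i': "integrable lborel (\<lambda>y. ?p (y + w) * ln (cmod y))" for w
    using integrable_translate[OF i[of w], of w] by simp
  have "(LINT y|lborel. ?p y * log_kernel y) = (LINT y|lborel. ?p y * ln (cmod (y - (-1))) + ?p y * ln (cmod (y - 1))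
      + ?p y * ln (cmod (y - (-\<i>))) + ?p y * ln (cmod (y - \<i>)) - 4 * (?p y * ln (cmod (y - 0))))"
    by (simp add: log_kernel_def algebra_simps)
  also have "\<dots> = (LINT y|lborel. ?p y * ln (cmod (y - (-1)))) + (LINT y|lborel. ?p y * ln (cmod (y - 1)))
      + (LINT y|lborel. ?p y * ln (cmod (y - (-\<i>)))) + (LINT y|lborel. ?p y * ln (cmod (y - \<i>))) - 4 * (LINT y|lborel. ?p y * ln (cmod (y - 0)))"
    by (simp only: Bochner_Integration.integral_add Bochner_Integration.integral_diff Bochner_Integration.integrable_add
          integral_mult_right_zero integrable_mult_right i)
  also have "\<dots> = (LINT y|lborel. ?p (y + (-1)) * ln (cmod y)) + (LINT y|lborel. ?p (y + 1) * ln (cmod y))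
      + (LINT y|lborel. ?p (y + (-\<i>)) * ln (cmod y)) + (LINT y|lborel. ?p (y + \<i>) * ln (cmod y)) - 4 * (LINT y|lborel. ?p (y + 0) * ln (cmod y))"
    by (simp only: s)
  also have "\<dots> = (LINT y|lborel. ?p (y + (-1)) * ln (cmod y) + ?p (y + 1) * ln (cmod y)
      + ?p (y + (-\<i>)) * ln (cmod y) + ?p (y + \<i>) * ln (cmod y) - 4 * (?p (y + 0) * ln (cmod y)))"
    by (simp only: Bochner_Integration.integral_add Bochner_Integration.integral_diff Bochner_Integration.integrable_add
          integral_mult_right_zero integrable_mult_right i')
  also have "\<dots> = (LINT y|lborel. cross_diff h \<phi> (l + of_real h * y) * ln (cmod y))"
    by (intro Bochner_Integration.integral_cong refl) (simp add: cross_diff_def algebra_simps)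
  \<comment> \<open>Under z = l + h y the logarithm of |y| becomes that of |z - l| minus
    \<open>ln h\<close>.\<close>
  also have "\<dots> = (LINT z|lborel. cross_diff h \<phi> z * (ln (cmod (z - l)) - ln h)) / h\<^sup>2"
  proof -
    let ?F = "\<lambda>z. cross_diff h \<phi> z * (ln (cmod (z - l)) - ln h)"
    have [measurable]: "(\<lambda>z. ln (cmod (z + - l))) \<in> borel_measurable borel"
      using measurable_compose[of "\<lambda>z. z + - l" borel borel "\<lambda>z. ln (cmod z)"] by simp
    have m: "?F \<in> borel_measurable borel"
    proof -
      have "(\<lambda>z. cross_diff h \<phi> z * (ln (cmod (z + - l)) - ln h)) \<in> borel_measurable borel" by measurable
      thus ?thesis by simp
    qed
    have mc: "(\<lambda>y. cross_diff h \<phi> (l + of_real h * y)) \<in> borel_measurable borel"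
      using measurable_compose[of "\<lambda>y. l + of_real h * y" borel borel "cross_diff h \<phi>"] by simp
    have "(LINT y|lborel. cross_diff h \<phi> (l + of_real h * y) * ln (cmod y)) = (LINT y|lborel. ?F (l + of_real h * y))"
    proof (rule integral_cong_AE)
      show "AE y in lborel. cross_diff h \<phi> (l + of_real h * y) * ln (cmod y) = ?F (l + of_real h * y)"
      \<comment> \<open>At y = 0 the logarithm has only its default value and does not turn products
        into sums, so the two integrands are compared almost everywhere.\<close>
      proof (rule AE_mp[OF AE_lborel_singleton[of 0]], rule AE_I2, rule impI)
        fix y :: complex assume "y \<noteq> 0"
        hence "ln (cmod (of_real h * y)) = ln h + ln (cmod y)" using h by (simp add: norm_mult ln_mult)
        thus "cross_diff h \<phi> (l + of_real h * y) * ln (cmod y) = ?F (l + of_real h * y)" by simp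
      qed
      show "(\<lambda>y. cross_diff h \<phi> (l + of_real h * y) * ln (cmod y)) \<in> borel_measurable lborel"
        using mc by (simp add: borel_measurable_times)
      show "(\<lambda>y. ?F (l + of_real h * y)) \<in> borel_measurable lborel"
        using measurable_compose[OF _ m, of "\<lambda>y. l + of_real h * y" borel] by simp
    qed
    thus ?thesis using integral_affine[OF m h, of l] h by simp
  qed
  also have "(LINT z|lborel. cross_diff h \<phi> z * (ln (cmod (z - l)) - ln h))
     = (LINT z|lborel. cross_diff h \<phi> z * ln (cmod (z - l))) - ln h * (LINT z|lborel. cross_diff h \<phi> z)"
  proof -
    have c1: "\<bar>cross_diff h \<phi> z\<bar> \<le> 8 * B" for z by (rule cross_diff_bound[OF B])
    have c2: "cross_diff h \<phi> z = 0" if "cmod z > R + h" for z using cross_diff_support[OF supp _ that] h by simp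
    have "integrable lborel (\<lambda>z. cross_diff h \<phi> z * ln (cmod (z - l)))"
      by (rule integrable_bounded_mult_ln[OF _ c1 c2]) auto
    moreover have "integrable lborel (\<lambda>z. ln h * cross_diff h \<phi> z)"
      by (rule integrable_mult_right[OF integrable_bounded_support[OF _ c1 c2]]) auto
    moreover have "(LINT z|lborel. cross_diff h \<phi> z * (ln (cmod (z - l)) - ln h))
       = (LINT z|lborel. cross_diff h \<phi> z * ln (cmod (z - l)) - ln h * cross_diff h \<phi> z)"
      by (intro Bochner_Integration.integral_cong refl) (simp add: algebra_simps)
    ultimately show ?thesis by simp
  qed
  also have "(LINT z|lborel. cross_diff h \<phi> z) = 0" by (rule integral_cross_diff_zero[OF f B supp])
  finally show ?thesis by simp
qed

section \<open>Positivity of the total mass of the kernel\<close>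

definition log_kernel_mass :: real where
  "log_kernel_mass = (LINT y|lborel. log_kernel y)"

text \<open>Tested on \<open>\<phi> z = max 0 (1 - \<bar>z\<bar>\<^sup>2)\<close> at \<open>0\<close>: the scaled difference is \<open>-4\<close> on the disc of
  radius \<open>1 - h\<close>, and the contribution of the remaining annulus tends to \<open>0\<close> because the logarithm
  vanishes on the unit circle.\<close>

lemma log_kernel_mass_pos: "log_kernel_mass > 0"
proof -
  define \<phi> :: "complex \<Rightarrow> real" where "\<phi> = (\<lambda>z. max 0 (1 - (cmod z)\<^sup>2))"
  have lip: "2-lipschitz_on UNIV \<phi>"
  proof (rule lipschitz_onI)
    fix z w :: complex
    have *: "\<phi> z - \<phi> w \<le> 2 * \<bar>cmod z - cmod w\<bar>" for z w
    proof (cases "cmod z < 1")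
      case False
      hence "\<phi> z = 0" using one_le_power[of "cmod z" 2] unfolding \<phi>_def by simp
      moreover have "\<phi> w \<ge> 0" unfolding \<phi>_def by simp
      ultimately show ?thesis by (smt (verit))
    next
      case T: True
      hence z1: "\<phi> z = 1 - (cmod z)\<^sup>2" using power_le_one[of "cmod z" 2] unfolding \<phi>_def by simp
      \<comment> \<open>Clipping at 1 does not change \<open>\<phi> w\<close>, and it puts both
        moduli into the unit interval, where their sum is at most 2.\<close>
      define v where "v = min 1 (cmod w)"
      have w1: "\<phi> w = 1 - v\<^sup>2"
        using one_le_power[of "cmod w" 2] power_le_one[of "cmod w" 2] unfolding \<phi>_def v_def by (auto simp: min_def)
      have v: "0 \<le> v" "v \<le> 1" unfolding v_def by auto
      have "\<phi> z - \<phi> w = (v - cmod z) * (v + cmod z)" unfolding z1 w1 by (simp add: power2_eq_square algebra_simps)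
      also have "\<dots> \<le> \<bar>v - cmod z\<bar> * 2"
        by (rule order.trans[OF mult_right_mono[OF abs_ge_self] mult_left_mono]) (use T v in auto)
      also have "\<bar>v - cmod z\<bar> \<le> \<bar>cmod z - cmod w\<bar>" using T unfolding v_def by (auto simp: min_def)
      finally show ?thesis by (smt (verit))
    qed
    have "\<bar>cmod z - cmod w\<bar> \<le> dist z w" by (simp add: dist_norm norm_triangle_ineq3)
    hence "\<phi> z - \<phi> w \<le> 2 * dist z w" "\<phi> w - \<phi> z \<le> 2 * dist z w"
      using *[of z w] *[of w z] by (smt (verit))+
    thus "dist (\<phi> z) (\<phi> w) \<le> 2 * dist z w" unfolding dist_real_def by (intro abs_leI) linarith+
  qed auto
  have [measurable]: "\<phi> \<in> borel_measurable borel"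
    using lip by (intro borel_measurable_continuous_onI lipschitz_on_continuous_on) auto
  have B: "\<bar>\<phi> z\<bar> \<le> 1" for z by (simp add: \<phi>_def)
  have supp: "\<phi> z = 0" if "cmod z > 1" for z
    using that one_le_power[of "cmod z" 2] by (simp add: \<phi>_def)
  \<comment> \<open>The first term: on the disc of radius 1/2, of area pi/4, the integrand is at
    least 4 h^2 ln 2. The second: on the annulus of area 4 pi h around the unit circle the
    difference is at most 8 h and the logarithm at most 2 h. Both are then divided by h^2.\<close>
  have lower: "(LINT y|lborel. \<phi> (0 + of_real h * y) * log_kernel y) \<ge> pi * ln 2 - 64 * pi * h"
    if h: "0 < h" "h \<le> 1 / 4" for h
  proof -
    have le: "4 * ln 2 * h\<^sup>2 * indicator (cball 0 (1/2)) z - 16 * h\<^sup>2 * (indicator (cball 0 (1 + h)) z - indicator (cball 0 (1 - h)) z)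
        \<le> cross_diff h \<phi> z * ln (cmod (z - 0))" if z: "z \<noteq> 0" for z
    proof (cases "cmod z \<le> 1 - h")
      case True
      have le1: "cmod (z + w) \<le> 1" if "cmod w \<le> h" for w
        using norm_triangle_ineq[of z w] that True by linarith
      have ph: "\<phi> (z + w) = 1 - (cmod (z + w))\<^sup>2" if "cmod w \<le> h" for w
        using power_le_one[of "cmod (z + w)" 2] le1[OF that] by (simp add: \<phi>_def)
      have "cross_diff h \<phi> z = - 4 * h\<^sup>2"
        using ph[of "of_real h"] ph[of "- of_real h"] ph[of "of_real h * \<i>"] ph[of "- (of_real h * \<i>)"] ph[of 0] h
        unfolding cross_diff_def cmod_power2 by (simp add: norm_mult power2_eq_square algebra_simps)
      moreover have "ln (cmod z) \<le> 0" using True z h by simp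
      moreover have "cmod z \<le> 1/2 \<Longrightarrow> ln (cmod z) \<le> - ln 2"
      proof -
        assume "cmod z \<le> 1/2"
        hence "ln (cmod z) \<le> ln (1/2)" using z by (subst ln_le_cancel_iff) auto
        thus ?thesis by (simp add: ln_div)
      qed
      ultimately have D: "cross_diff h \<phi> z * ln (cmod z) = 4 * h\<^sup>2 * (- ln (cmod z))"
        and t: "0 \<le> - ln (cmod z)" "cmod z \<le> 1/2 \<Longrightarrow> ln 2 \<le> - ln (cmod z)" by auto
      have "4 * h\<^sup>2 * (if cmod z \<le> 1/2 then ln 2 else 0) \<le> 4 * h\<^sup>2 * (- ln (cmod z))"
        using t by (intro mult_left_mono) auto
      also have "\<dots> = cross_diff h \<phi> z * ln (cmod (z - 0))" using D by simp
      finally have E: "4 * h\<^sup>2 * (if cmod z \<le> 1/2 then ln 2 else 0) \<le> cross_diff h \<phi> z * ln (cmod (z - 0))" .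
      have "indicator (cball 0 (1 + h)) z = (1::real)" "indicator (cball 0 (1 - h)) z = (1::real)"
        "indicator (cball 0 (1/2)) z = (if cmod z \<le> 1/2 then 1 else 0 :: real)"
        using True h by (auto simp: indicator_def)
      hence "4 * ln 2 * h\<^sup>2 * indicator (cball 0 (1/2)) z - 16 * h\<^sup>2 * (indicator (cball 0 (1 + h)) z - indicator (cball 0 (1 - h)) z)
        = 4 * h\<^sup>2 * (if cmod z \<le> 1/2 then ln 2 else 0)" by simp
      thus ?thesis using E by (simp only:)
    next
      case False
      hence n12: "\<not> cmod z \<le> 1/2" using h by simp
      show ?thesis
      proof (cases "cmod z \<le> 1 + h")
        case True
        have d: "\<bar>\<phi> (z + w) - \<phi> z\<bar> \<le> 2 * h" if "cmod w = h" for w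
          using lipschitz_onD[OF lip, of "z + w" z] that by (simp add: dist_norm)
        have "\<bar>cross_diff h \<phi> z\<bar> \<le> 8 * h"
          using d[of "of_real h"] d[of "- of_real h"] d[of "of_real h * \<i>"] d[of "- (of_real h * \<i>)"] h
          unfolding cross_diff_def by (simp add: norm_mult)
        moreover have "\<bar>ln (cmod z)\<bar> \<le> 2 * h"
        proof -
          have "ln (cmod z) \<le> ln (1 + h)" using z True h by (subst ln_le_cancel_iff) auto
          also have "\<dots> \<le> h" using h by (intro ln_add_one_self_le_self) auto
          finally have up: "ln (cmod z) \<le> h" .
          have "ln (1 - h) \<le> ln (cmod z)" using z False h by (subst ln_le_cancel_iff) auto
          moreover have "- h - 2 * h\<^sup>2 \<le> ln (1 - h)" using h by (intro ln_one_minus_pos_lower_bound) auto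
          moreover have "2 * h\<^sup>2 \<le> h" using h mult_left_mono[of h "1/4" h] by (simp add: power2_eq_square)
          ultimately show ?thesis using up h by linarith
        qed
        ultimately have "\<bar>cross_diff h \<phi> z\<bar> * \<bar>ln (cmod z)\<bar> \<le> (8 * h) * (2 * h)"
          using h by (intro mult_mono) auto
        hence "cross_diff h \<phi> z * ln (cmod z) \<ge> - 16 * h\<^sup>2"
          unfolding abs_mult[symmetric] by (simp add: power2_eq_square abs_le_iff)
        thus ?thesis using False True n12 by simp
      next
        case F2: False
        hence "cross_diff h \<phi> z = 0" using cross_diff_support[of 1 \<phi> h z, OF supp] h by simp
        thus ?thesis using False F2 n12 by simp
      qed
    qed
    have c1: "\<bar>cross_diff h \<phi> z\<bar> \<le> 8 * 1" for z by (rule cross_diff_bound[OF B])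
    have c2: "cross_diff h \<phi> z = 0" if "cmod z > 1 + h" for z using cross_diff_support[OF supp _ that] h by simp
    have fin: "emeasure lborel (cball (0::complex) r) < \<infinity>" for r by (rule emeasure_lborel_cball_finite)
    have ii: "integrable lborel (\<lambda>z::complex. indicator (cball 0 r) z :: real)" for r
      using fin by (intro integrable_real_indicator) auto
    have "(LINT z|lborel. 4 * ln 2 * h\<^sup>2 * indicator (cball 0 (1/2)) z - 16 * h\<^sup>2 * (indicator (cball 0 (1 + h)) z - indicator (cball 0 (1 - h)) (z::complex)))
       \<le> (LINT z|lborel. cross_diff h \<phi> z * ln (cmod (z - 0)))"
    proof (rule integral_mono_AE)
      show "AE z in lborel. 4 * ln 2 * h\<^sup>2 * indicator (cball 0 (1/2)) z - 16 * h\<^sup>2 * (indicator (cball 0 (1 + h)) z - indicator (cball 0 (1 - h)) z)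
        \<le> cross_diff h \<phi> z * ln (cmod (z - 0))"
        by (rule AE_mp[OF AE_lborel_singleton[of 0]], rule AE_I2, rule impI, rule le)
      show "integrable lborel (\<lambda>z. cross_diff h \<phi> z * ln (cmod (z - 0)))"
        by (rule integrable_bounded_mult_ln[OF _ c1 c2]) auto
    qed (intro Bochner_Integration.integrable_diff integrable_mult_right ii)
    also have "(LINT z|lborel. 4 * ln 2 * h\<^sup>2 * indicator (cball 0 (1/2)) z - 16 * h\<^sup>2 * (indicator (cball 0 (1 + h)) z - indicator (cball 0 (1 - h)) (z::complex)))
       = 4 * ln 2 * h\<^sup>2 * (pi * (1/2)\<^sup>2) - 16 * h\<^sup>2 * (pi * (1 + h)\<^sup>2 - pi * (1 - h)\<^sup>2)"
      using h ii by (simp add: measure_cball_complex)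
    also have "\<dots> = h\<^sup>2 * (pi * ln 2 - 64 * pi * h)" by (simp add: power2_eq_square algebra_simps)
    finally have *: "h\<^sup>2 * (pi * ln 2 - 64 * pi * h) \<le> (LINT z|lborel. cross_diff h \<phi> z * ln (cmod (z - 0)))" .
    have "(LINT y|lborel. \<phi> (0 + of_real h * y) * log_kernel y)
       = (LINT z|lborel. cross_diff h \<phi> z * ln (cmod (z - 0))) / h\<^sup>2"
      by (rule integral_log_kernel_eq_cross_diff[OF \<open>\<phi> \<in> borel_measurable borel\<close> B supp h(1)])
    moreover have "pi * ln 2 - 64 * pi * h \<le> (LINT z|lborel. cross_diff h \<phi> z * ln (cmod (z - 0))) / h\<^sup>2"
      using * h by (simp add: le_divide_eq mult.commute)
    ultimately show ?thesis by linarith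
  qed
  define e where "e = (\<lambda>n. LINT y|lborel. min (2 * 1) (2 * inverse (real (Suc n)) * cmod y) * \<bar>log_kernel y\<bar>)"
  have e: "e \<longlonglongrightarrow> 0" unfolding e_def by (rule log_kernel_approx_identity_error) auto
  have ev: "eventually (\<lambda>n. pi * ln 2 - 64 * pi * inverse (real (Suc n)) - e n \<le> log_kernel_mass) sequentially"
    using eventually_ge_at_top[of 4]
  proof eventually_elim
    case (elim n)
    let ?h = "inverse (real (Suc n))"
    have "?h \<le> inverse 4" using elim by (intro le_imp_inverse_le) auto
    hence "(LINT y|lborel. \<phi> (0 + of_real ?h * y) * log_kernel y) \<ge> pi * ln 2 - 64 * pi * ?h"
      by (intro lower) auto
    moreover have "\<bar>(LINT y|lborel. \<phi> (0 + of_real ?h * y) * log_kernel y) - (LINT y|lborel. log_kernel y) * \<phi> 0\<bar> \<le> e n"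
      unfolding e_def by (rule log_kernel_approx_identity[OF lip B]) auto
    moreover have "\<phi> 0 = 1" by (simp add: \<phi>_def)
    ultimately show ?case unfolding log_kernel_mass_def by simp
  qed
  have "(\<lambda>n. pi * ln 2 - 64 * pi * inverse (real (Suc n)) - e n) \<longlonglongrightarrow> pi * ln 2 - 64 * pi * 0 - 0"
    by (intro tendsto_intros LIMSEQ_inverse_real_of_nat e)
  from tendsto_upperbound[OF this ev] have "pi * ln 2 \<le> log_kernel_mass" by simp
  moreover have "pi * ln 2 > 0" by simp
  ultimately show ?thesis by linarith
qed

section \<open>Sums of test functions recovered from logarithmic potentials\<close>

lemma integrable_sum_list:
  fixes f :: "'b \<Rightarrow> 'a \<Rightarrow> real"
  assumes "\<And>a. a \<in> set as \<Longrightarrow> integrable M (f a)"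
  shows "integrable M (\<lambda>x. \<Sum>a\<leftarrow>as. f a x)"
  using assms by (induction as) auto

lemma integral_sum_list:
  fixes f :: "'b \<Rightarrow> 'a \<Rightarrow> real"
  assumes "\<And>a. a \<in> set as \<Longrightarrow> integrable M (f a)"
  shows "(LINT x|M. (\<Sum>a\<leftarrow>as. f a x)) = (\<Sum>a\<leftarrow>as. LINT x|M. f a x)"
  using assms by (induction as) (auto simp: integrable_sum_list)

lemma abs_sum_list_le:
  fixes f :: "'a \<Rightarrow> real"
  shows "\<bar>\<Sum>a\<leftarrow>as. f a\<bar> \<le> (\<Sum>a\<leftarrow>as. \<bar>f a\<bar>)"
  by (induction as) auto

lemma sum_list_le_length_mult:
  fixes f :: "'a \<Rightarrow> real"
  assumes "\<And>a. a \<in> set as \<Longrightarrow> f a \<le> c"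
  shows "(\<Sum>a\<leftarrow>as. f a) \<le> c * real (length as)"
  using assms
proof (induction as)
  case (Cons a as)
  have "f a \<le> c" "(\<Sum>a\<leftarrow>as. f a) \<le> c * real (length as)" using Cons by auto
  thus ?case by (simp add: algebra_simps)
qed simp

context
  fixes \<phi> :: "complex \<Rightarrow> real" and L B R :: real
  assumes lip: "L-lipschitz_on UNIV \<phi>" and B: "\<And>z. \<bar>\<phi> z\<bar> \<le> B"
    and supp: "\<And>z. cmod z > R \<Longrightarrow> \<phi> z = 0"
begin

lemma test_function_measurable: "\<phi> \<in> borel_measurable borel"
  using lip by (intro borel_measurable_continuous_onI lipschitz_on_continuous_on) auto

lemma integrable_cross_diff_ln:
  assumes "h > 0"
  shows "integrable lborel (\<lambda>z. cross_diff h \<phi> z * ln (cmod (z - l)))"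
proof (rule integrable_bounded_mult_ln)
  show "cross_diff h \<phi> \<in> borel_measurable borel" using test_function_measurable by simp
  show "\<bar>cross_diff h \<phi> z\<bar> \<le> 8 * B" for z by (rule cross_diff_bound[OF B])
  show "cross_diff h \<phi> z = 0" if "cmod z > R + h" for z
    using cross_diff_support[OF supp _ that] assms by simp
qed

lemma log_potential_test_error:
  obtains e where "e \<longlonglongrightarrow> 0"
    "\<And>n l. \<bar>(LINT z|lborel. cross_diff (inverse (real (Suc n))) \<phi> z * ln (cmod (z - l))) / (inverse (real (Suc n)))\<^sup>2
        - log_kernel_mass * \<phi> l\<bar> \<le> e n"
proof
  show "(\<lambda>n. LINT y|lborel. min (2 * B) (L * inverse (real (Suc n)) * cmod y) * \<bar>log_kernel y\<bar>) \<longlonglongrightarrow> 0"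
    using B[of 0] lipschitz_on_nonneg[OF lip] by (intro log_kernel_approx_identity_error) auto
  fix n and l :: complex
  have h: "inverse (real (Suc n)) > 0" by simp
  show "\<bar>(LINT z|lborel. cross_diff (inverse (real (Suc n))) \<phi> z * ln (cmod (z - l))) / (inverse (real (Suc n)))\<^sup>2
        - log_kernel_mass * \<phi> l\<bar> \<le> (LINT y|lborel. min (2 * B) (L * inverse (real (Suc n)) * cmod y) * \<bar>log_kernel y\<bar>)"
  proof -
    have "(LINT y|lborel. \<phi> (l + of_real (inverse (real (Suc n))) * y) * log_kernel y)
       = (LINT z|lborel. cross_diff (inverse (real (Suc n))) \<phi> z * ln (cmod (z - l))) / (inverse (real (Suc n)))\<^sup>2"
      by (rule integral_log_kernel_eq_cross_diff[OF test_function_measurable B supp h])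
    thus ?thesis using log_kernel_approx_identity[OF lip B h, where l = l]
      by (simp only: log_kernel_mass_def)
  qed
qed

text \<open>The left side involves the list \<open>as\<close> only through the modulus of the monic
  polynomial with these roots. For a random matrix that modulus is a determinant, hence measurable,
  whereas an enumeration of the eigenvalues need not be.\<close>

lemma sum_test_function_eq_limit:
  "(\<lambda>n. (LINT z|lborel. cross_diff (inverse (real (Suc n))) \<phi> z * ln (\<Prod>a\<leftarrow>as. cmod (z - a)))
      / (inverse (real (Suc n)))\<^sup>2 / log_kernel_mass) \<longlonglongrightarrow> (\<Sum>a\<leftarrow>as. \<phi> a)"
proof -
  obtain e where e: "e \<longlonglongrightarrow> 0"
    "\<And>n l. \<bar>(LINT z|lborel. cross_diff (inverse (real (Suc n))) \<phi> z * ln (cmod (z - l))) / (inverse (real (Suc n)))\<^sup>2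
        - log_kernel_mass * \<phi> l\<bar> \<le> e n" using log_potential_test_error by blast
  let ?h = "\<lambda>n. inverse (real (Suc n))"
  let ?J = "\<lambda>n l. (LINT z|lborel. cross_diff (?h n) \<phi> z * ln (cmod (z - l))) / (?h n)\<^sup>2"
  have J: "(\<lambda>n. ?J n l) \<longlonglongrightarrow> log_kernel_mass * \<phi> l" for l
  proof -
    have "(\<lambda>n. ?J n l - log_kernel_mass * \<phi> l) \<longlonglongrightarrow> 0"
      by (rule Lim_null_comparison[OF _ e(1)]) (use e(2) in \<open>auto intro!: always_eventually\<close>)
    thus ?thesis by (simp add: LIM_zero_iff)
  qed
  have "(\<lambda>n. (\<Sum>a\<leftarrow>as. ?J n a)) \<longlonglongrightarrow> (\<Sum>a\<leftarrow>as. log_kernel_mass * \<phi> a)"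
    by (induction as) (auto intro!: tendsto_add J simp del: of_nat_Suc)
  moreover have "(LINT z|lborel. cross_diff (?h n) \<phi> z * ln (\<Prod>a\<leftarrow>as. cmod (z - a))) / (?h n)\<^sup>2 = (\<Sum>a\<leftarrow>as. ?J n a)" for n
  proof -
    have "(LINT z|lborel. cross_diff (?h n) \<phi> z * ln (\<Prod>a\<leftarrow>as. cmod (z - a)))
       = (LINT z|lborel. (\<Sum>a\<leftarrow>as. cross_diff (?h n) \<phi> z * ln (cmod (z - a))))"
    proof (rule integral_cong_AE)
      have m: "(\<lambda>z. ln (cmod (z - a))) \<in> borel_measurable borel" for a :: complex
        using measurable_compose[of "\<lambda>z. z - a" borel borel "\<lambda>z. ln (cmod z)"] by simp
      have c: "cross_diff (?h n) \<phi> \<in> borel_measurable borel" using test_function_measurable by simp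
      have "(\<lambda>z. \<Prod>a\<leftarrow>as. cmod (z - a)) \<in> borel_measurable (borel :: complex measure)"
        by (induction as) auto
      thus "(\<lambda>z. cross_diff (?h n) \<phi> z * ln (\<Prod>a\<leftarrow>as. cmod (z - a))) \<in> borel_measurable lborel"
        using c by (simp add: borel_measurable_times borel_measurable_ln)
      show "(\<lambda>z. \<Sum>a\<leftarrow>as. cross_diff (?h n) \<phi> z * ln (cmod (z - a))) \<in> borel_measurable lborel"
      proof (induction as)
        case (Cons a as)
        have "(\<lambda>z. cross_diff (?h n) \<phi> z * ln (cmod (z - a))) \<in> borel_measurable lborel"
          using m[of a] c by (simp add: borel_measurable_times)
        from borel_measurable_add[OF this Cons] show ?case by simp
      qed simp
      \<comment> \<open>Off the finite set of roots no factor vanishes, so the logarithm of the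
        product splits.\<close>
      have "AE z in lborel. z \<notin> set as"
        by (rule AE_I'[of "set as"]) (auto simp: finite_imp_null_set_lborel)
      thus "AE z in lborel. cross_diff (?h n) \<phi> z * ln (\<Prod>a\<leftarrow>as. cmod (z - a)) = (\<Sum>a\<leftarrow>as. cross_diff (?h n) \<phi> z * ln (cmod (z - a)))"
      proof eventually_elim
        case (elim z)
        hence "(\<Prod>a\<leftarrow>as. cmod (z - a)) > 0 \<and> ln (\<Prod>a\<leftarrow>as. cmod (z - a)) = (\<Sum>a\<leftarrow>as. ln (cmod (z - a)))"
        proof (induction as)
          case (Cons a as)
          hence "cmod (z - a) > 0" by auto
          thus ?case using Cons by (auto simp: ln_mult)
        qed simp
        thus ?case by (simp add: sum_list_const_mult)
      qed
    qed
    also have "\<dots> = (\<Sum>a\<leftarrow>as. LINT z|lborel. cross_diff (?h n) \<phi> z * ln (cmod (z - a)))"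
      by (intro integral_sum_list integrable_cross_diff_ln) simp
    finally show ?thesis by (simp add: sum_list_const_mult[symmetric] divide_inverse mult.commute del: of_nat_Suc)
  qed
  ultimately have "(\<lambda>n. (LINT z|lborel. cross_diff (?h n) \<phi> z * ln (\<Prod>a\<leftarrow>as. cmod (z - a))) / (?h n)\<^sup>2)
     \<longlonglongrightarrow> (\<Sum>a\<leftarrow>as. log_kernel_mass * \<phi> a)" by presburger
  from tendsto_divide[OF this tendsto_const, of log_kernel_mass]
  show ?thesis using log_kernel_mass_pos by (simp add: sum_list_const_mult del: of_nat_Suc)
qed

text \<open>The step h is frozen first, so that the approximate-identity error is small; \<eta> and
  \<kappa> may then absorb the factor h^-2. Off S the potentials of the two lists are close by
  hypothesis. On S they need not be related at all: each is small in mean by uniform integrability.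
  The margin \<open>R + 1 \<le> R1\<close> contains the support of the difference because h \<le>
  1.\<close>

lemma test_function_sum_compare:
  assumes eps: "\<epsilon> > 0" and R1: "R + 1 \<le> R1" "0 \<le> R1"
  obtains \<eta> \<kappa> where "\<eta> > 0" "\<kappa> > 0"
    "\<And>as bs S N. length as = N \<Longrightarrow> length bs = N \<Longrightarrow> set as \<subseteq> cball 0 R1 \<Longrightarrow> set bs \<subseteq> cball 0 R1 \<Longrightarrow>
       S \<in> sets borel \<Longrightarrow> S \<subseteq> cball 0 R1 \<Longrightarrow> measure lborel S \<le> \<kappa> \<Longrightarrow>
       (\<And>z. z \<in> cball 0 R1 \<Longrightarrow> z \<notin> S \<Longrightarrow>
          \<bar>(\<Sum>a\<leftarrow>as. ln (cmod (z - a))) - (\<Sum>b\<leftarrow>bs. ln (cmod (z - b)))\<bar> \<le> \<eta> * real N) \<Longrightarrow>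
       \<bar>(\<Sum>a\<leftarrow>as. \<phi> a) - (\<Sum>b\<leftarrow>bs. \<phi> b)\<bar> \<le> \<epsilon> * real N"
proof -
  define c where "c = log_kernel_mass"
  have c: "c > 0" using log_kernel_mass_pos by (simp add: c_def)
  have B0: "B \<ge> 0" using B[of 0] by linarith
  obtain e where e: "e \<longlonglongrightarrow> 0"
    "\<And>n l. \<bar>(LINT z|lborel. cross_diff (inverse (real (Suc n))) \<phi> z * ln (cmod (z - l))) / (inverse (real (Suc n)))\<^sup>2
        - log_kernel_mass * \<phi> l\<bar> \<le> e n" using log_potential_test_error by blast
  have "eventually (\<lambda>n. e n < c * \<epsilon> / 4) sequentially"
    using e(1) c eps by (intro order_tendstoD(2)[OF e(1)]) simp
  then obtain n where n: "e n < c * \<epsilon> / 4" by (auto simp: eventually_sequentially)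
  define h where "h = inverse (real (Suc n))"
  have h: "0 < h" "h \<le> 1" unfolding h_def by (auto simp: field_simps)
  define J where "J = (\<lambda>l. LINT z|lborel. cross_diff h \<phi> z * ln (cmod (z - l)))"
  have J: "\<bar>J l / h\<^sup>2 - c * \<phi> l\<bar> \<le> c * \<epsilon> / 4" for l
    using e(2)[of n l] n unfolding J_def h_def c_def by linarith
  \<comment> \<open>The error budget is c \<epsilon>/4 for each list from the approximate identity
    and c \<epsilon>/2 for the comparison of potentials. Of the latter, \<epsilon>2 and \<eta> take
    half each, after multiplication by 8 B and division by h^2.\<close>
  define \<epsilon>2 where "\<epsilon>2 = c * \<epsilon> * h\<^sup>2 / (64 * (B + 1))"
  have e2: "\<epsilon>2 > 0" unfolding \<epsilon>2_def using c eps h B0 by simp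
  define \<eta> where "\<eta> = c * \<epsilon> * h\<^sup>2 / (32 * (B + 1) * (pi * R1\<^sup>2 + 1))"
  have pR: "pi * R1\<^sup>2 + 1 > 0" by (simp add: add_nonneg_pos)
  have eta: "\<eta> > 0" unfolding \<eta>_def using c eps h B0 pR by simp
  obtain \<kappa> where k: "\<kappa> > 0"
    "\<And>S l. S \<in> sets borel \<Longrightarrow> S \<subseteq> cball 0 R1 \<Longrightarrow> measure lborel S \<le> \<kappa> \<Longrightarrow> cmod l \<le> R1 \<Longrightarrow>
       (LINT z|lborel. indicator S z * \<bar>ln (cmod (z - l))\<bar>) \<le> \<epsilon>2"
    using ln_uniformly_integrable[OF e2] by blast
  show ?thesis
  proof (rule that[OF eta k(1)])
    fix as bs :: "complex list" and S :: "complex set" and N :: nat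
    assume as: "length as = N" "set as \<subseteq> cball 0 R1" and bs: "length bs = N" "set bs \<subseteq> cball 0 R1"
      and S: "S \<in> sets borel" "S \<subseteq> cball 0 R1" "measure lborel S \<le> \<kappa>"
      and close: "\<And>z. z \<in> cball 0 R1 \<Longrightarrow> z \<notin> S \<Longrightarrow>
          \<bar>(\<Sum>a\<leftarrow>as. ln (cmod (z - a))) - (\<Sum>b\<leftarrow>bs. ln (cmod (z - b)))\<bar> \<le> \<eta> * real N"
    let ?W = "\<lambda>z. (\<Sum>a\<leftarrow>as. ln (cmod (z - a))) - (\<Sum>b\<leftarrow>bs. ln (cmod (z - b)))"
    let ?G = "\<lambda>cs z. \<Sum>a\<leftarrow>cs. indicator S z * \<bar>ln (cmod (z - a))\<bar>"
    let ?H = "\<lambda>z. 8 * B * (\<eta> * real N * indicator (cball 0 R1) z + ?G as z + ?G bs z)"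
    have intS: "integrable lborel (\<lambda>z. indicator S z * \<bar>ln (cmod (z - a))\<bar>)" for a
    proof -
      have "integrable lborel (\<lambda>z. indicator S z * ln (cmod (z - a)))"
        by (rule integrable_bounded_mult_ln[of _ 1 R1]) (use S in \<open>auto simp: indicator_def\<close>)
      from integrable_abs[OF this] show ?thesis by (simp add: abs_mult)
    qed
    have intG: "integrable lborel (?G cs)" for cs by (rule integrable_sum_list[OF intS])
    have intB: "integrable lborel (\<lambda>z::complex. \<eta> * real N * indicator (cball 0 R1) z)"
      using emeasure_lborel_cball_finite[of "0::complex" R1]
      by (intro integrable_mult_right integrable_real_indicator) auto
    have intH: "integrable lborel ?H"
      by (intro integrable_mult_right Bochner_Integration.integrable_add intB intG)
    have intc: "integrable lborel (\<lambda>z. \<Sum>a\<leftarrow>cs. cross_diff h \<phi> z * ln (cmod (z - a)))" for cs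
      by (intro integrable_sum_list integrable_cross_diff_ln h)
    have intW: "integrable lborel (\<lambda>z. cross_diff h \<phi> z * ?W z)"
      using Bochner_Integration.integrable_diff[OF intc[of as] intc[of bs]]
      by (simp add: sum_list_const_mult right_diff_distrib)
    have JW: "(\<Sum>a\<leftarrow>as. J a) - (\<Sum>b\<leftarrow>bs. J b) = (LINT z|lborel. cross_diff h \<phi> z * ?W z)"
    proof -
      have "(\<Sum>a\<leftarrow>cs. J a) = (LINT z|lborel. (\<Sum>a\<leftarrow>cs. cross_diff h \<phi> z * ln (cmod (z - a))))" for cs
        unfolding J_def by (intro integral_sum_list[symmetric] integrable_cross_diff_ln h)
      thus ?thesis using Bochner_Integration.integral_diff[OF intc[of as] intc[of bs]]
        by (simp add: sum_list_const_mult right_diff_distrib)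
    qed
    have pt: "\<bar>cross_diff h \<phi> z * ?W z\<bar> \<le> ?H z" for z
    proof (cases "cmod z > R1")
      case True
      hence "cross_diff h \<phi> z = 0" using cross_diff_support[of R \<phi> h z, OF supp] h R1 by simp
      moreover have "?G cs z \<ge> 0" for cs by (intro sum_list_nonneg) auto
      ultimately show ?thesis using B0 True by simp
    next
      case False
      have "\<bar>?W z\<bar> \<le> \<eta> * real N * indicator (cball 0 R1) z + ?G as z + ?G bs z"
      proof (cases "z \<in> S")
        case True
        have "\<bar>?W z\<bar> \<le> \<bar>\<Sum>a\<leftarrow>as. ln (cmod (z - a))\<bar> + \<bar>\<Sum>b\<leftarrow>bs. ln (cmod (z - b))\<bar>"
          by (rule abs_triangle_ineq4)
        also have "\<dots> \<le> ?G as z + ?G bs z"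
          using True abs_sum_list_le[of "\<lambda>a. ln (cmod (z - a))" as] abs_sum_list_le[of "\<lambda>a. ln (cmod (z - a))" bs]
          by (simp add: add_mono)
        finally have "\<bar>?W z\<bar> \<le> ?G as z + ?G bs z" .
        moreover have "0 \<le> \<eta> * real N * indicator (cball 0 R1) z" using eta by (intro mult_nonneg_nonneg) auto
        ultimately show ?thesis by linarith
      next
        case F: False
        thus ?thesis using close[of z] False by simp
      qed
      moreover have "\<bar>cross_diff h \<phi> z\<bar> \<le> 8 * B" by (rule cross_diff_bound[OF B])
      ultimately show ?thesis unfolding abs_mult by (intro mult_mono) (use B0 in auto)
    qed
    have "\<bar>(\<Sum>a\<leftarrow>as. J a) - (\<Sum>b\<leftarrow>bs. J b)\<bar> \<le> (LINT z|lborel. \<bar>cross_diff h \<phi> z * ?W z\<bar>)"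
      unfolding JW by (rule integral_abs_bound)
    also have "\<dots> \<le> (LINT z|lborel. ?H z)"
      by (intro integral_mono integrable_abs intW intH pt)
    also have "\<dots> = 8 * B * (\<eta> * real N * measure lborel (cball (0::complex) R1) + (LINT z|lborel. ?G as z) + (LINT z|lborel. ?G bs z))"
      using intB intG by (simp add: Bochner_Integration.integral_add Bochner_Integration.integrable_add)
    also have "\<dots> \<le> 8 * B * (\<eta> * real N * (pi * R1\<^sup>2) + \<epsilon>2 * real N + \<epsilon>2 * real N)"
    proof (intro mult_left_mono add_mono)
      have G: "(LINT z|lborel. ?G cs z) \<le> \<epsilon>2 * real N" if "length cs = N" "set cs \<subseteq> cball 0 R1" for cs
      proof -
        have "(LINT z|lborel. ?G cs z) = (\<Sum>a\<leftarrow>cs. LINT z|lborel. indicator S z * \<bar>ln (cmod (z - a))\<bar>)"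
          by (rule integral_sum_list[OF intS])
        also have "\<dots> \<le> \<epsilon>2 * real (length cs)"
        proof (rule sum_list_le_length_mult)
          fix a assume "a \<in> set cs"
          hence "cmod a \<le> R1" using that(2) by auto
          thus "(LINT z|lborel. indicator S z * \<bar>ln (cmod (z - a))\<bar>) \<le> \<epsilon>2" by (rule k(2)[OF S])
        qed
        finally show ?thesis using that by simp
      qed
      show "(LINT z|lborel. ?G as z) \<le> \<epsilon>2 * real N" by (rule G[OF as])
      show "(LINT z|lborel. ?G bs z) \<le> \<epsilon>2 * real N" by (rule G[OF bs])
      show "measure lborel (cball (0::complex) R1) \<le> pi * R1\<^sup>2" using R1 by (simp add: measure_cball_complex)
    qed (use B0 eta in auto)
    finally have K: "\<bar>(\<Sum>a\<leftarrow>as. J a) - (\<Sum>b\<leftarrow>bs. J b)\<bar> \<le> 8 * B * (\<eta> * (pi * R1\<^sup>2) + 2 * \<epsilon>2) * real N"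
      by (simp add: algebra_simps)
    have "8 * B * (\<eta> * (pi * R1\<^sup>2) + 2 * \<epsilon>2) \<le> 8 * (B + 1) * (\<eta> * (pi * R1\<^sup>2 + 1) + 2 * \<epsilon>2)"
      using B0 eta e2 by (intro mult_mono add_mono) auto
    also have "\<dots> = c * \<epsilon> * h\<^sup>2 / 2"
    proof -
      have "\<eta> * (pi * R1\<^sup>2 + 1) = c * \<epsilon> * h\<^sup>2 / (32 * (B + 1))"
        unfolding \<eta>_def using pR by simp
      moreover have "8 * K * (t / (32 * K) + 2 * (t / (64 * K))) = t / 2" if "K \<noteq> 0" for K t :: real
        using that by (simp add: field_simps)
      ultimately show ?thesis unfolding \<epsilon>2_def using B0 by (simp only:)
    qed
    finally have "\<bar>(\<Sum>a\<leftarrow>as. J a) - (\<Sum>b\<leftarrow>bs. J b)\<bar> \<le> c * \<epsilon> * h\<^sup>2 / 2 * real N"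
      using K by (meson mult_right_mono of_nat_0_le_iff order_trans)
    hence "\<bar>(\<Sum>a\<leftarrow>as. J a) - (\<Sum>b\<leftarrow>bs. J b)\<bar> / h\<^sup>2 \<le> c * \<epsilon> / 2 * real N"
      using h by (simp add: divide_le_eq mult_ac)
    hence D: "\<bar>(\<Sum>a\<leftarrow>as. J a) / h\<^sup>2 - (\<Sum>b\<leftarrow>bs. J b) / h\<^sup>2\<bar> \<le> c * \<epsilon> / 2 * real N"
      by (simp add: diff_divide_distrib[symmetric])
    have E: "\<bar>(\<Sum>a\<leftarrow>cs. J a) / h\<^sup>2 - c * (\<Sum>a\<leftarrow>cs. \<phi> a)\<bar> \<le> c * \<epsilon> / 4 * real (length cs)" for cs
    proof -
      have "(\<Sum>a\<leftarrow>cs. J a) / h\<^sup>2 - c * (\<Sum>a\<leftarrow>cs. \<phi> a) = (\<Sum>a\<leftarrow>cs. J a / h\<^sup>2 - c * \<phi> a)"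
        by (induction cs) (auto simp: algebra_simps add_divide_distrib)
      also have "\<bar>\<dots>\<bar> \<le> (\<Sum>a\<leftarrow>cs. \<bar>J a / h\<^sup>2 - c * \<phi> a\<bar>)" by (rule abs_sum_list_le)
      also have "\<dots> \<le> c * \<epsilon> / 4 * real (length cs)" by (rule sum_list_le_length_mult[OF J])
      finally show ?thesis .
    qed
    have "\<bar>c * (\<Sum>a\<leftarrow>as. \<phi> a) - c * (\<Sum>b\<leftarrow>bs. \<phi> b)\<bar> \<le> c * \<epsilon> / 4 * real N + c * \<epsilon> / 2 * real N + c * \<epsilon> / 4 * real N"
      using E[of as] E[of bs] D unfolding as bs by (smt (verit))
    moreover have "\<bar>c * x - c * y\<bar> = c * \<bar>x - y\<bar>" for x y
      using c by (simp add: right_diff_distrib[symmetric] abs_mult)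
    moreover have "c * \<epsilon> / 4 * real N + c * \<epsilon> / 2 * real N + c * \<epsilon> / 4 * real N = c * (\<epsilon> * real N)" by simp
    ultimately have "c * \<bar>(\<Sum>a\<leftarrow>as. \<phi> a) - (\<Sum>b\<leftarrow>bs. \<phi> b)\<bar> \<le> c * (\<epsilon> * real N)"
      by (simp only:)
    thus "\<bar>(\<Sum>a\<leftarrow>as. \<phi> a) - (\<Sum>b\<leftarrow>bs. \<phi> b)\<bar> \<le> \<epsilon> * real N" using c by simp
  qed
qed

end

section \<open>Circulant matrices\<close>

definition weight_sum :: "(int \<Rightarrow> complex) \<Rightarrow> real" where
  "weight_sum a = (\<Sum>\<^sub>\<infinity>\<nu>. (1 + \<bar>real_of_int \<nu>\<bar>) * cmod (a \<nu>))"

text \<open>Periodisation: the resulting matrix is the action of the bi-infinite Laurent operator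
  with coefficients \<open>a\<close> on N-periodic sequences.\<close>

definition circulant_entry :: "(int \<Rightarrow> complex) \<Rightarrow> nat \<Rightarrow> nat \<Rightarrow> nat \<Rightarrow> complex" where
  "circulant_entry a N j k = (\<Sum>\<^sub>\<infinity>\<nu>\<in>{\<nu>. \<nu> mod int N = (int j - int k) mod int N}. a \<nu>)"

definition unity_root :: "nat \<Rightarrow> nat \<Rightarrow> complex" where
  "unity_root N m = cis (2 * pi * real m / real N)"

lemma norm_unity_root [simp]: "cmod (unity_root N m) = 1"
  by (simp add: unity_root_def)

lemma unity_root_nonzero [simp]: "unity_root N m \<noteq> 0"
  by (simp add: unity_root_def)

lemma unity_root_power: "N > 0 \<Longrightarrow> unity_root N m ^ N = 1"
  unfolding unity_root_def Complex.DeMoivre using cis_multiple_2pi[of "real m"] by simp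

lemma unity_root_inj:
  assumes "m < N" "m' < N" "unity_root N m = unity_root N m'"
  shows "m = m'"
proof -
  have "cis (2 * pi * real m / real N - 2 * pi * real m' / real N) = 1"
    using assms(3) unfolding unity_root_def by (simp add: cis_divide[symmetric])
  hence "cos (2 * pi * real m / real N - 2 * pi * real m' / real N) = 1" by (metis cis.sel(1) one_complex.sel(1))
  then obtain n :: int where n: "2 * pi * real m / real N - 2 * pi * real m' / real N = of_int n * (2 * pi)"
    unfolding cos_one_2pi_int by (auto simp: mult_ac)
  have "2 * pi * (real m - real m') = 2 * pi * (of_int n * real N)"
    using n assms(1) by (simp add: field_simps)
  hence "real_of_int (int m - int m') = real_of_int (n * int N)" by simp
  hence e: "int m - int m' = n * int N" by (simp only: of_int_eq_iff)
  have "\<bar>int m - int m'\<bar> < int N" using assms by linarith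
  hence "\<bar>n\<bar> * int N < 1 * int N" unfolding e abs_mult by simp
  hence "n = 0" using assms(1) by (subst (asm) mult_less_cancel_right) auto
  thus ?thesis using e by simp
qed

lemma powi_cong_mod:
  fixes w :: complex
  assumes w: "w ^ N = 1" "w \<noteq> 0" and xy: "x mod int N = y mod int N"
  shows "w powi x = w powi y"
proof -
  obtain l where l: "x = y + int N * l"
    using xy by (metis mod_eqE)
  have "w powi x = w powi y * (w powi int N) powi l"
    unfolding l using w(2) by (simp add: power_int_add power_int_mult)
  thus ?thesis using w(1) by simp
qed

lemma unity_root_orthogonal:
  assumes "m < N" "m' < N"
  shows "(\<Sum>k<N. unity_root N m powi (- int k) * cnj (unity_root N m' powi (- int k))) = (if m = m' then of_nat N else 0)"
proof -
  let ?q = "unity_root N m' / unity_root N m"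
  have cn: "cnj (unity_root N m') = inverse (unity_root N m')"
    unfolding unity_root_def by (simp add: cis_cnj)
  have t: "unity_root N m powi (- int k) * cnj (unity_root N m' powi (- int k)) = ?q ^ k" for k
  proof -
    have "cnj (unity_root N m' powi (- int k)) = (cnj (unity_root N m')) powi (- int k)"
      by (simp add: power_int_minus)
    also have "\<dots> = unity_root N m' ^ k" unfolding cn by (simp add: power_int_minus power_inverse)
    finally show ?thesis by (simp add: power_int_minus power_mult_distrib power_inverse divide_inverse mult.commute)
  qed
  show ?thesis
  proof (cases "m = m'")
    case True thus ?thesis unfolding t by simp
  next
    case False
    hence q: "?q \<noteq> 1" using unity_root_inj[OF assms] by (auto simp: field_simps)
    have "?q ^ N = 1" using unity_root_power[of N m] unity_root_power[of N m'] assms by (simp add: power_divide)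
    hence "(\<Sum>k<N. ?q ^ k) = 0" using geometric_sum[OF q, of N] by simp
    thus ?thesis unfolding t using False by simp
  qed
qed

definition fourier_mat :: "nat \<Rightarrow> complex mat" where
  "fourier_mat N = mat N N (\<lambda>(k, m). unity_root N m powi (- int k))"

lemma fourier_mat_carrier [simp]: "fourier_mat N \<in> carrier_mat N N"
  by (simp add: fourier_mat_def)

text \<open>Parseval's identity for the unnormalised transform, whose columns are orthogonal with
  squared length N.\<close>

lemma vnorm_fourier_mat:
  assumes u: "u \<in> carrier_vec N"
  shows "vnorm (fourier_mat N *\<^sub>v u) = sqrt (real N) * vnorm u"
proof -
  let ?e = "\<lambda>m k. unity_root N m powi (- int k)"
  have nth: "(fourier_mat N *\<^sub>v u) $ k = (\<Sum>m<N. ?e m k * u $ m)" if "k < N" for k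
    using that u by (auto simp: fourier_mat_def scalar_prod_def atLeast0LessThan intro!: sum.cong)
  have swap: "(\<Sum>k<N. \<Sum>m<N. \<Sum>m'<N. f k m m') = (\<Sum>m<N. \<Sum>m'<N. \<Sum>k<N. f k m m')"
    for f :: "nat \<Rightarrow> nat \<Rightarrow> nat \<Rightarrow> complex"
  proof -
    have "(\<Sum>k<N. \<Sum>m<N. \<Sum>m'<N. f k m m') = (\<Sum>m<N. \<Sum>k<N. \<Sum>m'<N. f k m m')" by (rule sum.swap)
    also have "\<dots> = (\<Sum>m<N. \<Sum>m'<N. \<Sum>k<N. f k m m')" by (rule sum.cong[OF refl], rule sum.swap)
    finally show ?thesis .
  qed
  have "complex_of_real (\<Sum>k<N. (cmod ((fourier_mat N *\<^sub>v u) $ k))\<^sup>2)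
      = (\<Sum>k<N. (\<Sum>m<N. ?e m k * u $ m) * cnj (\<Sum>m'<N. ?e m' k * u $ m'))"
    by (simp add: nth complex_norm_square del: of_real_power cnj_sum)
  also have "\<dots> = (\<Sum>k<N. \<Sum>m<N. \<Sum>m'<N. u $ m * cnj (u $ m') * (?e m k * cnj (?e m' k)))"
    by (intro sum.cong refl) (simp only: cnj_sum complex_cnj_mult sum_product mult_ac)
  also have "\<dots> = (\<Sum>m<N. \<Sum>m'<N. \<Sum>k<N. u $ m * cnj (u $ m') * (?e m k * cnj (?e m' k)))"
    by (rule swap)
  also have "\<dots> = (\<Sum>m<N. \<Sum>m'<N. u $ m * cnj (u $ m') * (if m = m' then of_nat N else 0))"
    unfolding sum_distrib_left[symmetric]
    by (intro sum.cong refl arg_cong2[where f = "(*)"] unity_root_orthogonal) auto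
  also have "\<dots> = (\<Sum>m<N. u $ m * cnj (u $ m) * of_nat N)"
    by (intro sum.cong refl) (simp add: if_distrib cong: if_cong)
  also have "\<dots> = complex_of_real (real N * (\<Sum>m<N. (cmod (u $ m))\<^sup>2))"
    by (simp add: complex_norm_square sum_distrib_left mult_ac del: of_real_power)
  finally have "(\<Sum>k<N. (cmod ((fourier_mat N *\<^sub>v u) $ k))\<^sup>2) = real N * (\<Sum>m<N. (cmod (u $ m))\<^sup>2)"
    by (simp only: of_real_eq_iff)
  moreover have "dim_vec (fourier_mat N *\<^sub>v u) = N" by (simp add: fourier_mat_def)
  ultimately show ?thesis using u by (simp add: vnorm_def L2_set_def real_sqrt_mult del: index_mult_mat_vec)
qed

lemma det_fourier_mat: "N > 0 \<Longrightarrow> Determinant.det (fourier_mat N) \<noteq> 0"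
  by (rule det_nonzero_of_vnorm_bound[of _ N "sqrt (real N)"]) (auto simp: vnorm_fourier_mat)

definition shifted_circulant :: "(int \<Rightarrow> complex) \<Rightarrow> nat \<Rightarrow> complex \<Rightarrow> complex mat" where
  "shifted_circulant a N z = mat N N (\<lambda>(j, k). circulant_entry a N j k - (if j = k then z else 0))"

lemma shifted_circulant_carrier [simp]: "shifted_circulant a N z \<in> carrier_mat N N"
  by (simp add: shifted_circulant_def)

lemma residue_class_disjoint:
  assumes "k < N" "k' < N" "k \<noteq> k'"
  shows "{\<nu>. \<nu> mod int N = (int j - int k) mod int N} \<inter> {\<nu>. \<nu> mod int N = (int j - int k') mod int N} = {}"
proof (rule ccontr)
  assume "\<not> ?thesis"
  hence "(int j - int k) mod int N = (int j - int k') mod int N" by auto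
  hence "int N dvd (int j - int k) - (int j - int k')" by (rule mod_eq_dvd_iff[THEN iffD1])
  hence "int N dvd int k' - int k" by simp
  hence "int N \<le> \<bar>int k' - int k\<bar>" using dvd_imp_le_int[of "int k' - int k" "int N"] assms by simp
  thus False using assms by linarith
qed

section \<open>Estimates for the symbol and diagonalisation of the circulant matrix\<close>

context
  fixes a :: "int \<Rightarrow> complex"
  assumes summ: "(\<lambda>\<nu>. (1 + \<bar>real_of_int \<nu>\<bar>) * cmod (a \<nu>)) summable_on UNIV"
begin

lemma coeff_summable: "(\<lambda>\<nu>. cmod (a \<nu>)) summable_on A"
proof -
  have "(\<lambda>\<nu>. cmod (a \<nu>)) summable_on UNIV"
    by (rule summable_on_comparison_test[OF summ]) (auto simp: algebra_simps)
  thus ?thesis by (rule summable_on_subset_banach) auto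
qed

lemma weighted_summable: "(\<lambda>\<nu>. (1 + \<bar>real_of_int \<nu>\<bar>) * cmod (a \<nu>)) summable_on A"
  using summ by (rule summable_on_subset_banach) auto

lemma weight_sum_nonneg: "weight_sum a \<ge> 0"
  unfolding weight_sum_def by (intro infsum_nonneg) auto

lemma weighted_infsum_le: "(\<Sum>\<^sub>\<infinity>\<nu>\<in>A. (1 + \<bar>real_of_int \<nu>\<bar>) * cmod (a \<nu>)) \<le> weight_sum a"
  unfolding weight_sum_def by (intro infsum_mono2 weighted_summable) auto

lemma coeff_infsum_le: "(\<Sum>\<^sub>\<infinity>\<nu>\<in>A. cmod (a \<nu>)) \<le> weight_sum a"
  by (rule order.trans[OF infsum_mono[OF coeff_summable weighted_summable] weighted_infsum_le[of A]])
     (simp add: algebra_simps)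

text \<open>Markov's inequality for the weight 1 + |nu|; it is the source of the decay away from the
  first and last rows.\<close>

lemma coeff_tail_le:
  assumes "\<And>\<nu>. \<nu> \<in> A \<Longrightarrow> real d \<le> \<bar>real_of_int \<nu>\<bar>"
  shows "(\<Sum>\<^sub>\<infinity>\<nu>\<in>A. cmod (a \<nu>)) \<le> weight_sum a / (1 + real d)"
proof -
  have "(1 + real d) * (\<Sum>\<^sub>\<infinity>\<nu>\<in>A. cmod (a \<nu>)) = (\<Sum>\<^sub>\<infinity>\<nu>\<in>A. (1 + real d) * cmod (a \<nu>))"
    by (simp add: infsum_cmult_right')
  also have "\<dots> \<le> (\<Sum>\<^sub>\<infinity>\<nu>\<in>A. (1 + \<bar>real_of_int \<nu>\<bar>) * cmod (a \<nu>))"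
    using assms by (intro infsum_mono summable_on_cmult_right coeff_summable weighted_summable mult_right_mono) auto
  also have "\<dots> \<le> weight_sum a" by (rule weighted_infsum_le)
  finally show ?thesis by (simp add: field_simps)
qed

lemma symbol_term_summable:
  assumes "cmod \<zeta> = 1"
  shows "(\<lambda>\<nu>. a \<nu> * \<zeta> powi \<nu>) summable_on A"
  by (rule abs_summable_summable) (use assms coeff_summable in \<open>simp add: norm_mult norm_power_int\<close>)

lemma coeff_c_summable: "a summable_on A"
  by (rule abs_summable_summable) (rule coeff_summable)

lemma norm_laurent_symbol_le:
  assumes "cmod \<zeta> = 1"
  shows "cmod (laurent_symbol a \<zeta>) \<le> weight_sum a"
proof -
  have "cmod (laurent_symbol a \<zeta>) \<le> (\<Sum>\<^sub>\<infinity>\<nu>. cmod (a \<nu> * \<zeta> powi \<nu>))"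
    unfolding laurent_symbol_def
    by (rule norm_infsum_bound) (use assms coeff_summable in \<open>simp add: norm_mult norm_power_int\<close>)
  also have "\<dots> = (\<Sum>\<^sub>\<infinity>\<nu>. cmod (a \<nu>))" using assms by (simp add: norm_mult norm_power_int)
  also have "\<dots> \<le> weight_sum a" by (rule coeff_infsum_le)
  finally show ?thesis .
qed

lemma norm_cis_diff_le: "cmod (cis x - cis y) \<le> \<bar>x - y\<bar>"
proof -
  have "cis x - cis y = cis y * (cis (x - y) - 1)" by (simp add: right_diff_distrib cis_mult)
  hence "cmod (cis x - cis y) = cmod (cis (x - y) - 1)" by (simp add: norm_mult)
  also have "\<dots> = 2 * \<bar>sin ((x - y) / 2)\<bar>"
    using dist_exp_i_1[of "x - y"] by (simp add: cis_conv_exp)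
  also have "\<dots> \<le> 2 * \<bar>(x - y) / 2\<bar>" by (intro mult_left_mono abs_sin_x_le_abs_x) auto
  finally show ?thesis by simp
qed

text \<open>The term with index nu has Lipschitz constant |nu| |a_nu| in the angle. Both the area of
  a neighbourhood of the curve and the Riemann sums rest on this bound.\<close>

lemma laurent_symbol_lipschitz:
  "cmod (laurent_symbol a (cis s) - laurent_symbol a (cis t)) \<le> weight_sum a * \<bar>s - t\<bar>"
proof -
  have ab: "(\<lambda>\<nu>. (1 + \<bar>real_of_int \<nu>\<bar>) * cmod (a \<nu>) * \<bar>s - t\<bar>) summable_on UNIV"
    by (intro summable_on_cmult_left weighted_summable)
  have le: "cmod (a \<nu> * cis s powi \<nu> - a \<nu> * cis t powi \<nu>) \<le> (1 + \<bar>real_of_int \<nu>\<bar>) * cmod (a \<nu>) * \<bar>s - t\<bar>" for \<nu>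
  proof -
    have "cmod (a \<nu> * cis s powi \<nu> - a \<nu> * cis t powi \<nu>) = cmod (a \<nu>) * cmod (cis (of_int \<nu> * s) - cis (of_int \<nu> * t))"
      by (simp add: cis_power_int right_diff_distrib[symmetric] norm_mult)
    also have "\<dots> \<le> cmod (a \<nu>) * \<bar>of_int \<nu> * s - of_int \<nu> * t\<bar>"
      by (intro mult_left_mono norm_cis_diff_le) auto
    also have "\<dots> = cmod (a \<nu>) * (\<bar>of_int \<nu>\<bar> * \<bar>s - t\<bar>)"
      by (simp only: right_diff_distrib[symmetric] abs_mult)
    also have "\<dots> \<le> (1 + \<bar>real_of_int \<nu>\<bar>) * cmod (a \<nu>) * \<bar>s - t\<bar>" by (simp add: algebra_simps)
    finally show ?thesis .
  qed
  have abs: "(\<lambda>\<nu>. cmod (a \<nu> * cis s powi \<nu> - a \<nu> * cis t powi \<nu>)) summable_on UNIV"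
    by (rule summable_on_comparison_test[OF ab]) (use le in auto)
  have "laurent_symbol a (cis s) - laurent_symbol a (cis t) = (\<Sum>\<^sub>\<infinity>\<nu>. a \<nu> * cis s powi \<nu> + (- (a \<nu> * cis t powi \<nu>)))"
    unfolding laurent_symbol_def
    by (subst infsum_add) (auto intro!: symbol_term_summable simp: infsum_uminus summable_on_uminus)
  hence "cmod (laurent_symbol a (cis s) - laurent_symbol a (cis t)) \<le> (\<Sum>\<^sub>\<infinity>\<nu>. cmod (a \<nu> * cis s powi \<nu> - a \<nu> * cis t powi \<nu>))"
    using norm_infsum_bound[OF abs] by simp
  also have "\<dots> \<le> (\<Sum>\<^sub>\<infinity>\<nu>. (1 + \<bar>real_of_int \<nu>\<bar>) * cmod (a \<nu>) * \<bar>s - t\<bar>)"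
    by (intro infsum_mono abs ab le)
  also have "\<dots> = weight_sum a * \<bar>s - t\<bar>" unfolding weight_sum_def by (simp add: infsum_cmult_left')
  finally show ?thesis .
qed

text \<open>For an N-th root of unity w and nu congruent to j - k, the powers w^(nu - j) and w^(-k)
  agree. Summing over k therefore glues the residue classes back into the full Laurent
  series.\<close>

lemma circulant_eigenvector:
  assumes N: "N > 0" and j: "j < N"
  shows "(\<Sum>k<N. circulant_entry a N j k * unity_root N m powi (- int k))
       = laurent_symbol a (unity_root N m) * unity_root N m powi (- int j)"
proof -
  let ?w = "unity_root N m"
  let ?A = "\<lambda>k. {\<nu>. \<nu> mod int N = (int j - int k) mod int N}"
  have "circulant_entry a N j k * ?w powi (- int k) = (\<Sum>\<^sub>\<infinity>\<nu>\<in>?A k. a \<nu> * ?w powi \<nu> * ?w powi (- int j))" for k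
  proof -
    have "?w powi \<nu> * ?w powi (- int j) = ?w powi (- int k)" if "\<nu> \<in> ?A k" for \<nu>
    proof -
      have "(\<nu> + - int j) mod int N = ((int j - int k) + - int j) mod int N"
        using that by (intro mod_add_cong) auto
      hence "?w powi (\<nu> + - int j) = ?w powi (- int k)"
        by (intro powi_cong_mod[where N = N]) (use unity_root_power[OF N] in auto)
      moreover have "?w powi (\<nu> + - int j) = ?w powi \<nu> * ?w powi (- int j)"
        by (rule power_int_add) simp
      ultimately show ?thesis by (simp only:)
    qed
    hence "(\<Sum>\<^sub>\<infinity>\<nu>\<in>?A k. a \<nu> * ?w powi \<nu> * ?w powi (- int j)) = (\<Sum>\<^sub>\<infinity>\<nu>\<in>?A k. a \<nu> * ?w powi (- int k))"
      by (intro infsum_cong) (simp add: mult.assoc)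
    thus ?thesis unfolding circulant_entry_def by (simp add: infsum_cmult_left')
  qed
  hence "(\<Sum>k<N. circulant_entry a N j k * ?w powi (- int k)) = (\<Sum>k<N. \<Sum>\<^sub>\<infinity>\<nu>\<in>?A k. a \<nu> * ?w powi \<nu> * ?w powi (- int j))"
    by simp
  also have "\<dots> = (\<Sum>\<^sub>\<infinity>\<nu>\<in>(\<Union>k<N. ?A k). a \<nu> * ?w powi \<nu> * ?w powi (- int j))"
  proof (intro sum_infsum)
    show "(\<lambda>\<nu>. a \<nu> * ?w powi \<nu> * ?w powi (- int j)) summable_on ?A k" for k
      by (intro summable_on_cmult_left symbol_term_summable) simp
    fix k k' assume kk: "k \<in> {..<N}" "k' \<in> {..<N}" "k \<noteq> k'"
    show "?A k \<inter> ?A k' = {}" using residue_class_disjoint[of k N k' j] kk by auto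
  qed auto
  also have "(\<Union>k<N. ?A k) = UNIV"
  proof (intro equalityI subsetI UNIV_I)
    fix \<nu> :: int
    define k where "k = nat ((int j - \<nu>) mod int N)"
    have "int k = (int j - \<nu>) mod int N" unfolding k_def using N by simp
    hence "(int j - int k) mod int N = \<nu> mod int N"
      by (metis mod_diff_right_eq add.commute diff_add_cancel diff_diff_eq2 add_diff_cancel)
    moreover have "k < N" unfolding k_def using N by (simp add: nat_less_iff)
    ultimately show "\<nu> \<in> (\<Union>k<N. ?A k)" by (intro UN_I[of k]) auto
  qed
  also have "(\<Sum>\<^sub>\<infinity>\<nu>. a \<nu> * ?w powi \<nu> * ?w powi (- int j)) = laurent_symbol a ?w * ?w powi (- int j)"
    unfolding laurent_symbol_def by (simp add: infsum_cmult_left')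
  finally show ?thesis .
qed

text \<open>In row \<open>j\<close> the periodised coefficients that do not occur in the Toeplitz matrix have index at
  least \<open>min (j + 1) (N - j)\<close> in absolute value.\<close>

lemma circulant_row_diff:
  assumes j: "j < N" and d: "d \<le> j" "d \<le> N - 1 - j"
  shows "(\<Sum>k<N. cmod (circulant_entry a N j k - a (int j - int k))) \<le> weight_sum a / (1 + real d)"
proof -
  let ?A = "\<lambda>k. {\<nu>. \<nu> mod int N = (int j - int k) mod int N} - {int j - int k}"
  have "circulant_entry a N j k - a (int j - int k) = (\<Sum>\<^sub>\<infinity>\<nu>\<in>?A k. a \<nu>)" for k
  proof -
    have "{\<nu>. \<nu> mod int N = (int j - int k) mod int N} = ?A k \<union> {int j - int k}" by auto
    hence "circulant_entry a N j k = (\<Sum>\<^sub>\<infinity>\<nu>\<in>?A k \<union> {int j - int k}. a \<nu>)"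
      unfolding circulant_entry_def by simp
    also have "\<dots> = (\<Sum>\<^sub>\<infinity>\<nu>\<in>?A k. a \<nu>) + (\<Sum>\<^sub>\<infinity>\<nu>\<in>{int j - int k}. a \<nu>)"
      by (intro infsum_Un_disjoint coeff_c_summable) auto
    finally show ?thesis by simp
  qed
  hence "(\<Sum>k<N. cmod (circulant_entry a N j k - a (int j - int k))) \<le> (\<Sum>k<N. \<Sum>\<^sub>\<infinity>\<nu>\<in>?A k. cmod (a \<nu>))"
    by (simp only:) (intro sum_mono norm_infsum_bound coeff_summable)
  also have "\<dots> = (\<Sum>\<^sub>\<infinity>\<nu>\<in>(\<Union>k<N. ?A k). cmod (a \<nu>))"
  proof (intro sum_infsum coeff_summable)
    fix k k' assume kk: "k \<in> {..<N}" "k' \<in> {..<N}" "k \<noteq> k'"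
    show "?A k \<inter> ?A k' = {}" using residue_class_disjoint[of k N k' j] kk by auto
  qed auto
  also have "\<dots> \<le> weight_sum a / (1 + real d)"
  proof (rule coeff_tail_le)
    fix \<nu> assume "\<nu> \<in> (\<Union>k<N. ?A k)"
    then obtain k where k: "k < N" "\<nu> mod int N = (int j - int k) mod int N" "\<nu> \<noteq> int j - int k" by auto
    obtain l where l: "\<nu> = int j - int k + int N * l" using k(2) by (metis mod_eqE)
    have "l \<noteq> 0" using l k(3) by auto
    hence "l \<ge> 1 \<or> l \<le> -1" by linarith
    hence "int N * l \<ge> int N \<or> int N * l \<le> - int N"
    proof
      assume "l \<ge> 1" thus ?thesis using mult_left_mono[of 1 l "int N"] by simp
    next
      assume "l \<le> -1" thus ?thesis using mult_left_mono[of l "-1" "int N"] by simp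
    qed
    hence "int d \<le> \<bar>\<nu>\<bar>" using l k(1) j d by linarith
    thus "real d \<le> \<bar>real_of_int \<nu>\<bar>" by linarith
  qed
  finally show ?thesis .
qed

lemma circulant_entry_le: "cmod (circulant_entry a N j k) \<le> weight_sum a"
  unfolding circulant_entry_def
  by (rule order.trans[OF norm_infsum_bound[OF coeff_summable] coeff_infsum_le])

lemma shifted_circulant_fourier:
  assumes N: "N > 0"
  shows "shifted_circulant a N z * fourier_mat N
       = fourier_mat N * mat N N (\<lambda>(m, m'). if m = m' then laurent_symbol a (unity_root N m) - z else 0)"
    (is "?L = fourier_mat N * ?D")
proof (rule eq_matI)
  fix j m assume "j < dim_row (fourier_mat N * ?D)" "m < dim_col (fourier_mat N * ?D)"
  hence jm: "j < N" "m < N" by (simp_all add: fourier_mat_def)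
  let ?e = "\<lambda>k. unity_root N m powi (- int k)"
  have "?L $$ (j, m) = (\<Sum>k<N. (circulant_entry a N j k - (if j = k then z else 0)) * ?e k)"
    using jm by (auto simp: shifted_circulant_def fourier_mat_def scalar_prod_def atLeast0LessThan intro!: sum.cong)
  also have "\<dots> = (\<Sum>k<N. circulant_entry a N j k * ?e k) - (\<Sum>k<N. if j = k then z * ?e k else 0)"
    unfolding sum_subtractf[symmetric] by (intro sum.cong refl) (auto simp: left_diff_distrib)
  also have "\<dots> = (laurent_symbol a (unity_root N m) - z) * ?e j"
    using jm by (simp add: circulant_eigenvector[OF N] left_diff_distrib)
  also have "\<dots> = (\<Sum>k<N. (unity_root N k powi (- int j)) * (if k = m then laurent_symbol a (unity_root N k) - z else 0))"
    using jm by (simp add: if_distrib cong: if_cong)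
  also have "\<dots> = (fourier_mat N * ?D) $$ (j, m)"
    using jm by (auto simp: fourier_mat_def scalar_prod_def atLeast0LessThan intro!: sum.cong)
  finally show "?L $$ (j, m) = (fourier_mat N * ?D) $$ (j, m)" .
qed (auto simp: shifted_circulant_def fourier_mat_def)

lemma det_shifted_circulant:
  assumes N: "N > 0"
  shows "Determinant.det (shifted_circulant a N z) = (\<Prod>m<N. laurent_symbol a (unity_root N m) - z)"
proof -
  let ?D = "mat N N (\<lambda>(m, m'). if m = m' then laurent_symbol a (unity_root N m) - z else 0)"
  have D: "?D \<in> carrier_mat N N" by simp
  have "Determinant.det ?D = prod_list (diag_mat ?D)"
    by (rule det_upper_triangular[OF _ D]) auto
  also have "diag_mat ?D = map (\<lambda>m. laurent_symbol a (unity_root N m) - z) [0..<N]"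
    by (simp add: diag_mat_def)
  also have "prod_list \<dots> = (\<Prod>m<N. laurent_symbol a (unity_root N m) - z)"
    by (simp add: prod.distinct_set_conv_list[symmetric] atLeast0LessThan)
  finally have "Determinant.det ?D = (\<Prod>m<N. laurent_symbol a (unity_root N m) - z)" .
  moreover have "Determinant.det (shifted_circulant a N z) * Determinant.det (fourier_mat N) = Determinant.det (fourier_mat N) * Determinant.det ?D"
    unfolding det_mult[OF shifted_circulant_carrier fourier_mat_carrier, symmetric]
      det_mult[OF fourier_mat_carrier D, symmetric] shifted_circulant_fourier[OF N] ..
  ultimately show ?thesis using det_fourier_mat[OF N] by simp
qed

text \<open>The Fourier matrix is sqrt N times an isometry, and this factor cancels. Such a lower
  bound by the distance to the eigenvalues is special to normal matrices and fails for the Toeplitz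
  matrix itself.\<close>

lemma vnorm_shifted_circulant:
  assumes N: "N > 0" and \<rho>: "\<rho> \<ge> 0" and far: "\<And>m. m < N \<Longrightarrow> \<rho> \<le> cmod (laurent_symbol a (unity_root N m) - z)"
    and v: "v \<in> carrier_vec N"
  shows "\<rho> * vnorm v \<le> vnorm (shifted_circulant a N z *\<^sub>v v)"
proof -
  let ?D = "mat N N (\<lambda>(m, m'). if m = m' then laurent_symbol a (unity_root N m) - z else 0)"
  have D: "?D \<in> carrier_mat N N" by simp
  obtain V where V: "V \<in> carrier_mat N N" "fourier_mat N * V = 1\<^sub>m N"
    using exists_inverse_mat[OF fourier_mat_carrier det_fourier_mat[OF N]] by blast
  define u where "u = V *\<^sub>v v"
  have u: "u \<in> carrier_vec N" unfolding u_def using V v by simp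
  have vu: "v = fourier_mat N *\<^sub>v u"
    unfolding u_def using V v by (simp add: assoc_mult_mat_vec[symmetric, of _ N N _ N])
  have Du: "(?D *\<^sub>v u) $ m = (laurent_symbol a (unity_root N m) - z) * u $ m" if "m < N" for m
  proof -
    have "(?D *\<^sub>v u) $ m = (\<Sum>m'<N. (if m = m' then laurent_symbol a (unity_root N m) - z else 0) * u $ m')"
      using that u by (auto simp: scalar_prod_def atLeast0LessThan intro!: sum.cong)
    also have "\<dots> = (\<Sum>m'<N. if m = m' then (laurent_symbol a (unity_root N m) - z) * u $ m' else 0)"
      by (intro sum.cong) auto
    finally show ?thesis using that by simp
  qed
  have "\<rho> * vnorm u = L2_set (\<lambda>i. \<rho> * cmod (u $ i)) {..<N}"
    using u \<rho> unfolding vnorm_def by (subst L2_set_right_distrib) auto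
  also have "\<dots> \<le> L2_set (\<lambda>i. cmod ((?D *\<^sub>v u) $ i)) {..<N}"
    using far \<rho> by (intro L2_set_mono) (auto simp: Du norm_mult intro!: mult_right_mono simp del: index_mult_mat_vec)
  also have "\<dots> = vnorm (?D *\<^sub>v u)" unfolding vnorm_def by simp
  finally have *: "\<rho> * vnorm u \<le> vnorm (?D *\<^sub>v u)" .
  have Du': "?D *\<^sub>v u \<in> carrier_vec N" by (intro carrier_vecI) simp
  have "shifted_circulant a N z *\<^sub>v v = fourier_mat N *\<^sub>v (?D *\<^sub>v u)"
  proof -
    have "shifted_circulant a N z *\<^sub>v v = (shifted_circulant a N z * fourier_mat N) *\<^sub>v u"
      unfolding vu using u by (simp add: assoc_mult_mat_vec[of _ N N _ N])
    also have "\<dots> = fourier_mat N *\<^sub>v (?D *\<^sub>v u)"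
      unfolding shifted_circulant_fourier[OF N] using u by (simp add: assoc_mult_mat_vec[of _ N N _ N])
    finally show ?thesis .
  qed
  hence "vnorm (shifted_circulant a N z *\<^sub>v v) = sqrt (real N) * vnorm (?D *\<^sub>v u)"
    using vnorm_fourier_mat[OF Du'] by simp
  moreover have "\<rho> * vnorm v = sqrt (real N) * (\<rho> * vnorm u)"
    using vnorm_fourier_mat[OF u] vu by simp
  moreover have "sqrt (real N) * (\<rho> * vnorm u) \<le> sqrt (real N) * vnorm (?D *\<^sub>v u)"
    by (intro mult_left_mono *) simp
  ultimately show ?thesis by (simp only:)
qed

end

section \<open>Gaussian matrices\<close>

text \<open>The random array \<open>y\<close> is a function on index pairs rather than a matrix, so
  that a single entry can be overwritten while all others are frozen.\<close>

definition mixed_mat :: "nat \<Rightarrow> (nat \<Rightarrow> nat \<Rightarrow> complex) \<Rightarrow> complex \<Rightarrow> (nat \<Rightarrow> nat \<Rightarrow> complex) \<Rightarrow> nat set \<Rightarrow> (nat \<times> nat \<Rightarrow> complex) \<Rightarrow> complex mat" where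
  "mixed_mat N t \<delta> c S y = mat N N (\<lambda>(i, j). if i \<in> S then t i j + \<delta> * y (i, j) else c i j)"

lemma mixed_mat_carrier [simp]: "mixed_mat N t \<delta> c S y \<in> carrier_mat N N"
  by (simp add: mixed_mat_def)

lemma borel_measurable_det:
  fixes f :: "'a \<Rightarrow> nat \<times> nat \<Rightarrow> complex"
  assumes "\<And>i j. i < N \<Longrightarrow> j < N \<Longrightarrow> (\<lambda>x. f x (i, j)) \<in> borel_measurable M"
  shows "(\<lambda>x. Determinant.det (mat N N (f x))) \<in> borel_measurable M"
proof -
  have "(\<lambda>x. \<Sum>p\<in>{p. p permutes {0..<N}}. signof p * (\<Prod>i=0..<N. f x (i, p i))) \<in> borel_measurable M"
  proof (intro borel_measurable_sum borel_measurable_times borel_measurable_const borel_measurable_prod)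
    fix p i assume "p \<in> {p. p permutes {0..<N}}" "i \<in> {0..<N}"
    hence "i < N" "p i < N" using permutes_in_image[of p "{0..<N}" i] by auto
    thus "(\<lambda>x. f x (i, p i)) \<in> borel_measurable M" by (rule assms)
  qed
  moreover have "Determinant.det (mat N N (f x)) = (\<Sum>p\<in>{p. p permutes {0..<N}}. signof p * (\<Prod>i=0..<N. f x (i, p i)))" for x
  proof -
    have "Determinant.det (mat N N (f x)) = (\<Sum>p\<in>{p. p permutes {0..<N}}. signof p * (\<Prod>i=0..<N. mat N N (f x) $$ (i, p i)))"
      by (rule det_def') simp
    also have "\<dots> = (\<Sum>p\<in>{p. p permutes {0..<N}}. signof p * (\<Prod>i=0..<N. f x (i, p i)))"
      by (intro sum.cong prod.cong refl arg_cong2[where f = "(*)"]) (auto dest: permutes_in_image)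
    finally show ?thesis .
  qed
  ultimately show ?thesis by simp
qed

lemma borel_measurable_det_mixed_mat:
  assumes "\<And>i j. i < N \<Longrightarrow> j < N \<Longrightarrow> (\<lambda>x. y x (i, j)) \<in> borel_measurable M"
  shows "(\<lambda>x. Determinant.det (mixed_mat N t \<delta> c S (y x))) \<in> borel_measurable M"
  unfolding mixed_mat_def
proof (rule borel_measurable_det)
  fix i j assume "i < N" "j < N"
  thus "(\<lambda>x. (\<lambda>(i, j). if i \<in> S then t i j + \<delta> * y x (i, j) else c i j) (i, j)) \<in> borel_measurable M"
    using assms[of i j] by (cases "i \<in> S") auto
qed

lemma borel_measurable_cofactor_mixed_mat:
  assumes "\<And>i j. i < N \<Longrightarrow> j < N \<Longrightarrow> (\<lambda>x. y x (i, j)) \<in> borel_measurable M" and "r < N" "k < N"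
  shows "(\<lambda>x. cofactor (mixed_mat N t \<delta> c S (y x)) r k) \<in> borel_measurable M"
proof -
  have "mat_delete (mixed_mat N t \<delta> c S Y) r k = mat (N - 1) (N - 1) (\<lambda>(i, j).
      (\<lambda>(i, j). if i \<in> S then t i j + \<delta> * Y (i, j) else c i j) (if i < r then i else Suc i, if j < k then j else Suc j))" for Y
    unfolding mat_delete_def mixed_mat_def by (intro eq_matI) auto
  moreover have "(\<lambda>x. Determinant.det (mat (N - 1) (N - 1) (\<lambda>(i, j).
      (\<lambda>(i, j). if i \<in> S then t i j + \<delta> * y x (i, j) else c i j) (if i < r then i else Suc i, if j < k then j else Suc j)))) \<in> borel_measurable M"
  proof (rule borel_measurable_det)
    fix i j assume "i < N - 1" "j < N - 1"
    hence "(if i < r then i else Suc i) < N" "(if j < k then j else Suc j) < N" by auto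
    thus "(\<lambda>x. (\<lambda>(i, j). (\<lambda>(i, j). if i \<in> S then t i j + \<delta> * y x (i, j) else c i j) (if i < r then i else Suc i, if j < k then j else Suc j)) (i, j)) \<in> borel_measurable M"
      using assms(1) by (cases "(if i < r then i else Suc i) \<in> S") auto
  qed
  ultimately show ?thesis unfolding cofactor_def by simp
qed

text \<open>Row r is deleted, so neither its random entries nor the membership of r in S matters.
  The first fact gives independence from the entry that is varied, the second lets the cofactors be
  compared before and after row r is made random.\<close>

lemma cofactor_mixed_mat_cong:
  assumes "\<And>i j. i < N \<Longrightarrow> j < N \<Longrightarrow> i \<noteq> r \<Longrightarrow> y (i, j) = y' (i, j)"
    and "\<And>i. i \<noteq> r \<Longrightarrow> i \<in> S \<longleftrightarrow> i \<in> S'" and "r < N" "k < N"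
  shows "cofactor (mixed_mat N t \<delta> c S y) r k = cofactor (mixed_mat N t \<delta> c S' y') r k"
proof -
  have "mat_delete (mixed_mat N t \<delta> c S y) r k = mat_delete (mixed_mat N t \<delta> c S' y') r k"
    unfolding mat_delete_def mixed_mat_def using assms by (intro eq_matI) auto
  thus ?thesis by (simp add: cofactor_def)
qed

text \<open>In the Laplace expansion along row r the entry (r, k) occurs in one term only. The
  determinant is thus affine in this entry, with coefficients that depend on the other
  entries.\<close>

lemma det_mixed_mat_affine:
  assumes r: "r < N" and k: "k < N" and S: "r \<in> S"
  shows "Determinant.det (mixed_mat N t \<delta> c S y)
       = Determinant.det (mixed_mat N t \<delta> c S (y((r, k) := 0))) + \<delta> * cofactor (mixed_mat N t \<delta> c S y) r k * y (r, k)"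
proof -
  let ?y = "y((r, k) := 0)"
  have cof: "cofactor (mixed_mat N t \<delta> c S ?y) r j = cofactor (mixed_mat N t \<delta> c S y) r j" if "j < N" for j
    using that r by (intro cofactor_mixed_mat_cong) auto
  have "Determinant.det (mixed_mat N t \<delta> c S y) = (\<Sum>j<N. mixed_mat N t \<delta> c S y $$ (r, j) * cofactor (mixed_mat N t \<delta> c S y) r j)"
    by (rule laplace_expansion_row[OF mixed_mat_carrier r])
  also have "\<dots> = (\<Sum>j<N. mixed_mat N t \<delta> c S ?y $$ (r, j) * cofactor (mixed_mat N t \<delta> c S ?y) r j
       + (if j = k then \<delta> * cofactor (mixed_mat N t \<delta> c S y) r k * y (r, k) else 0))"
  proof (intro sum.cong refl)
    fix j assume "j \<in> {..<N}"
    hence j: "j < N" by simp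
    have e: "mixed_mat N t \<delta> c S Y $$ (r, j) = t r j + \<delta> * Y (r, j)" for Y
      using r S j by (simp add: mixed_mat_def)
    show "mixed_mat N t \<delta> c S y $$ (r, j) * cofactor (mixed_mat N t \<delta> c S y) r j
      = mixed_mat N t \<delta> c S ?y $$ (r, j) * cofactor (mixed_mat N t \<delta> c S ?y) r j
       + (if j = k then \<delta> * cofactor (mixed_mat N t \<delta> c S y) r k * y (r, k) else 0)"
      unfolding e cof[OF j] by (auto simp: algebra_simps)
  qed
  also have "\<dots> = Determinant.det (mixed_mat N t \<delta> c S ?y) + \<delta> * cofactor (mixed_mat N t \<delta> c S y) r k * y (r, k)"
    unfolding sum.distrib laplace_expansion_row[OF mixed_mat_carrier r, symmetric] using k by simp
  finally show ?thesis .
qed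

section \<open>Small balls and tails for a single Gaussian variable\<close>

context prob_space
begin

text \<open>The density is at most 1/pi and the disc has area pi s^2.\<close>

lemma gaussian_small_ball:
  assumes "distributed M lborel X (\<lambda>\<alpha>. ennreal (exp (- (cmod \<alpha>)\<^sup>2) / pi))" and s: "s \<ge> 0"
  shows "emeasure (distr M borel X) (cball c s) \<le> ennreal (s\<^sup>2)"
proof -
  have "distr M borel X = distr M lborel X" by (intro distr_cong) auto
  also have "\<dots> = density lborel (\<lambda>\<alpha>. ennreal (exp (- (cmod \<alpha>)\<^sup>2) / pi))"
    by (rule distributed_distr_eq_density[OF assms(1)])
  finally have "emeasure (distr M borel X) (cball c s) = (\<integral>\<^sup>+ \<alpha>. ennreal (exp (- (cmod \<alpha>)\<^sup>2) / pi) * indicator (cball c s) \<alpha> \<partial>lborel)"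
    by (simp add: emeasure_density)
  also have "\<dots> \<le> (\<integral>\<^sup>+ \<alpha>. ennreal (1 / pi) * indicator (cball c s) \<alpha> \<partial>lborel)"
    by (intro nn_integral_mono mult_right_mono ennreal_leI divide_right_mono) auto
  also have "\<dots> = ennreal (1 / pi) * ennreal (pi * s\<^sup>2)"
    by (subst nn_integral_cmult_indicator) (simp_all add: emeasure_cball_complex s)
  also have "\<dots> = ennreal (s\<^sup>2)" by (simp add: ennreal_mult[symmetric])
  finally show ?thesis .
qed

text \<open>Given Y = y with g y nonzero, the event says that the Gaussian variable lies in the disc
  of radius s about - f y / g y. Measuring the affine expression relative to |g y| makes the radius,
  and hence the bound, independent of y; Tonelli's theorem then integrates over y.\<close>

lemma gaussian_affine_small_ball:
  assumes ind: "indep_var NX X' N' Y" and h[measurable]: "h \<in> borel_measurable NX"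
    and X: "distributed M lborel (\<lambda>\<omega>. h (X' \<omega>)) (\<lambda>\<alpha>. ennreal (exp (- (cmod \<alpha>)\<^sup>2) / pi))"
    and f[measurable]: "f \<in> borel_measurable N'" and g[measurable]: "g \<in> borel_measurable N'" and s: "s \<ge> 0"
  shows "prob {\<omega> \<in> space M. g (Y \<omega>) \<noteq> (0::complex) \<and> cmod (f (Y \<omega>) + g (Y \<omega>) * h (X' \<omega>)) \<le> s * cmod (g (Y \<omega>))} \<le> s\<^sup>2"
proof -
  have rv[measurable]: "X' \<in> measurable M NX" "Y \<in> measurable M N'"
    using ind indep_var_rv1 indep_var_rv2 by auto
  let ?E = "{xy \<in> space (NX \<Otimes>\<^sub>M N'). g (snd xy) \<noteq> 0 \<and> cmod (f (snd xy) + g (snd xy) * h (fst xy)) \<le> s * cmod (g (snd xy))}"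
  have E[measurable]: "?E \<in> sets (NX \<Otimes>\<^sub>M N')" by measurable
  interpret X: prob_space "distr M NX X'" by (rule prob_space_distr) simp
  interpret Y: prob_space "distr M N' Y" by (rule prob_space_distr) simp
  interpret XY: pair_sigma_finite "distr M NX X'" "distr M N' Y" ..
  have "emeasure M {\<omega> \<in> space M. g (Y \<omega>) \<noteq> 0 \<and> cmod (f (Y \<omega>) + g (Y \<omega>) * h (X' \<omega>)) \<le> s * cmod (g (Y \<omega>))}
      = emeasure (distr M (NX \<Otimes>\<^sub>M N') (\<lambda>\<omega>. (X' \<omega>, Y \<omega>))) ?E"
    by (subst emeasure_distr)
       (auto intro!: arg_cong[where f = "emeasure M"] simp: space_pair_measure measurable_space[OF rv(1)] measurable_space[OF rv(2)])
  also have "\<dots> = emeasure (distr M NX X' \<Otimes>\<^sub>M distr M N' Y) ?E"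
    using ind unfolding indep_var_distribution_eq by simp
  also have "\<dots> = (\<integral>\<^sup>+ y. emeasure (distr M NX X') ((\<lambda>x. (x, y)) -` ?E) \<partial>distr M N' Y)"
    by (rule XY.emeasure_pair_measure_alt2) (simp add: sets_pair_measure_cong[OF sets_distr sets_distr])
  also have "\<dots> \<le> (\<integral>\<^sup>+ y. ennreal (s\<^sup>2) \<partial>distr M N' Y)"
  proof (rule nn_integral_mono)
    fix y
    show "emeasure (distr M NX X') ((\<lambda>x. (x, y)) -` ?E) \<le> ennreal (s\<^sup>2)"
    proof (cases "g y = 0")
      case True
      hence "(\<lambda>x. (x, y)) -` ?E = {}" by auto
      thus ?thesis by (simp only: emeasure_empty zero_le)
    next
      case False
      have "(\<lambda>x. (x, y)) -` ?E \<subseteq> h -` cball (- f y / g y) s \<inter> space NX"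
      proof
        fix x assume x: "x \<in> (\<lambda>x. (x, y)) -` ?E"
        hence "cmod (f y + g y * h x) \<le> s * cmod (g y)" by auto
        moreover have "f y + g y * h x = g y * (h x - (- f y / g y))" using False by (simp add: field_simps)
        ultimately have "cmod (g y) * cmod (h x - (- f y / g y)) \<le> cmod (g y) * s" by (simp only: norm_mult mult.commute)
        hence "cmod (h x - (- f y / g y)) \<le> s" using False by simp
        hence "h x \<in> cball (- f y / g y) s" by (simp only: mem_cball dist_norm norm_minus_commute)
        thus "x \<in> h -` cball (- f y / g y) s \<inter> space NX" using x by (auto simp: space_pair_measure)
      qed
      hence "emeasure (distr M NX X') ((\<lambda>x. (x, y)) -` ?E) \<le> emeasure (distr M NX X') (h -` cball (- f y / g y) s \<inter> space NX)"
        by (intro emeasure_mono) (auto intro: measurable_sets[OF h])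
      also have "\<dots> = emeasure (distr (distr M NX X') borel h) (cball (- f y / g y) s)"
        by (subst emeasure_distr) auto
      also have "distr (distr M NX X') borel h = distr M borel (\<lambda>\<omega>. h (X' \<omega>))"
        by (subst distr_distr) (auto simp: comp_def)
      finally show ?thesis using gaussian_small_ball[OF X s] by (rule order.trans)
    qed
  qed
  also have "\<dots> = ennreal (s\<^sup>2)" using Y.emeasure_space_1 by simp
  finally show ?thesis unfolding emeasure_eq_measure by (subst (asm) ennreal_le_iff) auto
qed

text \<open>Half of the exponent is bounded by its value at \<tau>, and the other half remains
  integrable.\<close>

lemma gaussian_tail:
  assumes X: "distributed M lborel X (\<lambda>\<alpha>. ennreal (exp (- (cmod \<alpha>)\<^sup>2) / pi))" and \<tau>: "\<tau> \<ge> 0"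
  shows "prob {\<omega> \<in> space M. cmod (X \<omega>) > \<tau>} \<le> 2 * exp (- \<tau>\<^sup>2 / 2)"
proof -
  let ?d = "\<lambda>\<alpha>::complex. ennreal (exp (- (cmod \<alpha>)\<^sup>2) / pi)"
  have rv[measurable]: "X \<in> measurable M borel" using distributed_measurable[OF X] by simp
  have dist: "distr M lborel X = density lborel ?d" by (rule distributed_distr_eq_density[OF X])
  have [measurable]: "(\<lambda>\<alpha>::complex. ennreal (exp (- (cmod \<alpha>)\<^sup>2) / pi)) \<in> borel_measurable borel" by measurable
  interpret D: prob_space "distr M lborel X" by (rule prob_space_distr) simp
  have "emeasure (density lborel ?d) (space (density lborel ?d)) = 1"
    using D.emeasure_space_1 unfolding dist .
  moreover have "emeasure (density lborel ?d) UNIV = (\<integral>\<^sup>+ \<alpha>. ?d \<alpha> * indicator UNIV \<alpha> \<partial>lborel)"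
    by (rule emeasure_density) auto
  ultimately have one: "(\<integral>\<^sup>+ \<alpha>. ?d \<alpha> \<partial>lborel) = 1" by simp
  \<comment> \<open>Scaling by sqrt 2 doubles the total mass. That mass is 1 because the density
    belongs to a probability law, so no Gaussian integral has to be evaluated.\<close>
  have half: "(\<integral>\<^sup>+ \<alpha>. ennreal (exp (- (cmod \<alpha>)\<^sup>2 / 2) / pi) \<partial>lborel) = 2"
  proof -
    let ?f = "\<lambda>\<alpha>::complex. ennreal (exp (- (cmod \<alpha>)\<^sup>2 / 2) / pi)"
    have [measurable]: "?f \<in> borel_measurable borel" by measurable
    have "(\<integral>\<^sup>+ \<alpha>. ?f \<alpha> \<partial>lborel) = (\<integral>\<^sup>+ \<alpha>. ?f \<alpha> \<partial>density (distr lborel borel (\<lambda>x. 0 + sqrt 2 *\<^sub>R x)) (\<lambda>x. ennreal (\<bar>sqrt 2\<bar> ^ DIM(complex))))"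
      by (subst lborel_affine[of "sqrt 2" 0]) auto
    also have "\<dots> = (\<integral>\<^sup>+ \<alpha>. 2 * ?f (sqrt 2 *\<^sub>R \<alpha>) \<partial>lborel)"
      by (subst nn_integral_density, simp, simp, subst nn_integral_distr) auto
    also have "\<dots> = (\<integral>\<^sup>+ \<alpha>. 2 * ?d \<alpha> \<partial>lborel)"
      by (intro nn_integral_cong) (simp add: power_mult_distrib)
    also have "\<dots> = 2" by (subst nn_integral_cmult) (simp_all add: one)
    finally show ?thesis .
  qed
  have "emeasure M {\<omega> \<in> space M. cmod (X \<omega>) > \<tau>} = emeasure (distr M lborel X) {\<alpha>. cmod \<alpha> > \<tau>}"
    by (subst emeasure_distr) (auto intro!: arg_cong[where f = "emeasure M"])
  also have "\<dots> = (\<integral>\<^sup>+ \<alpha>. ?d \<alpha> * indicator {\<alpha>. cmod \<alpha> > \<tau>} \<alpha> \<partial>lborel)"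
    unfolding dist by (subst emeasure_density) auto
  also have "\<dots> \<le> (\<integral>\<^sup>+ \<alpha>. ennreal (exp (- \<tau>\<^sup>2 / 2)) * ennreal (exp (- (cmod \<alpha>)\<^sup>2 / 2) / pi) \<partial>lborel)"
  proof (rule nn_integral_mono)
    fix \<alpha> :: complex
    show "?d \<alpha> * indicator {\<alpha>. cmod \<alpha> > \<tau>} \<alpha> \<le> ennreal (exp (- \<tau>\<^sup>2 / 2)) * ennreal (exp (- (cmod \<alpha>)\<^sup>2 / 2) / pi)"
    proof (cases "cmod \<alpha> > \<tau>")
      case True
      hence "\<tau>\<^sup>2 \<le> (cmod \<alpha>)\<^sup>2" using \<tau> by (intro power_mono) auto
      hence "exp (- (cmod \<alpha>)\<^sup>2) \<le> exp (- \<tau>\<^sup>2 / 2 + - (cmod \<alpha>)\<^sup>2 / 2)" by simp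
      hence "exp (- (cmod \<alpha>)\<^sup>2) \<le> exp (- \<tau>\<^sup>2 / 2) * exp (- (cmod \<alpha>)\<^sup>2 / 2)" by (simp only: exp_add)
      hence "exp (- (cmod \<alpha>)\<^sup>2) / pi \<le> exp (- \<tau>\<^sup>2 / 2) * (exp (- (cmod \<alpha>)\<^sup>2 / 2) / pi)"
        by (simp add: divide_right_mono)
      thus ?thesis using True by (simp add: ennreal_mult[symmetric] ennreal_leI)
    qed auto
  qed
  also have "\<dots> = ennreal (exp (- \<tau>\<^sup>2 / 2)) * 2"
    by (subst nn_integral_cmult, simp, simp only: half)
  also have "\<dots> = ennreal (2 * exp (- \<tau>\<^sup>2 / 2))"
    by (simp add: ennreal_mult mult.commute)
  finally have "emeasure M {\<omega> \<in> space M. cmod (X \<omega>) > \<tau>} \<le> ennreal (2 * exp (- \<tau>\<^sup>2 / 2))" .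
  thus ?thesis unfolding emeasure_eq_measure by (subst (asm) ennreal_le_iff) auto
qed

end

section \<open>Adding Gaussian rows one by one, and exceptional sets of small area\<close>

lemma gaussian_matD:
  assumes "gaussian_random_mat M N Q"
  shows "prob_space M" "\<And>\<omega>. \<omega> \<in> space M \<Longrightarrow> Q \<omega> \<in> carrier_mat N N"
    "\<And>j k. j < N \<Longrightarrow> k < N \<Longrightarrow> distributed M lborel (\<lambda>\<omega>. Q \<omega> $$ (j, k)) (\<lambda>\<alpha>. ennreal (exp (- (cmod \<alpha>)\<^sup>2) / pi))"
    "prob_space.indep_vars M (\<lambda>_. borel) (\<lambda>jk \<omega>. Q \<omega> $$ jk) ({..<N} \<times> {..<N})"
  using assms unfolding gaussian_random_mat_def by auto

lemma gaussian_mat_measurable: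
  assumes "gaussian_random_mat M N Q" "j < N" "k < N"
  shows "(\<lambda>\<omega>. Q \<omega> $$ (j, k)) \<in> borel_measurable M"
  using distributed_measurable[OF gaussian_matD(3)[OF assms]] by simp

lemma det_mixed_gaussian_measurable:
  assumes "gaussian_random_mat M N Q"
  shows "(\<lambda>\<omega>. Determinant.det (mixed_mat N t \<delta> c S (\<lambda>jk. Q \<omega> $$ jk))) \<in> borel_measurable M"
  by (rule borel_measurable_det_mixed_mat) (rule gaussian_mat_measurable[OF assms])

text \<open>By the Laplace expansion along row \<open>r\<close>, some cofactor of that row is at least
  \<open>\<bar>det\<bar> / (K N)\<close>; the Gaussian entry it multiplies is independent of everything else.\<close>

lemma prob_det_add_row:
  assumes G: "gaussian_random_mat M N Q" and \<delta>: "\<delta> > 0" and K: "K > 0" and s: "s \<ge> 0"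
    and c: "\<And>i j. i < N \<Longrightarrow> j < N \<Longrightarrow> cmod (c i j) \<le> K"
    and r: "r < N" "r \<notin> S"
  shows "measure M {\<omega> \<in> space M. cmod (Determinant.det (mixed_mat N t (of_real \<delta>) c (insert r S) (\<lambda>jk. Q \<omega> $$ jk)))
        < \<delta> * s / (K * real N) * cmod (Determinant.det (mixed_mat N t (of_real \<delta>) c S (\<lambda>jk. Q \<omega> $$ jk)))} \<le> real N * s\<^sup>2"
    (is "measure M ?bad \<le> _")
proof -
  interpret prob_space M by (rule gaussian_matD(1)[OF G])
  let ?X = "\<lambda>S y. mixed_mat N t (of_real \<delta>) c S y"
  let ?I = "{..<N} \<times> {..<N}"
  let ?cof = "\<lambda>\<omega> k. cofactor (?X (insert r S) (\<lambda>jk. Q \<omega> $$ jk)) r k"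
  define B where "B = (\<lambda>k. {\<omega> \<in> space M. complex_of_real \<delta> * ?cof \<omega> k \<noteq> 0 \<and>
      cmod (Determinant.det (?X (insert r S) (\<lambda>jk. Q \<omega> $$ jk))) \<le> s * cmod (complex_of_real \<delta> * ?cof \<omega> k)})"
  have meas: "(\<lambda>\<omega>. Q \<omega> $$ (i, j)) \<in> borel_measurable M" if "i < N" "j < N" for i j
    by (rule gaussian_mat_measurable[OF G that])
  have Bm: "B k \<in> sets M" if k: "k < N" for k
  proof -
    have [measurable]: "(\<lambda>\<omega>. ?cof \<omega> k) \<in> borel_measurable M"
      by (rule borel_measurable_cofactor_mixed_mat) (use meas r(1) k in auto)
    have [measurable]: "(\<lambda>\<omega>. Determinant.det (?X (insert r S) (\<lambda>jk. Q \<omega> $$ jk))) \<in> borel_measurable M"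
      by (rule det_mixed_gaussian_measurable[OF G])
    show ?thesis unfolding B_def by measurable
  qed
  have Bp: "prob (B k) \<le> s\<^sup>2" if k: "k < N" for k
  proof -
    let ?A = "?I - {(r, k)}"
    let ?N' = "PiM ?A (\<lambda>_. borel :: complex measure)"
    define Y where "Y = (\<lambda>\<omega>. \<lambda>jk\<in>?A. Q \<omega> $$ jk)"
    \<comment> \<open>Extension by 0 agrees on the index square with overwriting the entry (r, k) by
      0, so the coefficients f and g are functions of the remaining entries Y alone.\<close>
    define e :: "(nat \<times> nat \<Rightarrow> complex) \<Rightarrow> nat \<times> nat \<Rightarrow> complex" where "e = (\<lambda>y jk. if jk \<in> ?A then y jk else 0)"
    have ind0: "indep_var (PiM {(r, k)} (\<lambda>_. borel)) (\<lambda>\<omega>. \<lambda>jk\<in>{(r, k)}. Q \<omega> $$ jk) ?N' Y"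
      unfolding Y_def by (rule indep_var_restrict[OF gaussian_matD(4)[OF G]]) (use r k in auto)
    have em: "(\<lambda>y. e y (i, j)) \<in> borel_measurable ?N'" for i j
      unfolding e_def by (cases "(i, j) \<in> ?A") (auto intro: measurable_component_singleton)
    define f where "f = (\<lambda>y. Determinant.det (?X (insert r S) (e y)))"
    define g where "g = (\<lambda>y. complex_of_real \<delta> * cofactor (?X (insert r S) (e y)) r k)"
    have fm: "f \<in> borel_measurable ?N'" unfolding f_def by (rule borel_measurable_det_mixed_mat) (rule em)
    have gm: "g \<in> borel_measurable ?N'" unfolding g_def
    proof (rule borel_measurable_times[OF borel_measurable_const])
      show "(\<lambda>y. cofactor (?X (insert r S) (e y)) r k) \<in> borel_measurable ?N'"
        by (rule borel_measurable_cofactor_mixed_mat[OF _ r(1) k]) (rule em)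
    qed
    have eY: "e (Y \<omega>) (i, j) = ((\<lambda>jk. Q \<omega> $$ jk)((r, k) := 0)) (i, j)" if "i < N" "j < N" for \<omega> i j
      using that unfolding e_def Y_def by auto
    have gY: "g (Y \<omega>) = complex_of_real \<delta> * ?cof \<omega> k" for \<omega>
      unfolding g_def using r k by (intro arg_cong2[where f = "(*)"] cofactor_mixed_mat_cong) (auto simp: eY)
    have fY: "f (Y \<omega>) = Determinant.det (?X (insert r S) ((\<lambda>jk. Q \<omega> $$ jk)((r, k) := 0)))" for \<omega>
      unfolding f_def mixed_mat_def
      by (intro arg_cong[where f = Determinant.det] eq_matI) (auto simp: eY simp del: fun_upd_apply)
    have "B k = {\<omega> \<in> space M. g (Y \<omega>) \<noteq> 0 \<and> cmod (f (Y \<omega>) + g (Y \<omega>) * Q \<omega> $$ (r, k)) \<le> s * cmod (g (Y \<omega>))}"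
    proof -
      have D: "Determinant.det (?X (insert r S) (\<lambda>jk. Q \<omega> $$ jk))
        = Determinant.det (?X (insert r S) ((\<lambda>jk. Q \<omega> $$ jk)((r, k) := 0))) + complex_of_real \<delta> * ?cof \<omega> k * Q \<omega> $$ (r, k)" for \<omega>
        by (rule det_mixed_mat_affine[OF r(1) k]) simp
      show ?thesis unfolding B_def gY fY D[symmetric] ..
    qed
    also have "prob \<dots> \<le> s\<^sup>2"
    proof -
      have h: "(\<lambda>y. y (r, k)) \<in> borel_measurable (PiM {(r, k)} (\<lambda>_. borel :: complex measure))"
        by (rule measurable_component_singleton) simp
      show ?thesis
        using gaussian_affine_small_ball[OF ind0 h _ fm gm s] gaussian_matD(3)[OF G r(1) k] by simp
    qed
    finally show ?thesis .
  qed
  \<comment> \<open>The column with a large cofactor depends on the outcome; hence the union over k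
    and the factor N in the bound.\<close>
  have sub: "?bad \<subseteq> (\<Union>k<N. B k)"
  proof
    fix \<omega> assume "\<omega> \<in> ?bad"
    hence \<omega>: "\<omega> \<in> space M" and lt: "cmod (Determinant.det (?X (insert r S) (\<lambda>jk. Q \<omega> $$ jk)))
        < \<delta> * s / (K * real N) * cmod (Determinant.det (?X S (\<lambda>jk. Q \<omega> $$ jk)))" by auto
    let ?d = "cmod (Determinant.det (?X S (\<lambda>jk. Q \<omega> $$ jk)))"
    have cofS: "cofactor (?X S (\<lambda>jk. Q \<omega> $$ jk)) r k = ?cof \<omega> k" if "k < N" for k
      using that r by (intro cofactor_mixed_mat_cong) auto
    \<comment> \<open>The strict inequality in the bad event cannot hold if the old determinant
      vanishes.\<close>
    have dpos: "?d > 0"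
      using lt norm_ge_zero[of "Determinant.det (?X (insert r S) (\<lambda>jk. Q \<omega> $$ jk))"] by (cases "?d = 0") auto
    have N: "real N > 0" using r by simp
    have "\<exists>k<N. ?d / (K * real N) \<le> cmod (?cof \<omega> k)"
    proof (rule ccontr)
      assume "\<not> ?thesis"
      hence small: "cmod (?cof \<omega> k) < ?d / (K * real N)" if "k < N" for k using that by force
      have "Determinant.det (?X S (\<lambda>jk. Q \<omega> $$ jk)) = (\<Sum>k<N. ?X S (\<lambda>jk. Q \<omega> $$ jk) $$ (r, k) * cofactor (?X S (\<lambda>jk. Q \<omega> $$ jk)) r k)"
        by (rule laplace_expansion_row[OF mixed_mat_carrier r(1)])
      also have "\<dots> = (\<Sum>k<N. c r k * ?cof \<omega> k)"
        using r by (intro sum.cong refl arg_cong2[where f = "(*)"] cofS) (auto simp: mixed_mat_def)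
      finally have "?d \<le> (\<Sum>k<N. cmod (c r k * ?cof \<omega> k))" by (simp only: norm_sum)
      also have "\<dots> < (\<Sum>k<N. ?d / real N)"
      proof (rule sum_strict_mono)
        fix k assume "k \<in> {..<N}"
        hence k: "k < N" by simp
        have "cmod (c r k * ?cof \<omega> k) \<le> K * cmod (?cof \<omega> k)"
          unfolding norm_mult using c[OF r(1) k] by (intro mult_right_mono) auto
        also have "\<dots> < K * (?d / (K * real N))" using small[OF k] K by (intro mult_strict_left_mono)
        also have "\<dots> = ?d / real N" using K by simp
        finally show "cmod (c r k * ?cof \<omega> k) < ?d / real N" .
      qed (use r in auto)
      also have "\<dots> = ?d" using N by simp
      finally show False by simp
    qed
    then obtain k where k: "k < N" "?d / (K * real N) \<le> cmod (?cof \<omega> k)" by auto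
    have "0 < ?d / (K * real N)" using dpos K N by simp
    hence "?cof \<omega> k \<noteq> 0" using k(2) by auto
    moreover have "cmod (Determinant.det (?X (insert r S) (\<lambda>jk. Q \<omega> $$ jk))) \<le> s * (\<delta> * cmod (?cof \<omega> k))"
    proof -
      have "\<delta> * s / (K * real N) * ?d = s * (\<delta> * (?d / (K * real N)))" by simp
      also have "\<dots> \<le> s * (\<delta> * cmod (?cof \<omega> k))" using k(2) s \<delta> by (intro mult_left_mono) auto
      finally show ?thesis using lt by linarith
    qed
    ultimately have "\<omega> \<in> B k" unfolding B_def using \<omega> \<delta> by (simp add: norm_mult)
    thus "\<omega> \<in> (\<Union>k<N. B k)" using k by auto
  qed
  have "prob ?bad \<le> prob (\<Union>k<N. B k)" using Bm by (intro finite_measure_mono sub) auto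
  also have "\<dots> \<le> (\<Sum>k<N. prob (B k))" using Bm by (intro finite_measure_subadditive_finite) auto
  also have "\<dots> \<le> (\<Sum>k<N. s\<^sup>2)" using Bp by (intro sum_mono) auto
  finally show ?thesis by simp
qed

text \<open>When rows are added one at a time, the factors lost multiply and the failure
  probabilities add.\<close>

lemma prob_det_add_rows:
  assumes G: "gaussian_random_mat M N Q" and \<delta>: "\<delta> > 0" and K: "K > 0" and s: "s \<ge> 0"
    and c: "\<And>i j. i < N \<Longrightarrow> j < N \<Longrightarrow> cmod (c i j) \<le> K"
    and J: "finite J" "J \<subseteq> {..<N}" "J \<inter> S = {}"
  shows "measure M {\<omega> \<in> space M. cmod (Determinant.det (mixed_mat N t (of_real \<delta>) c (J \<union> S) (\<lambda>jk. Q \<omega> $$ jk)))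
        < (\<delta> * s / (K * real N)) ^ card J * cmod (Determinant.det (mixed_mat N t (of_real \<delta>) c S (\<lambda>jk. Q \<omega> $$ jk)))}
      \<le> real (card J) * (real N * s\<^sup>2)"
  using J
proof (induction J rule: finite_induct)
  case empty
  thus ?case by simp
next
  case (insert r J)
  interpret prob_space M by (rule gaussian_matD(1)[OF G])
  let ?d = "\<lambda>S \<omega>. cmod (Determinant.det (mixed_mat N t (of_real \<delta>) c S (\<lambda>jk. Q \<omega> $$ jk)))"
  let ?k = "\<delta> * s / (K * real N)"
  have [measurable]: "?d S \<in> borel_measurable M" for S
    by (rule measurable_compose[OF det_mixed_gaussian_measurable[OF G] borel_measurable_norm])
  have k: "?k \<ge> 0" using \<delta> K s by simp
  have r: "r < N" "r \<notin> J \<union> S" using insert by auto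
  let ?E1 = "{\<omega> \<in> space M. ?d (J \<union> S) \<omega> < ?k ^ card J * ?d S \<omega>}"
  let ?E2 = "{\<omega> \<in> space M. ?d (insert r (J \<union> S)) \<omega> < ?k * ?d (J \<union> S) \<omega>}"
  have "prob {\<omega> \<in> space M. ?d (insert r J \<union> S) \<omega> < ?k ^ card (insert r J) * ?d S \<omega>} \<le> prob (?E1 \<union> ?E2)"
  proof (rule finite_measure_mono)
    show "{\<omega> \<in> space M. ?d (insert r J \<union> S) \<omega> < ?k ^ card (insert r J) * ?d S \<omega>} \<subseteq> ?E1 \<union> ?E2"
    proof
      fix \<omega> assume "\<omega> \<in> {\<omega> \<in> space M. ?d (insert r J \<union> S) \<omega> < ?k ^ card (insert r J) * ?d S \<omega>}"
      hence \<omega>: "\<omega> \<in> space M" "?d (insert r (J \<union> S)) \<omega> < ?k * (?k ^ card J * ?d S \<omega>)"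
        using insert.hyps by (auto simp: mult.assoc)
      show "\<omega> \<in> ?E1 \<union> ?E2"
      proof (rule ccontr)
        assume "\<omega> \<notin> ?E1 \<union> ?E2"
        hence 1: "?k ^ card J * ?d S \<omega> \<le> ?d (J \<union> S) \<omega>" and 2: "?k * ?d (J \<union> S) \<omega> \<le> ?d (insert r (J \<union> S)) \<omega>"
          using \<omega>(1) by auto
        show False using mult_left_mono[OF 1 k] 2 \<omega>(2) by linarith
      qed
    qed
    show "?E1 \<union> ?E2 \<in> events" by measurable
  qed
  also have "\<dots> \<le> prob ?E1 + prob ?E2" by (intro measure_Un_le) measurable
  also have "prob ?E1 \<le> real (card J) * (real N * s\<^sup>2)" using insert by auto
  also have "prob ?E2 \<le> real N * s\<^sup>2" by (rule prob_det_add_row[OF G \<delta> K s c r])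
  finally show ?case using insert.hyps by (simp add: algebra_simps)
qed

lemma prob_gaussian_mat_entries:
  assumes G: "gaussian_random_mat M N Q" and \<tau>: "\<tau> \<ge> 0"
  shows "measure M {\<omega> \<in> space M. \<exists>j<N. \<exists>k<N. cmod (Q \<omega> $$ (j, k)) > \<tau>} \<le> (real N)\<^sup>2 * (2 * exp (- \<tau>\<^sup>2 / 2))"
proof -
  interpret prob_space M by (rule gaussian_matD(1)[OF G])
  let ?I = "{..<N} \<times> {..<N}"
  let ?E = "\<lambda>jk. {\<omega> \<in> space M. cmod (Q \<omega> $$ jk) > \<tau>}"
  have E: "?E jk \<in> events" if "jk \<in> ?I" for jk
    using gaussian_mat_measurable[OF G, of "fst jk" "snd jk"] that by auto
  have "{\<omega> \<in> space M. \<exists>j<N. \<exists>k<N. cmod (Q \<omega> $$ (j, k)) > \<tau>} = (\<Union>jk\<in>?I. ?E jk)" by auto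
  also have "prob \<dots> \<le> (\<Sum>jk\<in>?I. prob (?E jk))"
    by (intro finite_measure_subadditive_finite) (use E in auto)
  also have "\<dots> \<le> (\<Sum>jk\<in>?I. 2 * exp (- \<tau>\<^sup>2 / 2))"
    using gaussian_tail[OF gaussian_matD(3)[OF G] \<tau>] by (intro sum_mono) auto
  also have "\<dots> = (real N)\<^sup>2 * (2 * exp (- \<tau>\<^sup>2 / 2))" by (simp add: power2_eq_square)
  finally show ?thesis .
qed

text \<open>By Tonelli's theorem the expected area of the exceptional z is at most q pi R^2, and
  Markov's inequality bounds the probability of a large area. This converts a bound for each fixed z
  into one for a single outcome.\<close>

lemma prob_section_area:
  assumes "prob_space M" and E: "E \<in> sets (M \<Otimes>\<^sub>M (lborel :: complex measure))"
    and q: "\<And>z. measure M {\<omega> \<in> space M. (\<omega>, z) \<in> E} \<le> q" "q \<ge> 0"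
    and R: "R \<ge> 0" and sub: "\<And>\<omega> z. (\<omega>, z) \<in> E \<Longrightarrow> cmod z \<le> R" and \<kappa>: "\<kappa> > 0"
  shows "{\<omega> \<in> space M. measure lborel {z. (\<omega>, z) \<in> E} > \<kappa>} \<in> sets M" (is "?S \<in> _")
    and "measure M {\<omega> \<in> space M. measure lborel {z. (\<omega>, z) \<in> E} > \<kappa>} \<le> q * (pi * R\<^sup>2) / \<kappa>"
proof -
  interpret prob_space M by fact
  interpret P: pair_sigma_finite M "lborel :: complex measure" ..
  have sec: "(\<lambda>\<omega>. emeasure lborel (Pair \<omega> -` E)) \<in> borel_measurable M"
    by (rule lborel.measurable_emeasure_Pair[OF E])
  have eq: "{z. (\<omega>, z) \<in> E} = Pair \<omega> -` E" for \<omega> by auto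
  have fin: "emeasure lborel (Pair \<omega> -` E) < \<infinity>" for \<omega>
  proof -
    have "emeasure lborel (Pair \<omega> -` E) \<le> emeasure lborel (cball (0::complex) R)"
      using sub by (intro emeasure_mono) auto
    also have "\<dots> < \<infinity>" by (rule emeasure_lborel_cball_finite)
    finally show ?thesis .
  qed
  \<comment> \<open>Sections have finite area, so \<kappa> may be compared with
    \<open>emeasure\<close>, whose measurability in \<omega> belongs to Tonelli's theorem.\<close>
  have S_eq: "?S = {\<omega> \<in> space M. ennreal \<kappa> < emeasure lborel (Pair \<omega> -` E)}"
    unfolding eq using fin \<kappa> by (auto simp: emeasure_eq_ennreal_measure less_top[symmetric] ennreal_less_iff)
  show S: "?S \<in> sets M" unfolding S_eq using sec by measurable
  have "ennreal \<kappa> * emeasure M ?S = (\<integral>\<^sup>+ \<omega>. ennreal \<kappa> * indicator ?S \<omega> \<partial>M)"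
    using S by (simp add: nn_integral_cmult_indicator)
  also have "\<dots> \<le> (\<integral>\<^sup>+ \<omega>. emeasure lborel (Pair \<omega> -` E) \<partial>M)"
    by (intro nn_integral_mono) (auto simp: S_eq indicator_def less_imp_le)
  also have "\<dots> = emeasure (M \<Otimes>\<^sub>M lborel) E"
    by (rule lborel.emeasure_pair_measure_alt[OF E, symmetric])
  also have "\<dots> = (\<integral>\<^sup>+ z. emeasure M ((\<lambda>\<omega>. (\<omega>, z)) -` E) \<partial>lborel)"
    by (rule P.emeasure_pair_measure_alt2[OF E])
  also have "\<dots> \<le> (\<integral>\<^sup>+ z. ennreal q * indicator (cball (0::complex) R) z \<partial>lborel)"
  proof (rule nn_integral_mono)
    fix z :: complex
    have space: "(\<lambda>\<omega>. (\<omega>, z)) -` E = {\<omega> \<in> space M. (\<omega>, z) \<in> E}"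
      using sets.sets_into_space[OF E] by (auto simp: space_pair_measure)
    show "emeasure M ((\<lambda>\<omega>. (\<omega>, z)) -` E) \<le> ennreal q * indicator (cball 0 R) z"
    proof (cases "cmod z \<le> R")
      case True
      thus ?thesis unfolding space emeasure_eq_measure using q by (simp add: ennreal_leI)
    next
      case False
      hence "(\<lambda>\<omega>. (\<omega>, z)) -` E = {}" using sub by auto
      thus ?thesis by (simp only: emeasure_empty zero_le)
    qed
  qed
  also have "\<dots> = ennreal (q * (pi * R\<^sup>2))"
    by (subst nn_integral_cmult_indicator) (simp_all add: emeasure_cball_complex R ennreal_mult[symmetric] q)
  finally have "ennreal (\<kappa> * prob ?S) \<le> ennreal (q * (pi * R\<^sup>2))"
    using \<kappa> by (simp add: emeasure_eq_measure ennreal_mult)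
  hence "\<kappa> * prob ?S \<le> q * (pi * R\<^sup>2)" using q by (subst (asm) ennreal_le_iff) auto
  thus "prob ?S \<le> q * (pi * R\<^sup>2) / \<kappa>" using \<kappa> by (simp add: field_simps)
qed

section \<open>Comparison of determinants\<close>

definition toeplitz_shift :: "(int \<Rightarrow> complex) \<Rightarrow> complex \<Rightarrow> nat \<Rightarrow> nat \<Rightarrow> complex" where
  "toeplitz_shift a z i j = a (int i - int j) - (if i = j then z else 0)"

definition circulant_shift :: "(int \<Rightarrow> complex) \<Rightarrow> nat \<Rightarrow> complex \<Rightarrow> nat \<Rightarrow> nat \<Rightarrow> complex" where
  "circulant_shift a N z i j = circulant_entry a N i j - (if i = j then z else 0)"

abbreviation hybrid_mat :: "(int \<Rightarrow> complex) \<Rightarrow> nat \<Rightarrow> real \<Rightarrow> complex \<Rightarrow> nat set \<Rightarrow> complex mat \<Rightarrow> complex mat" where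
  "hybrid_mat a N \<delta> z S q \<equiv> mixed_mat N (toeplitz_shift a z) (complex_of_real \<delta>) (circulant_shift a N z) S (\<lambda>jk. q $$ jk)"

lemma sum_inverse_squares_le:
  assumes "D > 0"
  shows "(\<Sum>i\<in>{D..<n}. 1 / (1 + real i)\<^sup>2) \<le> 1 / real D"
proof -
  have *: "(\<Sum>i\<in>{D..<n}. 1 / (1 + real i)\<^sup>2) \<le> 1 / real D - 1 / real n" if "D \<le> n" for n
    using that
  proof (induction n rule: dec_induct)
    case (step n)
    have n: "real n > 0" using step assms by simp
    have "1 / (1 + real n)\<^sup>2 \<le> 1 / (real n * (1 + real n))"
      using n by (intro divide_left_mono) (auto simp: power2_eq_square)
    also have "\<dots> = 1 / real n - 1 / (1 + real n)" using n by (simp add: field_simps)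
    finally show ?case using step by (simp add: sum.atLeastLessThan_Suc add.commute)
  qed simp
  show ?thesis
  proof (cases "D \<le> n")
    case True
    have "1 / real D - 1 / real n \<le> 1 / real D" by simp
    thus ?thesis using *[OF True] by linarith
  qed simp
qed

lemma toeplitz_row_sum_le:
  assumes summ: "(\<lambda>\<nu>. (1 + \<bar>real_of_int \<nu>\<bar>) * cmod (a \<nu>)) summable_on UNIV"
  shows "(\<Sum>j<N. cmod (a (int i - int j))) \<le> weight_sum a"
proof -
  have "(\<Sum>j<N. cmod (a (int i - int j))) = (\<Sum>\<nu>\<in>(\<lambda>j. int i - int j) ` {..<N}. cmod (a \<nu>))"
    by (subst sum.reindex) (auto simp: inj_on_def)
  also have "\<dots> = (\<Sum>\<^sub>\<infinity>\<nu>\<in>(\<lambda>j. int i - int j) ` {..<N}. cmod (a \<nu>))" by simp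
  also have "\<dots> \<le> weight_sum a" by (rule coeff_infsum_le[OF summ])
  finally show ?thesis .
qed

text \<open>The l2 norm of a row is at most its l1 norm, which is at most W / (1 + d) at distance d
  from the nearer end. Squares of this are summable in d with tail of order 1/D, uniformly in N.
  Replacing the minimum by a sum over both ends lets the reflection i -> N - 1 - i identify the two
  halves.\<close>

lemma toeplitz_circulant_hs_le:
  assumes summ: "(\<lambda>\<nu>. (1 + \<bar>real_of_int \<nu>\<bar>) * cmod (a \<nu>)) summable_on UNIV" and D: "D > 0"
  shows "(\<Sum>i\<in>{D..<N - D}. \<Sum>j<N. (cmod (a (int i - int j) - circulant_entry a N i j))\<^sup>2) \<le> 2 * (weight_sum a)\<^sup>2 / real D"
proof -
  let ?W = "weight_sum a"
  have row: "(\<Sum>j<N. (cmod (a (int i - int j) - circulant_entry a N i j))\<^sup>2)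
      \<le> ?W\<^sup>2 * (1 / (1 + real i)\<^sup>2) + ?W\<^sup>2 * (1 / (1 + real (N - 1 - i))\<^sup>2)" if i: "i \<in> {D..<N - D}" for i
  proof -
    have iN: "i < N" using i by auto
    define d where "d = min i (N - 1 - i)"
    let ?s = "\<Sum>j<N. cmod (a (int i - int j) - circulant_entry a N i j)"
    have "(\<Sum>j<N. (cmod (a (int i - int j) - circulant_entry a N i j))\<^sup>2)
       \<le> (\<Sum>j<N. cmod (a (int i - int j) - circulant_entry a N i j) * ?s)"
      unfolding power2_eq_square by (intro sum_mono mult_left_mono member_le_sum) auto
    also have "\<dots> = ?s\<^sup>2" by (simp add: sum_distrib_right[symmetric] power2_eq_square)
    also have "\<dots> \<le> (?W / (1 + real d))\<^sup>2"
      using circulant_row_diff[OF summ iN, of d] unfolding d_def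
      by (intro power_mono) (auto simp: norm_minus_commute intro: sum_nonneg)
    also have "\<dots> = ?W\<^sup>2 * (1 / (1 + real d)\<^sup>2)" by (simp add: power_divide)
    also have "\<dots> \<le> ?W\<^sup>2 * (1 / (1 + real i)\<^sup>2) + ?W\<^sup>2 * (1 / (1 + real (N - 1 - i))\<^sup>2)"
      unfolding d_def by (auto simp: min_def)
    finally show ?thesis .
  qed
  have "(\<Sum>i\<in>{D..<N - D}. \<Sum>j<N. (cmod (a (int i - int j) - circulant_entry a N i j))\<^sup>2)
     \<le> (\<Sum>i\<in>{D..<N - D}. ?W\<^sup>2 * (1 / (1 + real i)\<^sup>2) + ?W\<^sup>2 * (1 / (1 + real (N - 1 - i))\<^sup>2))"
    by (intro sum_mono row)
  also have "\<dots> = ?W\<^sup>2 * (\<Sum>i\<in>{D..<N - D}. 1 / (1 + real i)\<^sup>2) + ?W\<^sup>2 * (\<Sum>i\<in>{D..<N - D}. 1 / (1 + real (N - 1 - i))\<^sup>2)"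
    by (simp add: sum.distrib sum_distrib_left)
  also have "(\<Sum>i\<in>{D..<N - D}. 1 / (1 + real (N - 1 - i))\<^sup>2) = (\<Sum>i\<in>{D..<N - D}. 1 / (1 + real i)\<^sup>2)"
    by (rule sum.reindex_bij_witness[of _ "\<lambda>i. N - 1 - i" "\<lambda>i. N - 1 - i"]) auto
  also have "?W\<^sup>2 * (\<Sum>i\<in>{D..<N - D}. 1 / (1 + real i)\<^sup>2) + ?W\<^sup>2 * (\<Sum>i\<in>{D..<N - D}. 1 / (1 + real i)\<^sup>2)
     \<le> ?W\<^sup>2 * (1 / real D) + ?W\<^sup>2 * (1 / real D)"
    by (intro add_mono mult_left_mono sum_inverse_squares_le D) auto
  finally show ?thesis by (simp add: power2_eq_square)
qed

lemma sq_add_le: "(x + y)\<^sup>2 \<le> 2 * x\<^sup>2 + 2 * (y::real)\<^sup>2"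
  using zero_le_power2[of "x - y"] by (simp add: power2_eq_square algebra_simps)

text \<open>The squared Hilbert-Schmidt budget (u \<rho>)^2 is split evenly between the
  Toeplitz-circulant mismatch in the middle rows and the noise. For the upper bound the end rows are
  restored deterministically: their row sums are at most W + R + 1, and the hybrid matrix keeps the
  lower bound \<rho>/2 because u \<le> 1/2. The lower bound stops at the hybrid matrix, since
  restoring rows may cancel its determinant.\<close>

lemma hybrid_det_bounds:
  assumes summ: "(\<lambda>\<nu>. (1 + \<bar>real_of_int \<nu>\<bar>) * cmod (a \<nu>)) summable_on UNIV"
    and N: "N > 0" and D: "D > 0" and \<rho>: "\<rho> > 0" and u: "0 < u" "u \<le> 1/2" and \<delta>: "\<delta> \<ge> 0" and \<tau>: "\<tau> \<ge> 0"
    and Dbig: "8 * (weight_sum a)\<^sup>2 / real D \<le> (u * \<rho>)\<^sup>2"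
    and small: "4 * (\<delta> * real N * \<tau>)\<^sup>2 \<le> (u * \<rho>)\<^sup>2" "\<delta> * real N * \<tau> \<le> 1"
    and q: "q \<in> carrier_mat N N" "\<And>j k. j < N \<Longrightarrow> k < N \<Longrightarrow> cmod (q $$ (j, k)) \<le> \<tau>"
    and z: "cmod z \<le> R" and far: "\<And>m. m < N \<Longrightarrow> \<rho> \<le> cmod (laurent_symbol a (unity_root N m) - z)"
  defines "S \<equiv> {D..<N - D}" and "P \<equiv> (\<Prod>m<N. cmod (laurent_symbol a (unity_root N m) - z))"
  shows "(1 - u) ^ N * P \<le> cmod (Determinant.det (hybrid_mat a N \<delta> z S q))"
    and "cmod (Determinant.det (hybrid_mat a N \<delta> z {..<N} q))
      \<le> (1 + 2 * real N * (weight_sum a + R + 1) / \<rho>) ^ (2 * D) * ((1 + u) ^ N * P)"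
proof -
  let ?W = "weight_sum a"
  let ?C = "shifted_circulant a N z"
  let ?X = "hybrid_mat a N \<delta> z S q"
  let ?Y = "hybrid_mat a N \<delta> z {..<N} q"
  have C: "?C \<in> carrier_mat N N" and X: "?X \<in> carrier_mat N N" and Y: "?Y \<in> carrier_mat N N" by simp_all
  have detC: "cmod (Determinant.det ?C) = P"
    unfolding det_shifted_circulant[OF summ N] P_def by (simp add: prod_norm)
  have low: "\<rho> * vnorm v \<le> vnorm (?C *\<^sub>v v)" if "v \<in> carrier_vec N" for v
    using \<rho> by (intro vnorm_shifted_circulant[OF summ N _ far that]) auto
  have entry: "(cmod ((?X - ?C) $$ (i, j)))\<^sup>2
      \<le> (if i \<in> S then 2 * (cmod (a (int i - int j) - circulant_entry a N i j))\<^sup>2 + 2 * (\<delta> * \<tau>)\<^sup>2 else 0)"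
    if ij: "i < N" "j < N" for i j
  proof (cases "i \<in> S")
    case True
    have "(?X - ?C) $$ (i, j) = (a (int i - int j) - circulant_entry a N i j) + of_real \<delta> * q $$ (i, j)"
      using ij True by (simp add: mixed_mat_def shifted_circulant_def toeplitz_shift_def)
    hence "cmod ((?X - ?C) $$ (i, j)) \<le> cmod (a (int i - int j) - circulant_entry a N i j) + \<delta> * cmod (q $$ (i, j))"
      using \<delta> norm_triangle_ineq[of "a (int i - int j) - circulant_entry a N i j" "of_real \<delta> * q $$ (i, j)"]
      by (simp only: norm_mult norm_of_real abs_of_nonneg)
    also have "\<dots> \<le> cmod (a (int i - int j) - circulant_entry a N i j) + \<delta> * \<tau>"
      using q(2)[OF ij] \<delta> by (intro add_left_mono mult_left_mono)
    finally have "(cmod ((?X - ?C) $$ (i, j)))\<^sup>2 \<le> (cmod (a (int i - int j) - circulant_entry a N i j) + \<delta> * \<tau>)\<^sup>2"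
      by (intro power_mono) auto
    thus ?thesis using True sq_add_le[of "cmod (a (int i - int j) - circulant_entry a N i j)" "\<delta> * \<tau>"] by simp
  next
    case False
    thus ?thesis using ij by (simp add: mixed_mat_def shifted_circulant_def circulant_shift_def)
  qed
  have SN: "S \<subseteq> {..<N}" unfolding S_def by auto
  have "(\<Sum>i<N. \<Sum>j<N. (cmod ((?X - ?C) $$ (i, j)))\<^sup>2)
     \<le> (\<Sum>i<N. if i \<in> S then (\<Sum>j<N. 2 * (cmod (a (int i - int j) - circulant_entry a N i j))\<^sup>2 + 2 * (\<delta> * \<tau>)\<^sup>2) else 0)"
  proof (rule sum_mono)
    fix i assume "i \<in> {..<N}"
    hence "(\<Sum>j<N. (cmod ((?X - ?C) $$ (i, j)))\<^sup>2)
      \<le> (\<Sum>j<N. if i \<in> S then 2 * (cmod (a (int i - int j) - circulant_entry a N i j))\<^sup>2 + 2 * (\<delta> * \<tau>)\<^sup>2 else 0)"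
      using entry by (intro sum_mono) auto
    thus "(\<Sum>j<N. (cmod ((?X - ?C) $$ (i, j)))\<^sup>2)
      \<le> (if i \<in> S then (\<Sum>j<N. 2 * (cmod (a (int i - int j) - circulant_entry a N i j))\<^sup>2 + 2 * (\<delta> * \<tau>)\<^sup>2) else 0)"
      by (cases "i \<in> S") auto
  qed
  also have "\<dots> = (\<Sum>i\<in>S. \<Sum>j<N. 2 * (cmod (a (int i - int j) - circulant_entry a N i j))\<^sup>2 + 2 * (\<delta> * \<tau>)\<^sup>2)"
    using SN by (subst sum.inter_restrict[symmetric]) (auto simp: Int_absorb1)
  also have "\<dots> = 2 * (\<Sum>i\<in>S. \<Sum>j<N. (cmod (a (int i - int j) - circulant_entry a N i j))\<^sup>2) + real (card S) * (real N * (2 * (\<delta> * \<tau>)\<^sup>2))"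
    by (simp add: sum.distrib sum_distrib_left)
  also have "\<dots> \<le> 2 * (2 * ?W\<^sup>2 / real D) + real N * (real N * (2 * (\<delta> * \<tau>)\<^sup>2))"
  proof (intro add_mono mult_left_mono mult_right_mono)
    show "(\<Sum>i\<in>S. \<Sum>j<N. (cmod (a (int i - int j) - circulant_entry a N i j))\<^sup>2) \<le> 2 * ?W\<^sup>2 / real D"
      unfolding S_def by (rule toeplitz_circulant_hs_le[OF summ D])
    show "real (card S) \<le> real N" using card_mono[OF _ SN] by simp
  qed auto
  also have "\<dots> = (8 * ?W\<^sup>2 / real D) / 2 + (4 * (\<delta> * real N * \<tau>)\<^sup>2) / 2"
    by (simp add: power2_eq_square)
  also have "\<dots> \<le> (u * \<rho>)\<^sup>2"
  proof -
    have "x / 2 + y / 2 \<le> w" if "x \<le> w" "y \<le> w" for x y w :: real using that by linarith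
    thus ?thesis using Dbig small(1) by blast
  qed
  finally have HS: "sqrt (\<Sum>i<N. \<Sum>j<N. (cmod ((?X - ?C) $$ (i, j)))\<^sup>2) \<le> u * \<rho>"
    using u \<rho> by (intro real_le_lsqrt) (auto simp: sum_nonneg)
  have pert: "vnorm ((?X - ?C) *\<^sub>v v) \<le> u * \<rho> * vnorm v" if v: "v \<in> carrier_vec N" for v
  proof -
    have "vnorm ((?X - ?C) *\<^sub>v v) \<le> sqrt (\<Sum>i<N. \<Sum>j<N. (cmod ((?X - ?C) $$ (i, j)))\<^sup>2) * vnorm v"
      by (rule vnorm_mult_mat_vec_le[OF minus_carrier_mat[OF C] v])
    also have "\<dots> \<le> u * \<rho> * vnorm v" by (intro mult_right_mono HS vnorm_nonneg)
    finally show ?thesis .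
  qed
  have u1: "0 \<le> u" "u < 1" using u by auto
  note perturb = det_relative_perturbation[OF C X \<rho> u1 low pert]
  show "(1 - u) ^ N * P \<le> cmod (Determinant.det ?X)" using perturb(1) unfolding detC by simp
  have lowX: "\<rho> / 2 * vnorm v \<le> vnorm (?X *\<^sub>v v)" if v: "v \<in> carrier_vec N" for v
  proof -
    have "?C *\<^sub>v v = ?X *\<^sub>v v + (-1) \<cdot>\<^sub>v ((?X - ?C) *\<^sub>v v)"
    proof -
      have "(?X - ?C) *\<^sub>v v = ?X *\<^sub>v v - ?C *\<^sub>v v" by (rule minus_mult_distrib_mat_vec[OF X C v])
      thus ?thesis by (intro eq_vecI) (auto simp: mixed_mat_def shifted_circulant_def)
    qed
    hence "vnorm (?C *\<^sub>v v) \<le> vnorm (?X *\<^sub>v v) + vnorm ((-1) \<cdot>\<^sub>v ((?X - ?C) *\<^sub>v v))"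
      using X C v by (metis vnorm_triangle mult_mat_vec_carrier smult_carrier_vec minus_carrier_mat)
    also have "vnorm ((-1) \<cdot>\<^sub>v ((?X - ?C) *\<^sub>v v)) = vnorm ((?X - ?C) *\<^sub>v v)" by (simp add: vnorm_smult)
    also have "\<dots> \<le> u * \<rho> * vnorm v" by (rule pert[OF v])
    also have "\<dots> \<le> 1/2 * (\<rho> * vnorm v)"
      unfolding mult.assoc using u \<rho> vnorm_nonneg[of v] by (intro mult_right_mono) auto
    finally show ?thesis using low[OF v] by linarith
  qed
  let ?J = "{..<N} - S"
  let ?b = "real N * (?W + R + 1) / (\<rho> / 2)"
  have "cmod (Determinant.det ?Y) \<le> ?b ^ card ?J * cmod (Determinant.det ?X)"
  proof (rule det_replace_rows_le[OF X Y _ lowX])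
    show "?Y $$ (i, j) = ?X $$ (i, j)" if "i < N" "i \<notin> ?J" "j < N" for i j
      using that by (simp add: mixed_mat_def)
    fix i assume "i \<in> ?J"
    hence i: "i < N" by auto
    have "(\<Sum>j<N. cmod (?Y $$ (i, j))) \<le> (\<Sum>j<N. cmod (a (int i - int j)) + (if i = j then R else 0) + \<delta> * \<tau>)"
    proof (rule sum_mono)
      fix j assume "j \<in> {..<N}"
      hence j: "j < N" by simp
      have "?Y $$ (i, j) = a (int i - int j) - (if i = j then z else 0) + of_real \<delta> * q $$ (i, j)"
        using i j by (simp add: mixed_mat_def toeplitz_shift_def)
      hence "cmod (?Y $$ (i, j)) \<le> cmod (a (int i - int j) - (if i = j then z else 0)) + \<delta> * cmod (q $$ (i, j))"
        using \<delta> by (metis norm_triangle_ineq norm_mult norm_of_real abs_of_nonneg)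
      also have "cmod (a (int i - int j) - (if i = j then z else 0)) \<le> cmod (a (int i - int j)) + (if i = j then R else 0)"
        using z norm_triangle_ineq4[of "a (int i - int j)" z] by auto
      also have "\<delta> * cmod (q $$ (i, j)) \<le> \<delta> * \<tau>" using q(2)[OF i j] \<delta> by (rule mult_left_mono)
      finally show "cmod (?Y $$ (i, j)) \<le> cmod (a (int i - int j)) + (if i = j then R else 0) + \<delta> * \<tau>" by simp
    qed
    also have "\<dots> = (\<Sum>j<N. cmod (a (int i - int j))) + R + \<delta> * real N * \<tau>"
      using i by (simp add: sum.distrib)
    also have "\<dots> \<le> ?W + R + 1" using toeplitz_row_sum_le[OF summ, of i N] small(2) by linarith
    finally show "(\<Sum>j<N. cmod (?Y $$ (i, j))) \<le> ?W + R + 1" .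
  qed (use \<rho> in auto)
  also have "\<dots> \<le> (1 + ?b) ^ (2 * D) * ((1 + u) ^ N * P)"
  proof (rule mult_mono)
    have R0: "R \<ge> 0" using z norm_ge_zero[of z] by linarith
    have b: "?b \<ge> 0" using weight_sum_nonneg[OF summ] R0 \<rho> by simp
    \<comment> \<open>With truncated subtraction the two end blocks still cover everything when N
      \<le> 2 D and S is empty.\<close>
    have "{..<N} - S \<subseteq> {..<D} \<union> {N - D..<N}" unfolding S_def by auto
    hence "card ?J \<le> card ({..<D} \<union> {N - D..<N})" by (intro card_mono) auto
    also have "\<dots> \<le> D + (N - (N - D))" using card_Un_le[of "{..<D}" "{N - D..<N}"] by simp
    finally have cJ: "card ?J \<le> 2 * D" by simp
    have "?b ^ card ?J \<le> (1 + ?b) ^ card ?J" using b by (intro power_mono) auto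
    also have "\<dots> \<le> (1 + ?b) ^ (2 * D)" using b cJ by (intro power_increasing) auto
    finally show "?b ^ card ?J \<le> (1 + ?b) ^ (2 * D)" .
    show "cmod (Determinant.det ?X) \<le> (1 + u) ^ N * P" using perturb(2) unfolding detC by simp
    show "0 \<le> (1 + ?b) ^ (2 * D)" using b by simp
  qed auto
  also have "1 + ?b = 1 + 2 * real N * (?W + R + 1) / \<rho>" by simp
  finally show "cmod (Determinant.det ?Y) \<le> (1 + 2 * real N * (?W + R + 1) / \<rho>) ^ (2 * D) * ((1 + u) ^ N * P)" .
qed

section \<open>Asymptotic size of the losses\<close>

lemma ev_noise_small:
  fixes \<delta>0 \<delta>1 c :: real
  assumes "0 < \<delta>0" "\<delta>0 < 1" "\<delta>1 > 3 / 2" "c > 0"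
  shows "eventually (\<lambda>N. real N powr (- \<delta>1) * real N * (4 * real N powr (\<delta>0 / 2)) \<le> c) sequentially"
proof -
  \<comment> \<open>The exponent collects \<delta>, the dimension and the entry bound; it is
    negative because \<delta>0/2 < 1/2 < \<delta>1 - 1.\<close>
  have "eventually (\<lambda>N. 4 * real N powr (1 + \<delta>0 / 2 - \<delta>1) < c) sequentially"
  proof (rule order_tendstoD)
    have "(\<lambda>N. real N powr (1 + \<delta>0 / 2 - \<delta>1)) \<longlonglongrightarrow> 0"
      using assms by (intro tendsto_neg_powr filterlim_real_sequentially) auto
    from tendsto_mult_right_zero[OF this, of 4] show "(\<lambda>N. 4 * real N powr (1 + \<delta>0 / 2 - \<delta>1)) \<longlonglongrightarrow> 0" .
  qed (use assms in auto)
  thus ?thesis using eventually_gt_at_top[of 0]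
  proof eventually_elim
    case (elim N)
    have "real N powr (- \<delta>1) * real N * (4 * real N powr (\<delta>0 / 2))
       = 4 * (real N powr 1 * real N powr (\<delta>0 / 2) * real N powr (- \<delta>1))" using elim by simp
    also have "\<dots> = 4 * real N powr (1 + \<delta>0 / 2 - \<delta>1)" by (simp only: powr_add[symmetric]) simp
    finally show ?case using elim by simp
  qed
qed

lemma ev_upper_loss:
  fixes c e :: real
  assumes "c > 0" "e > 0"
  shows "eventually (\<lambda>N. (1 + 2 * real N * c) ^ k \<le> exp (e * real N)) sequentially"
proof -
  have "(\<lambda>N. ln (1 + 2 * real N * c) / real N) \<longlonglongrightarrow> 0" using assms by real_asymp
  hence "eventually (\<lambda>N. ln (1 + 2 * real N * c) / real N < e / (real k + 1)) sequentially"
    using assms by (intro order_tendstoD(2)) auto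
  thus ?thesis using eventually_gt_at_top[of 0]
  proof eventually_elim
    case (elim N)
    have pos: "1 + 2 * real N * c > 0" using assms by (simp add: add_pos_nonneg)
    have "ln (1 + 2 * real N * c) \<ge> 0" using assms by simp
    have "real k * ln (1 + 2 * real N * c) \<le> (real k + 1) * ln (1 + 2 * real N * c)"
      using \<open>ln (1 + 2 * real N * c) \<ge> 0\<close> by (intro mult_right_mono) auto
    also have "\<dots> \<le> e * real N" using elim by (simp add: field_simps)
    finally have "exp (real k * ln (1 + 2 * real N * c)) \<le> exp (e * real N)" by simp
    thus ?case using pos by (simp add: exp_of_nat_mult)
  qed
qed

text \<open>The loss per row is \<open>exp (- ?L)\<close>: one N^\<delta>0 comes from the smallest
  admissible \<delta>, two from the small-ball radius. With k fixed and \<delta>0 < 1 the total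
  exponent is o(N). The threshold for N is uniform in \<delta>.\<close>

lemma ev_lower_loss:
  fixes K e \<delta>0 :: real
  assumes "K \<ge> 1" "e > 0" "0 < \<delta>0" "\<delta>0 < 1"
  shows "eventually (\<lambda>N. \<forall>\<delta>. exp (- (real N powr \<delta>0)) \<le> \<delta> \<longrightarrow>
     exp (- e * real N) \<le> (\<delta> * exp (- 2 * real N powr \<delta>0) / (K * real N)) ^ k) sequentially"
proof -
  have "(\<lambda>N. (3 * real N powr \<delta>0 + ln K + ln (real N)) / real N) \<longlonglongrightarrow> 0"
    using assms by real_asymp
  hence "eventually (\<lambda>N. (3 * real N powr \<delta>0 + ln K + ln (real N)) / real N < e / (real k + 1)) sequentially"
    using assms by (intro order_tendstoD(2)) auto
  thus ?thesis using eventually_gt_at_top[of 0]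
  proof eventually_elim
    case (elim N)
    show ?case
    proof (intro allI impI)
      fix \<delta> assume \<delta>: "exp (- (real N powr \<delta>0)) \<le> \<delta>"
      let ?L = "3 * real N powr \<delta>0 + ln K + ln (real N)"
      have L0: "?L \<ge> 0" using assms elim by simp
      have "real k * ?L \<le> (real k + 1) * ?L" using L0 by (intro mult_right_mono) auto
      also have "\<dots> \<le> e * real N" using elim by (simp add: field_simps)
      finally have "- e * real N \<le> real k * (- ?L)"
        by (simp only: mult_minus_right mult_minus_left neg_le_iff_le)
      hence "exp (- e * real N) \<le> exp (real k * (- ?L))" by (simp only: exp_le_cancel_iff)
      also have "\<dots> = exp (- ?L) ^ k" by (rule exp_of_nat_mult)
      also have "exp (- ?L) = exp (- (real N powr \<delta>0)) * exp (- 2 * real N powr \<delta>0) / (K * real N)"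
      proof -
        have "- ?L = - (real N powr \<delta>0) + - 2 * real N powr \<delta>0 + - (ln K + ln (real N))" by simp
        hence "exp (- ?L) = exp (- (real N powr \<delta>0)) * exp (- 2 * real N powr \<delta>0) * exp (- (ln K + ln (real N)))"
          by (simp only: exp_add)
        also have "exp (- (ln K + ln (real N))) = inverse (K * real N)"
          using assms elim by (simp only: exp_minus exp_add exp_ln)
        finally show ?thesis by (simp add: divide_inverse)
      qed
      also have "\<dots> ^ k \<le> (\<delta> * exp (- 2 * real N powr \<delta>0) / (K * real N)) ^ k"
        using \<delta> assms elim by (intro power_mono divide_right_mono mult_right_mono) auto
      finally show "exp (- e * real N) \<le> (\<delta> * exp (- 2 * real N powr \<delta>0) / (K * real N)) ^ k" .
    qed
  qed
qed

text \<open>Here exp (-4 N^\<delta>0) is the square of the small-ball radius exp (-2 N^\<delta>0),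
  and N^2 counts rows times columns in the union bounds. Any exponent above 1 per unit of
  N^\<delta>0 leaves room for an arbitrary constant c.\<close>

lemma ev_union_bound:
  fixes c \<delta>0 :: real
  assumes "c > 0" "0 < \<delta>0"
  shows "eventually (\<lambda>N. (real N)\<^sup>2 * exp (- 4 * real N powr \<delta>0) \<le> c * exp (- (real N powr \<delta>0))) sequentially"
proof -
  have "(\<lambda>N. (real N)\<^sup>2 * exp (- 3 * real N powr \<delta>0)) \<longlonglongrightarrow> 0" using assms by real_asymp
  hence "eventually (\<lambda>N. (real N)\<^sup>2 * exp (- 3 * real N powr \<delta>0) < c) sequentially"
    using assms by (intro order_tendstoD(2)) auto
  thus ?thesis
  proof eventually_elim
    case (elim N)
    have "(real N)\<^sup>2 * exp (- 4 * real N powr \<delta>0) = ((real N)\<^sup>2 * exp (- 3 * real N powr \<delta>0)) * exp (- (real N powr \<delta>0))"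
      by (simp add: mult.assoc exp_add[symmetric])
    also have "\<dots> \<le> c * exp (- (real N powr \<delta>0))" using elim by (intro mult_right_mono) auto
    finally show ?case .
  qed
qed

section \<open>Comparison of the full determinant with the circulant product\<close>

abbreviation perturbed_shift :: "(int \<Rightarrow> complex) \<Rightarrow> nat \<Rightarrow> real \<Rightarrow> complex \<Rightarrow> complex mat \<Rightarrow> complex mat" where
  "perturbed_shift a N \<delta> z q \<equiv> hybrid_mat a N \<delta> z {..<N} q"

definition circulant_prod :: "(int \<Rightarrow> complex) \<Rightarrow> nat \<Rightarrow> complex \<Rightarrow> real" where
  "circulant_prod a N z = (\<Prod>m<N. cmod (laurent_symbol a (unity_root N m) - z))"

definition entries_bounded :: "nat \<Rightarrow> real \<Rightarrow> complex mat \<Rightarrow> bool" where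
  "entries_bounded N \<tau> q \<longleftrightarrow> (\<forall>j<N. \<forall>k<N. cmod (q $$ (j, k)) \<le> \<tau>)"

text \<open>Products instead of a difference of logarithms: the condition keeps its meaning when a
  determinant vanishes.\<close>

definition det_close :: "(int \<Rightarrow> complex) \<Rightarrow> nat \<Rightarrow> real \<Rightarrow> real \<Rightarrow> complex \<Rightarrow> complex mat \<Rightarrow> bool" where
  "det_close a N \<delta> \<eta> z q \<longleftrightarrow>
     exp (- \<eta> * real N) * circulant_prod a N z \<le> cmod (Determinant.det (perturbed_shift a N \<delta> z q)) \<and>
     cmod (Determinant.det (perturbed_shift a N \<delta> z q)) \<le> exp (\<eta> * real N) * circulant_prod a N z"

text \<open>When the entries are bounded the upper half of \<open>det_close\<close> always holds, so
  a failure violates the lower half and lies in the bad event of \<open>prob_det_add_rows\<close>.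
  The quantifier over z is inside \<open>eventually\<close>, as Tonelli's theorem later needs one
  threshold for all z.\<close>

lemma prob_det_close:
  fixes \<delta>0 \<delta>1 \<rho> R \<eta> c0 :: real
  assumes summ: "(\<lambda>\<nu>. (1 + \<bar>real_of_int \<nu>\<bar>) * cmod (a \<nu>)) summable_on UNIV"
    and d: "0 < \<delta>0" "\<delta>0 < 1" "\<delta>1 > 3 / 2" and \<rho>: "\<rho> > 0" and R: "R \<ge> 0" and \<eta>: "\<eta> > 0" and c0: "c0 > 0"
  shows "eventually (\<lambda>N. \<forall>(M :: 'w measure) Q \<delta> z. gaussian_random_mat M N Q \<longrightarrow>
     exp (- (real N powr \<delta>0)) \<le> \<delta> \<longrightarrow> \<delta> \<le> real N powr (- \<delta>1) \<longrightarrow> cmod z \<le> R \<longrightarrow>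
     (\<forall>m<N. \<rho> \<le> cmod (laurent_symbol a (unity_root N m) - z)) \<longrightarrow>
     measure M {\<omega> \<in> space M. entries_bounded N (4 * real N powr (\<delta>0 / 2)) (Q \<omega>) \<and> \<not> det_close a N \<delta> \<eta> z (Q \<omega>)}
       \<le> c0 * exp (- (real N powr \<delta>0))) sequentially"
proof -
  let ?W = "weight_sum a"
  have W: "?W \<ge> 0" by (rule weight_sum_nonneg[OF summ])
  define K where "K = ?W + R + 1"
  have K: "K \<ge> 1" using W R by (simp add: K_def)
  \<comment> \<open>For u \<le> 1/2 one has 1 - u \<ge> exp (-2 u), so u \<le> \<eta>/4 keeps (1 -
    u)^N above exp (- \<eta> N / 2). The other half of the exponent is left for the end
    rows.\<close>
  define u where "u = min (1/2) (\<eta> / 4)"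
  have u: "0 < u" "u \<le> 1/2" "u \<le> \<eta> / 4" using \<eta> by (auto simp: u_def)
  \<comment> \<open>The number of rows to be restored depends on u, \<rho> and the weight sum, not
    on N. The added 1 makes it positive.\<close>
  obtain D :: nat where D: "8 * ?W\<^sup>2 / (u * \<rho>)\<^sup>2 + 1 \<le> real D" using real_arch_simple by blast
  have up: "(u * \<rho>)\<^sup>2 > 0" using u \<rho> by simp
  have "8 * ?W\<^sup>2 / (u * \<rho>)\<^sup>2 \<ge> 0" by simp
  from add_mono[OF this order_refl[of 1]] D have "0 + 1 \<le> real D" by (rule order.trans)
  hence D0: "D > 0" by simp
  have Dbig: "8 * ?W\<^sup>2 / real D \<le> (u * \<rho>)\<^sup>2"
  proof -
    have "8 * ?W\<^sup>2 / (u * \<rho>)\<^sup>2 \<le> real D" using D by simp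
    thus ?thesis using up D0 by (simp add: field_simps)
  qed
  let ?n = "\<lambda>N. real N powr (- \<delta>1) * real N * (4 * real N powr (\<delta>0 / 2))"
  have e1: "eventually (\<lambda>N. ?n N \<le> min 1 (u * \<rho> / 2)) sequentially"
    using u \<rho> by (intro ev_noise_small d) auto
  have e2: "eventually (\<lambda>N. (1 + 2 * real N * (K / \<rho>)) ^ (2 * D) \<le> exp (\<eta> / 2 * real N)) sequentially"
    using K \<rho> \<eta> by (intro ev_upper_loss) auto
  have e3: "eventually (\<lambda>N. \<forall>\<delta>. exp (- (real N powr \<delta>0)) \<le> \<delta> \<longrightarrow>
     exp (- (\<eta> / 2) * real N) \<le> (\<delta> * exp (- 2 * real N powr \<delta>0) / (K * real N)) ^ (2 * D)) sequentially"
    using K \<eta> d by (intro ev_lower_loss) auto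
  have e4: "eventually (\<lambda>N. (real N)\<^sup>2 * exp (- 4 * real N powr \<delta>0) \<le> c0 * exp (- (real N powr \<delta>0))) sequentially"
    by (intro ev_union_bound c0 d)
  show ?thesis using e1 e2 e3 e4 eventually_gt_at_top[of 0]
  proof eventually_elim
    case (elim N)
    show ?case
    proof (intro allI impI)
      fix M :: "'w measure" and Q \<delta> z
      assume G: "gaussian_random_mat M N Q" and \<delta>: "exp (- (real N powr \<delta>0)) \<le> \<delta>" "\<delta> \<le> real N powr (- \<delta>1)"
        and z: "cmod z \<le> R" and far: "\<forall>m<N. \<rho> \<le> cmod (laurent_symbol a (unity_root N m) - z)"
      interpret prob_space M by (rule gaussian_matD(1)[OF G])
      have N: "N > 0" using elim by simp
      let ?\<tau> = "4 * real N powr (\<delta>0 / 2)"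
      let ?S = "{D..<N - D}"
      let ?s = "exp (- 2 * real N powr \<delta>0)"
      let ?P = "circulant_prod a N z"
      let ?k = "\<delta> * ?s / (K * real N)"
      have dpos: "\<delta> > 0" using \<delta>(1) exp_gt_zero[of "- (real N powr \<delta>0)"] by linarith
      have P0: "?P \<ge> 0" unfolding circulant_prod_def by (intro prod_nonneg) auto
      have noise: "\<delta> * real N * ?\<tau> \<le> min 1 (u * \<rho> / 2)"
      proof -
        have "\<delta> * real N * ?\<tau> \<le> ?n N" using \<delta>(2) by (intro mult_right_mono) auto
        thus ?thesis using elim(1) by linarith
      qed
      have noise2: "4 * (\<delta> * real N * ?\<tau>)\<^sup>2 \<le> (u * \<rho>)\<^sup>2"
      proof -
        have "(\<delta> * real N * ?\<tau>)\<^sup>2 \<le> (u * \<rho> / 2)\<^sup>2" using noise dpos by (intro power_mono) auto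
        thus ?thesis by (simp add: power_divide)
      qed
      have dle1: "\<delta> \<le> 1"
      proof -
        have "real N powr (- \<delta>1) \<le> real N powr 0" using N d by (intro powr_mono) auto
        thus ?thesis using \<delta>(2) N by simp
      qed
      have kle: "0 \<le> ?k" "?k \<le> 1"
      proof -
        show "0 \<le> ?k" using dpos K by simp
        have "\<delta> * ?s \<le> 1 * 1" using dle1 dpos by (intro mult_mono) auto
        moreover have "1 * 1 \<le> K * real N" using K N by (intro mult_mono) auto
        ultimately show "?k \<le> 1" using K N by (simp add: divide_le_eq)
      qed
      have J: "finite ({..<N} - ?S)" "{..<N} - ?S \<subseteq> {..<N}" "({..<N} - ?S) \<inter> ?S = {}" by auto
      have JS: "({..<N} - ?S) \<union> ?S = {..<N}" by auto
      have cJ: "card ({..<N} - ?S) \<le> 2 * D"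
      proof -
        have "{..<N} - ?S \<subseteq> {..<D} \<union> {N - D..<N}" by auto
        hence "card ({..<N} - ?S) \<le> card ({..<D} \<union> {N - D..<N})" by (intro card_mono) auto
        also have "\<dots> \<le> D + (N - (N - D))" using card_Un_le[of "{..<D}" "{N - D..<N}"] by simp
        finally show ?thesis by simp
      qed
      have cN: "card ({..<N} - ?S) \<le> N" using card_mono[of "{..<N}" "{..<N} - ?S"] by auto
      let ?bad = "{\<omega> \<in> space M. cmod (Determinant.det (hybrid_mat a N \<delta> z ({..<N} - ?S \<union> ?S) (Q \<omega>)))
        < ?k ^ card ({..<N} - ?S) * cmod (Determinant.det (hybrid_mat a N \<delta> z ?S (Q \<omega>)))}"
      have circ: "cmod (circulant_shift a N z i j) \<le> K" if "i < N" "j < N" for i j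
        using circulant_entry_le[OF summ, of N i j] z R norm_triangle_ineq4[of "circulant_entry a N i j" z]
        unfolding circulant_shift_def K_def by (cases "i = j") auto
      have "prob ?bad \<le> real (card ({..<N} - ?S)) * (real N * ?s\<^sup>2)"
        by (rule prob_det_add_rows[OF G dpos _ _ circ J]) (use K in auto)
      also have "\<dots> \<le> real N * (real N * ?s\<^sup>2)" using cN by (intro mult_right_mono) auto
      also have "\<dots> = (real N)\<^sup>2 * exp (- 4 * real N powr \<delta>0)" by (simp add: power2_eq_square exp_add[symmetric])
      also have "\<dots> \<le> c0 * exp (- (real N powr \<delta>0))" by (rule elim(4))
      finally have pbad: "prob ?bad \<le> c0 * exp (- (real N powr \<delta>0))" .
      have "{\<omega> \<in> space M. entries_bounded N ?\<tau> (Q \<omega>) \<and> \<not> det_close a N \<delta> \<eta> z (Q \<omega>)} \<subseteq> ?bad"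
      proof
        fix \<omega> assume "\<omega> \<in> {\<omega> \<in> space M. entries_bounded N ?\<tau> (Q \<omega>) \<and> \<not> det_close a N \<delta> \<eta> z (Q \<omega>)}"
        hence \<omega>: "\<omega> \<in> space M" and eb: "entries_bounded N ?\<tau> (Q \<omega>)" and nc: "\<not> det_close a N \<delta> \<eta> z (Q \<omega>)" by auto
        have ent: "cmod (Q \<omega> $$ (j, k)) \<le> ?\<tau>" if "j < N" "k < N" for j k
          using eb that unfolding entries_bounded_def by blast
        have \<tau>0: "?\<tau> \<ge> 0" and n1: "\<delta> * real N * ?\<tau> \<le> 1" and d0: "\<delta> \<ge> 0" using noise dpos by auto
        have far': "\<rho> \<le> cmod (laurent_symbol a (unity_root N m) - z)" if "m < N" for m using far that by blast
        note hb = hybrid_det_bounds[OF summ N D0 \<rho> u(1,2) d0 \<tau>0 Dbig noise2 n1 gaussian_matD(2)[OF G \<omega>] ent z far']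
        have up: "cmod (Determinant.det (perturbed_shift a N \<delta> z (Q \<omega>))) \<le> exp (\<eta> * real N) * ?P"
        proof -
          have "cmod (Determinant.det (perturbed_shift a N \<delta> z (Q \<omega>))) \<le> (1 + 2 * real N * (K / \<rho>)) ^ (2 * D) * ((1 + u) ^ N * ?P)"
            using hb(2) unfolding K_def circulant_prod_def by simp
          also have "\<dots> \<le> exp (\<eta> / 2 * real N) * (exp (\<eta> / 4 * real N) * ?P)"
          proof (intro mult_mono mult_right_mono elim(2) P0)
            have "(1 + u) ^ N \<le> exp u ^ N" using u by (intro power_mono) auto
            also have "\<dots> = exp (real N * u)" by (simp add: exp_of_nat_mult)
            also have "\<dots> \<le> exp (\<eta> / 4 * real N)"
              using mult_left_mono[OF u(3), of "real N"] by (simp only: exp_le_cancel_iff mult.commute of_nat_0_le_iff)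
            finally show "(1 + u) ^ N \<le> exp (\<eta> / 4 * real N)" .
          qed (use u P0 in auto)
          also have "\<dots> = exp (\<eta> / 2 * real N + \<eta> / 4 * real N) * ?P" by (simp only: exp_add mult.assoc)
          also have "\<dots> \<le> exp (\<eta> * real N) * ?P" using \<eta> P0 by (intro mult_right_mono) auto
          finally show ?thesis .
        qed
        hence lo: "cmod (Determinant.det (perturbed_shift a N \<delta> z (Q \<omega>))) < exp (- \<eta> * real N) * ?P"
          using nc unfolding det_close_def by linarith
        have "exp (- \<eta> * real N) * ?P \<le> ?k ^ card ({..<N} - ?S) * cmod (Determinant.det (hybrid_mat a N \<delta> z ?S (Q \<omega>)))"
        proof -
          have "exp (- \<eta> * real N) * ?P = exp (- (\<eta> / 2) * real N + - (\<eta> / 2) * real N) * ?P" by simp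
          also have "\<dots> = exp (- (\<eta> / 2) * real N) * (exp (- (\<eta> / 2) * real N) * ?P)" by (simp only: exp_add mult.assoc)
          also have "\<dots> \<le> ?k ^ card ({..<N} - ?S) * cmod (Determinant.det (hybrid_mat a N \<delta> z ?S (Q \<omega>)))"
          proof (rule mult_mono)
            have "exp (- (\<eta> / 2) * real N) \<le> ?k ^ (2 * D)" using elim(3) \<delta>(1) by blast
            \<comment> \<open>Only an upper bound for the number of end rows is known, hence the
              need for \<open>?k \<le> 1\<close>.\<close>
            also have "\<dots> \<le> ?k ^ card ({..<N} - ?S)" by (rule power_decreasing[OF cJ kle])
            finally show "exp (- (\<eta> / 2) * real N) \<le> ?k ^ card ({..<N} - ?S)" .
            have "exp (- (\<eta> / 2) * real N) \<le> exp (- 2 * u) ^ N"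
            proof -
              have "u * real N \<le> \<eta> / 4 * real N" using u(3) by (intro mult_right_mono) auto
              hence "- (\<eta> / 2) * real N \<le> real N * (- 2 * u)" by (simp add: mult.commute)
              thus ?thesis by (simp only: exp_of_nat_mult[symmetric] exp_le_cancel_iff)
            qed
            also have "\<dots> \<le> (1 - u) ^ N"
            proof (rule power_mono)
              have "- u - 2 * u\<^sup>2 \<le> ln (1 - u)" using u by (intro ln_one_minus_pos_lower_bound) auto
              moreover have "2 * u\<^sup>2 \<le> u" using u mult_left_mono[of u "1/2" u] by (simp add: power2_eq_square)
              ultimately have "exp (- 2 * u) \<le> exp (ln (1 - u))" by simp
              thus "exp (- 2 * u) \<le> 1 - u" using u by simp
            qed simp
            finally have "exp (- (\<eta> / 2) * real N) * ?P \<le> (1 - u) ^ N * ?P" using P0 by (intro mult_right_mono)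
            also have "\<dots> \<le> cmod (Determinant.det (hybrid_mat a N \<delta> z ?S (Q \<omega>)))"
              using hb(1) unfolding circulant_prod_def .
            finally show "exp (- (\<eta> / 2) * real N) * ?P \<le> cmod (Determinant.det (hybrid_mat a N \<delta> z ?S (Q \<omega>)))" .
          qed (use kle P0 in auto)
          finally show ?thesis .
        qed
        thus "\<omega> \<in> ?bad" using lo \<omega> unfolding JS by simp
      qed
      moreover have "?bad \<in> events"
      proof -
        have [measurable]: "(\<lambda>\<omega>. cmod (Determinant.det (hybrid_mat a N \<delta> z S (Q \<omega>)))) \<in> borel_measurable M" for S
          by (rule measurable_compose[OF det_mixed_gaussian_measurable[OF G] borel_measurable_norm])
        show ?thesis by measurable
      qed
      ultimately show "prob {\<omega> \<in> space M. entries_bounded N ?\<tau> (Q \<omega>) \<and> \<not> det_close a N \<delta> \<eta> z (Q \<omega>)}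
         \<le> c0 * exp (- (real N powr \<delta>0))"
        using pbad finite_measure_mono by (meson order.trans)
    qed
  qed
qed

section \<open>Linear statistics of the spectrum\<close>

lemma perturbed_shift_eq:
  assumes "q \<in> carrier_mat N N"
  shows "perturbed_shift a N \<delta> z q
    = mat N N (\<lambda>(i, j). (toeplitz_mat a N + complex_of_real \<delta> \<cdot>\<^sub>m q) $$ (i, j) - (if i = j then z else 0))"
  using assms by (intro eq_matI) (auto simp: mixed_mat_def toeplitz_shift_def toeplitz_mat_def)

text \<open>Positivity of the product forces every factor to be positive, so no logarithm takes its
  default value.\<close>

lemma ln_prod_list_cmod:
  assumes "(\<Prod>a\<leftarrow>as. cmod (z - a)) > 0"
  shows "ln (\<Prod>a\<leftarrow>as. cmod (z - a)) = (\<Sum>a\<leftarrow>as. ln (cmod (z - a)))"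
  using assms
proof (induction as)
  case (Cons a as)
  have nn: "(\<Prod>a\<leftarrow>as. cmod (z - a)) \<ge> 0" by (intro prod_list_nonneg) auto
  have pos: "0 < x \<and> 0 < y" if "0 < x * y" "0 \<le> x" "0 \<le> y" for x y :: real
    using that by (auto simp: zero_less_mult_iff)
  have "0 < cmod (z - a) * (\<Prod>a\<leftarrow>as. cmod (z - a))" using Cons.prems by (simp only: list.map prod_list.Cons)
  from pos[OF this norm_ge_zero nn] have "(\<Prod>a\<leftarrow>as. cmod (z - a)) > 0" "cmod (z - a) > 0" by auto
  hence "ln (cmod (z - a) * (\<Prod>a\<leftarrow>as. cmod (z - a))) = ln (cmod (z - a)) + (\<Sum>a\<leftarrow>as. ln (cmod (z - a)))"
    using Cons.IH ln_mult_pos[of "cmod (z - a)" "\<Prod>a\<leftarrow>as. cmod (z - a)"] by linarith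
  thus ?case by simp
qed simp

text \<open>The area of N separate balls would grow with N. By the Lipschitz bound all of them lie
  in n balls of radius O(1/n) about the values of the symbol at the n-th roots of unity, with n
  independent of N; their total area is O(1/n).\<close>

lemma curve_neighbourhood_area:
  assumes summ: "(\<lambda>\<nu>. (1 + \<bar>real_of_int \<nu>\<bar>) * cmod (a \<nu>)) summable_on UNIV" and \<kappa>: "\<kappa> > 0"
  obtains \<rho> where "\<rho> > 0"
    "\<And>N. measure lborel (\<Union>m<N. ball (laurent_symbol a (unity_root N m)) \<rho>) \<le> \<kappa>"
proof -
  let ?W = "weight_sum a" and ?p = "laurent_symbol a"
  have W: "?W \<ge> 0" by (rule weight_sum_nonneg[OF summ])
  \<comment> \<open>Chosen so that n discs of radius r have total area T / n.\<close>
  define T where "T = pi * (1 + 2 * pi * ?W)\<^sup>2"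
  obtain n :: nat where n: "T / \<kappa> + 1 \<le> real n" using real_arch_simple by blast
  have T0: "T \<ge> 0" unfolding T_def by simp
  have n0: "real n > 0" using n T0 \<kappa> divide_nonneg_pos[of T \<kappa>] by linarith
  define r where "r = (1 + 2 * pi * ?W) / real n"
  have r0: "r \<ge> 0" unfolding r_def using W n0 by simp
  show ?thesis
  proof (rule that[of "1 / real n"])
    show "1 / real n > 0" using n0 by simp
    fix N
    have sub: "(\<Union>m<N. ball (?p (unity_root N m)) (1 / real n)) \<subseteq> (\<Union>j<n. ball (?p (cis (2 * pi * real j / real n))) r)"
    proof
      fix z assume "z \<in> (\<Union>m<N. ball (?p (unity_root N m)) (1 / real n))"
      then obtain m where m: "m < N" "dist (?p (unity_root N m)) z < 1 / real n" by auto
      \<comment> \<open>The n-th root of unity next below the m-th of the N-th ones; the angles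
        differ by at most 2 pi / n.\<close>
      define j where "j = (m * n) div N"
      have j: "j < n" unfolding j_def using m(1) n0 by (simp add: div_less_iff_less_mult)
      have jN: "j * N \<le> m * n" "m * n < j * N + N"
        unfolding j_def using div_mult_mod_eq[of "m * n" N] mod_less_divisor[of N "m * n"] m(1) by linarith+
      have "\<bar>2 * pi * real m / real N - 2 * pi * real j / real n\<bar> \<le> 2 * pi / real n"
      proof -
        have N0: "real N > 0" using m by simp
        define d where "d = (real (m * n) - real (j * N)) / (real N * real n)"
        have eq: "2 * pi * real m / real N - 2 * pi * real j / real n = 2 * pi * d"
          unfolding d_def using N0 n0 by (simp add: field_simps)
        have "real (j * N) \<le> real (m * n)" using jN(1) by (simp only: of_nat_le_iff)
        hence d0: "0 \<le> d" unfolding d_def using N0 n0 by (intro divide_nonneg_nonneg) auto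
        have "real (m * n) \<le> real (j * N + N)" using jN(2) by (simp only: of_nat_le_iff less_imp_le)
        hence "d \<le> real N / (real N * real n)" unfolding d_def using N0 n0 by (intro divide_right_mono) auto
        hence "2 * pi * d \<le> 2 * pi * (1 / real n)" using N0 by (intro mult_left_mono) auto
        thus ?thesis unfolding eq using d0 by (simp add: abs_of_nonneg)
      qed
      hence "?W * \<bar>2 * pi * real m / real N - 2 * pi * real j / real n\<bar> \<le> ?W * (2 * pi / real n)"
        using W by (intro mult_left_mono)
      hence "dist (?p (unity_root N m)) (?p (cis (2 * pi * real j / real n))) \<le> ?W * (2 * pi / real n)"
        using laurent_symbol_lipschitz[OF summ, of "2 * pi * real m / real N" "2 * pi * real j / real n"]
        unfolding dist_norm unity_root_def by linarith
      hence "dist (?p (cis (2 * pi * real j / real n))) z < ?W * (2 * pi / real n) + 1 / real n"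
        using m(2) dist_triangle3[of "?p (cis (2 * pi * real j / real n))" z "?p (unity_root N m)"] by linarith
      also have "\<dots> = r" unfolding r_def by (simp add: add_divide_distrib)
      finally show "z \<in> (\<Union>j<n. ball (?p (cis (2 * pi * real j / real n))) r)" using j by auto
    qed
    have fm: "ball c r \<in> fmeasurable lborel" for c :: complex
      using emeasure_ball_complex[OF r0, of c] by (intro fmeasurableI) auto
    have "measure lborel (\<Union>m<N. ball (?p (unity_root N m)) (1 / real n))
       \<le> measure lborel (\<Union>j<n. ball (?p (cis (2 * pi * real j / real n))) r)"
      by (rule measure_mono_fmeasurable[OF sub]) (auto intro!: fmeasurable.finite_UN fm)
    also have "\<dots> \<le> (\<Sum>j<n. measure lborel (ball (?p (cis (2 * pi * real j / real n))) r))"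
      by (rule measure_UNION_le) (auto intro: fm)
    also have "\<dots> = real n * (pi * r\<^sup>2)" using r0 by (simp add: measure_ball_complex)
    also have "\<dots> = T / real n" unfolding r_def T_def using n0 by (simp add: power2_eq_square)
    also have "\<dots> \<le> \<kappa>"
    proof -
      have "T / \<kappa> \<le> real n" using n by simp
      thus ?thesis using \<kappa> n0 by (simp add: field_simps)
    qed
    finally show "measure lborel (\<Union>m<N. ball (?p (unity_root N m)) (1 / real n)) \<le> \<kappa>" .
  qed
qed

lemma perturbed_det_measurable:
  assumes G: "gaussian_random_mat M N Q"
  shows "(\<lambda>x. cmod (Determinant.det (perturbed_shift a N \<delta> (snd x) (Q (fst x))))) \<in> borel_measurable (M \<Otimes>\<^sub>M (lborel :: complex measure))"
proof -
  let ?L = "M \<Otimes>\<^sub>M (lborel :: complex measure)"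
  have snd: "snd \<in> borel_measurable ?L" using measurable_snd[of M "lborel :: complex measure"] by simp
  have q: "(\<lambda>x. Q (fst x) $$ (i, j)) \<in> borel_measurable ?L" if "i < N" "j < N" for i j
    by (rule measurable_compose[OF measurable_fst gaussian_mat_measurable[OF G that]])
  have det: "(\<lambda>x. Determinant.det (perturbed_shift a N \<delta> (snd x) (Q (fst x)))) \<in> borel_measurable ?L"
    unfolding mixed_mat_def
  proof (rule borel_measurable_det)
    fix i j assume ij: "i < N" "j < N"
    have "(\<lambda>x. if i = j then snd x else 0) \<in> borel_measurable ?L" using snd by (cases "i = j") simp_all
    from borel_measurable_add[OF borel_measurable_diff[OF borel_measurable_const this] borel_measurable_times[OF borel_measurable_const q[OF ij]]]
    have "(\<lambda>x. a (int i - int j) - (if i = j then snd x else 0) + complex_of_real \<delta> * Q (fst x) $$ (i, j)) \<in> borel_measurable ?L" .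
    thus "(\<lambda>x. (\<lambda>(i, j). if i \<in> {..<N} then toeplitz_shift a (snd x) i j + complex_of_real \<delta> * Q (fst x) $$ (i, j)
        else circulant_shift a N (snd x) i j) (i, j)) \<in> borel_measurable ?L"
      by (simp only: prod.case lessThan_iff ij(1) if_True toeplitz_shift_def)
  qed
  show ?thesis by (rule measurable_compose[OF det borel_measurable_norm])
qed

text \<open>Joint measurability in the outcome and in z, as Tonelli's theorem requires.\<close>

lemma exceptional_set_measurable:
  assumes G: "gaussian_random_mat M N Q"
  shows "{x \<in> space (M \<Otimes>\<^sub>M lborel). cmod (snd x) \<le> R \<and> (\<forall>m<N. \<rho> \<le> cmod (laurent_symbol a (unity_root N m) - snd x))
      \<and> entries_bounded N \<tau> (Q (fst x)) \<and> \<not> det_close a N \<delta> \<eta> (snd x) (Q (fst x))} \<in> sets (M \<Otimes>\<^sub>M (lborel :: complex measure))"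
proof -
  let ?L = "M \<Otimes>\<^sub>M (lborel :: complex measure)"
  have snd: "snd \<in> borel_measurable ?L" using measurable_snd[of M "lborel :: complex measure"] by simp
  have q: "(\<lambda>x. Q (fst x) $$ (i, j)) \<in> borel_measurable ?L" if "i < N" "j < N" for i j
    by (rule measurable_compose[OF measurable_fst gaussian_mat_measurable[OF G that]])
  have dist_m[measurable]: "(\<lambda>x. cmod (c - snd x)) \<in> borel_measurable ?L" for c
    using snd by (intro measurable_compose[OF borel_measurable_diff[OF borel_measurable_const snd] borel_measurable_norm])
  have [measurable]: "(\<lambda>x. cmod (snd x)) \<in> borel_measurable ?L"
    by (rule measurable_compose[OF snd borel_measurable_norm])
  have [measurable]: "(\<lambda>x. circulant_prod a N (snd x)) \<in> borel_measurable ?L"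
    unfolding circulant_prod_def by (intro borel_measurable_prod dist_m)
  have [measurable]: "(\<lambda>x. cmod (Determinant.det (perturbed_shift a N \<delta> (snd x) (Q (fst x))))) \<in> borel_measurable ?L"
    by (rule perturbed_det_measurable[OF G])
  have A: "{x \<in> space ?L. cmod (snd x) \<le> R} \<in> sets ?L" by measurable
  have B: "{x \<in> space ?L. \<forall>m\<in>{..<N}. \<rho> \<le> cmod (laurent_symbol a (unity_root N m) - snd x)} \<in> sets ?L"
  proof (intro sets.sets_Collect_finite_All)
    fix m
    show "{x \<in> space ?L. \<rho> \<le> cmod (laurent_symbol a (unity_root N m) - snd x)} \<in> sets ?L" by measurable
  qed auto
  have C: "{x \<in> space ?L. \<forall>jk\<in>{..<N} \<times> {..<N}. cmod (Q (fst x) $$ jk) \<le> \<tau>} \<in> sets ?L"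
  proof (intro sets.sets_Collect_finite_All)
    fix jk assume "jk \<in> {..<N} \<times> {..<N}"
    hence [measurable]: "(\<lambda>x. Q (fst x) $$ jk) \<in> borel_measurable ?L" using q[of "fst jk" "snd jk"] by auto
    show "{x \<in> space ?L. cmod (Q (fst x) $$ jk) \<le> \<tau>} \<in> sets ?L" by measurable
  qed auto
  have D: "{x \<in> space ?L. \<not> det_close a N \<delta> \<eta> (snd x) (Q (fst x))} \<in> sets ?L"
    unfolding det_close_def by measurable
  have "{x \<in> space ?L. cmod (snd x) \<le> R \<and> (\<forall>m<N. \<rho> \<le> cmod (laurent_symbol a (unity_root N m) - snd x))
      \<and> entries_bounded N \<tau> (Q (fst x)) \<and> \<not> det_close a N \<delta> \<eta> (snd x) (Q (fst x))}
    = {x \<in> space ?L. cmod (snd x) \<le> R} \<inter> {x \<in> space ?L. \<forall>m\<in>{..<N}. \<rho> \<le> cmod (laurent_symbol a (unity_root N m) - snd x)}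
      \<inter> {x \<in> space ?L. \<forall>jk\<in>{..<N} \<times> {..<N}. cmod (Q (fst x) $$ jk) \<le> \<tau>} \<inter> {x \<in> space ?L. \<not> det_close a N \<delta> \<eta> (snd x) (Q (fst x))}"
    unfolding entries_bounded_def by auto
  thus ?thesis using A B C D by (simp only: sets.Int)
qed

lemma eigenvalue_bound_of_entries:
  assumes summ: "(\<lambda>\<nu>. (1 + \<bar>real_of_int \<nu>\<bar>) * cmod (a \<nu>)) summable_on UNIV"
    and q: "q \<in> carrier_mat N N" "entries_bounded N \<tau> q" and \<delta>: "\<delta> \<ge> 0" "\<delta> * real N * \<tau> \<le> 1"
    and ev: "eigenvalue (toeplitz_mat a N + complex_of_real \<delta> \<cdot>\<^sub>m q) k"
  shows "cmod k \<le> weight_sum a + 1"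
proof (rule eigenvalue_le_row_sum[OF _ ev])
  show "toeplitz_mat a N + complex_of_real \<delta> \<cdot>\<^sub>m q \<in> carrier_mat N N" using q by (simp add: toeplitz_mat_def)
  fix i assume i: "i < N"
  have "(\<Sum>j<N. cmod ((toeplitz_mat a N + complex_of_real \<delta> \<cdot>\<^sub>m q) $$ (i, j))) \<le> (\<Sum>j<N. cmod (a (int i - int j)) + \<delta> * \<tau>)"
  proof (rule sum_mono)
    fix j assume "j \<in> {..<N}"
    hence j: "j < N" by simp
    have "cmod ((toeplitz_mat a N + complex_of_real \<delta> \<cdot>\<^sub>m q) $$ (i, j)) = cmod (a (int i - int j) + of_real \<delta> * q $$ (i, j))"
      using i j q(1) by (simp add: toeplitz_mat_def)
    also have "\<dots> \<le> cmod (a (int i - int j)) + \<delta> * cmod (q $$ (i, j))"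
      using \<delta>(1) by (metis norm_triangle_ineq norm_mult norm_of_real abs_of_nonneg)
    also have "\<delta> * cmod (q $$ (i, j)) \<le> \<delta> * \<tau>"
      using q(2) i j \<delta>(1) unfolding entries_bounded_def by (intro mult_left_mono) auto
    finally show "cmod ((toeplitz_mat a N + complex_of_real \<delta> \<cdot>\<^sub>m q) $$ (i, j)) \<le> cmod (a (int i - int j)) + \<delta> * \<tau>" by simp
  qed
  also have "\<dots> = (\<Sum>j<N. cmod (a (int i - int j))) + \<delta> * real N * \<tau>" by (simp add: sum.distrib)
  also have "\<dots> \<le> weight_sum a + 1" using toeplitz_row_sum_le[OF summ, of i N] \<delta>(2) by linarith
  finally show "(\<Sum>j<N. cmod ((toeplitz_mat a N + complex_of_real \<delta> \<cdot>\<^sub>m q) $$ (i, j))) \<le> weight_sum a + 1" .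
qed

text \<open>The entry bound 4 N^(\<delta>0/2) makes the true exponent 8 N^\<delta>0; weakening it to
  4 brings it into the form handled by \<open>ev_union_bound\<close>.\<close>

lemma exp_entries_tail:
  assumes "N > 0"
  shows "2 * exp (- (4 * real N powr (\<delta>0 / 2))\<^sup>2 / 2) \<le> 2 * exp (- 4 * real N powr \<delta>0)"
proof -
  have "(real N powr (\<delta>0 / 2))\<^sup>2 = real N powr \<delta>0"
    using assms by (simp add: power2_eq_square powr_add[symmetric])
  hence "- (4 * real N powr (\<delta>0 / 2))\<^sup>2 / 2 = - 8 * real N powr \<delta>0" by (simp add: power_mult_distrib)
  also have "\<dots> \<le> - 4 * real N powr \<delta>0" by simp
  finally show ?thesis by simp
qed

text \<open>The event F says that some entry is too large or that the exceptional z have area above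
  \<kappa>/2. The other \<kappa>/2 is spent on the neighbourhood of the curve, where the circulant
  matrix gives no lower bound. The conclusion holds for every list of roots, so no measurable choice
  of eigenvalues is involved.\<close>

lemma spectrum_test_function_close:
  fixes \<phi> :: "complex \<Rightarrow> real" and L B R0 \<delta>0 \<delta>1 \<epsilon> :: real
  assumes summ: "(\<lambda>\<nu>. (1 + \<bar>real_of_int \<nu>\<bar>) * cmod (a \<nu>)) summable_on UNIV"
    and d: "0 < \<delta>0" "\<delta>0 < 1" "\<delta>1 > 3 / 2"
    and lip: "L-lipschitz_on UNIV \<phi>" and B: "\<And>z. \<bar>\<phi> z\<bar> \<le> B" and supp: "\<forall>z. cmod z > R0 \<longrightarrow> \<phi> z = 0"
    and eps: "\<epsilon> > 0"
  shows "eventually (\<lambda>N. \<forall>(M :: 'w measure) Q \<delta>. gaussian_random_mat M N Q \<longrightarrow>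
     exp (- (real N powr \<delta>0)) \<le> \<delta> \<longrightarrow> \<delta> \<le> real N powr (- \<delta>1) \<longrightarrow>
     (\<exists>F\<in>sets M. measure M F \<le> exp (- (real N powr \<delta>0)) / 2 \<and>
       (\<forall>\<omega>\<in>space M - F. \<forall>as. char_poly (toeplitz_mat a N + complex_of_real \<delta> \<cdot>\<^sub>m Q \<omega>) = (\<Prod>a\<leftarrow>as. [:- a, 1:]) \<longrightarrow> length as = N \<longrightarrow>
          \<bar>(\<Sum>a\<leftarrow>as. \<phi> a) - (\<Sum>m<N. \<phi> (laurent_symbol a (unity_root N m)))\<bar> \<le> \<epsilon> * real N))) sequentially"
proof -
  let ?W = "weight_sum a" and ?p = "laurent_symbol a"
  have W: "?W \<ge> 0" by (rule weight_sum_nonneg[OF summ])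
  define R where "R = max (R0 + 1) (?W + 1)"
  have R: "R0 + 1 \<le> R" "?W + 1 \<le> R" "0 \<le> R" using W by (auto simp: R_def)
  obtain \<eta> \<kappa> where \<eta>: "\<eta> > 0" and \<kappa>: "\<kappa> > 0" and cmp:
    "\<And>as bs S N. length as = N \<Longrightarrow> length bs = N \<Longrightarrow> set as \<subseteq> cball 0 R \<Longrightarrow> set bs \<subseteq> cball 0 R \<Longrightarrow>
       S \<in> sets borel \<Longrightarrow> S \<subseteq> cball 0 R \<Longrightarrow> measure lborel S \<le> \<kappa> \<Longrightarrow>
       (\<And>z. z \<in> cball 0 R \<Longrightarrow> z \<notin> S \<Longrightarrow>
          \<bar>(\<Sum>a\<leftarrow>as. ln (cmod (z - a))) - (\<Sum>b\<leftarrow>bs. ln (cmod (z - b)))\<bar> \<le> \<eta> * real N) \<Longrightarrow>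
       \<bar>(\<Sum>a\<leftarrow>as. \<phi> a) - (\<Sum>b\<leftarrow>bs. \<phi> b)\<bar> \<le> \<epsilon> * real N"
    using test_function_sum_compare[OF lip B supp[rule_format] eps R(1,3)] by blast
  obtain \<rho> where \<rho>: "\<rho> > 0" and thin: "\<And>N. measure lborel (\<Union>m<N. ball (?p (unity_root N m)) \<rho>) \<le> \<kappa> / 2"
    using curve_neighbourhood_area[OF summ, of "\<kappa> / 2"] \<kappa> by auto
  \<comment> \<open>With this constant Markov's inequality at level \<kappa>/2 gives probability at
    most a quarter of exp (- N^\<delta>0).\<close>
  define c0 where "c0 = (\<kappa> / 2) / (4 * (pi * R\<^sup>2 + 1))"
  have piR: "pi * R\<^sup>2 + 1 > 0" by (simp add: add_nonneg_pos)
  have c0: "c0 > 0" unfolding c0_def using \<kappa> piR by simp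
  have c0': "c0 * (pi * R\<^sup>2) / (\<kappa> / 2) \<le> 1 / 4"
  proof -
    have "c0 * (pi * R\<^sup>2) / (\<kappa> / 2) = (pi * R\<^sup>2) / (pi * R\<^sup>2 + 1) / 4"
    proof -
      have gen: "(k / 2) / (4 * x) * y / (k / 2) = y / x / 4" if "k \<noteq> 0" "x \<noteq> 0" for k x y :: real
        using that by (simp add: field_simps)
      show ?thesis unfolding c0_def by (rule gen) (use \<kappa> piR in auto)
    qed
    also have "(pi * R\<^sup>2) / (pi * R\<^sup>2 + 1) \<le> 1" using piR by (simp add: divide_le_eq)
    finally show ?thesis by simp
  qed
  have e1: "eventually (\<lambda>N. \<forall>(M :: 'w measure) Q \<delta> z. gaussian_random_mat M N Q \<longrightarrow>
     exp (- (real N powr \<delta>0)) \<le> \<delta> \<longrightarrow> \<delta> \<le> real N powr (- \<delta>1) \<longrightarrow> cmod z \<le> R \<longrightarrow>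
     (\<forall>m<N. \<rho> \<le> cmod (?p (unity_root N m) - z)) \<longrightarrow>
     measure M {\<omega> \<in> space M. entries_bounded N (4 * real N powr (\<delta>0 / 2)) (Q \<omega>) \<and> \<not> det_close a N \<delta> \<eta> z (Q \<omega>)}
       \<le> c0 * exp (- (real N powr \<delta>0))) sequentially"
    by (rule prob_det_close[OF summ d \<rho> R(3) \<eta> c0])
  \<comment> \<open>The Gaussian tail carries a factor 2, so 1/8 becomes the second quarter. Half of
    the admissible probability is used in total, since an inner and an outer cutoff will each need
    such an event.\<close>
  have e2: "eventually (\<lambda>N. (real N)\<^sup>2 * exp (- 4 * real N powr \<delta>0) \<le> 1 / 8 * exp (- (real N powr \<delta>0))) sequentially"
    by (rule ev_union_bound) (use d in auto)
  have e3: "eventually (\<lambda>N. real N powr (- \<delta>1) * real N * (4 * real N powr (\<delta>0 / 2)) \<le> 1) sequentially"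
    by (rule ev_noise_small[OF d]) simp
  show ?thesis using e1 e2 e3 eventually_gt_at_top[of 0]
  proof eventually_elim
    case (elim N)
    show ?case
    proof (intro allI impI)
      fix M :: "'w measure" and Q \<delta>
      assume G: "gaussian_random_mat M N Q" and \<delta>: "exp (- (real N powr \<delta>0)) \<le> \<delta>" "\<delta> \<le> real N powr (- \<delta>1)"
      interpret prob_space M by (rule gaussian_matD(1)[OF G])
      let ?\<tau> = "4 * real N powr (\<delta>0 / 2)"
      let ?ex = "exp (- (real N powr \<delta>0))"
      have dpos: "\<delta> \<ge> 0" using \<delta>(1) exp_gt_zero[of "- (real N powr \<delta>0)"] by linarith
      have noise: "\<delta> * real N * ?\<tau> \<le> 1"
      proof -
        have "\<delta> * real N * ?\<tau> \<le> real N powr (- \<delta>1) * real N * ?\<tau>" using \<delta>(2) by (intro mult_right_mono) auto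
        thus ?thesis using elim(3) by linarith
      qed
      define E where "E = {x \<in> space (M \<Otimes>\<^sub>M (lborel :: complex measure)). cmod (snd x) \<le> R \<and> (\<forall>m<N. \<rho> \<le> cmod (?p (unity_root N m) - snd x))
        \<and> entries_bounded N ?\<tau> (Q (fst x)) \<and> \<not> det_close a N \<delta> \<eta> (snd x) (Q (fst x))}"
      have Em: "E \<in> sets (M \<Otimes>\<^sub>M lborel)" unfolding E_def by (rule exceptional_set_measurable[OF G])
      have Ein: "(\<omega>, z) \<in> E \<longleftrightarrow> \<omega> \<in> space M \<and> cmod z \<le> R \<and> (\<forall>m<N. \<rho> \<le> cmod (?p (unity_root N m) - z))
        \<and> entries_bounded N ?\<tau> (Q \<omega>) \<and> \<not> det_close a N \<delta> \<eta> z (Q \<omega>)" for \<omega> z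
        unfolding E_def by (auto simp: space_pair_measure)
      have q: "prob {\<omega> \<in> space M. (\<omega>, z) \<in> E} \<le> c0 * ?ex" for z
      proof (cases "cmod z \<le> R \<and> (\<forall>m<N. \<rho> \<le> cmod (?p (unity_root N m) - z))")
        case True
        hence "{\<omega> \<in> space M. (\<omega>, z) \<in> E} = {\<omega> \<in> space M. entries_bounded N ?\<tau> (Q \<omega>) \<and> \<not> det_close a N \<delta> \<eta> z (Q \<omega>)}"
          unfolding Ein by auto
        thus ?thesis using elim(1) G \<delta> True by auto
      next
        case False
        hence "{\<omega> \<in> space M. (\<omega>, z) \<in> E} = {}" unfolding Ein by auto
        thus ?thesis using c0 by (simp only: measure_empty) simp
      qed
      let ?F1 = "{\<omega> \<in> space M. \<exists>j<N. \<exists>k<N. cmod (Q \<omega> $$ (j, k)) > ?\<tau>}"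
      let ?F2 = "{\<omega> \<in> space M. measure lborel {z. (\<omega>, z) \<in> E} > \<kappa> / 2}"
      have k2: "\<kappa> / 2 > 0" using \<kappa> by simp
      have q0: "c0 * ?ex \<ge> 0" using c0 by simp
      have subE: "\<And>\<omega> z. (\<omega>, z) \<in> E \<Longrightarrow> cmod z \<le> R" unfolding Ein by simp
      note area = prob_section_area[OF gaussian_matD(1)[OF G] Em q q0 R(3) subE k2]
      have F1m: "?F1 \<in> events"
      proof -
        have "?F1 = (\<Union>jk\<in>{..<N} \<times> {..<N}. {\<omega> \<in> space M. cmod (Q \<omega> $$ jk) > ?\<tau>})" by auto
        also have "\<dots> \<in> events"
        proof (intro sets.finite_UN)
          fix jk assume "jk \<in> {..<N} \<times> {..<N}"
          hence [measurable]: "(\<lambda>\<omega>. Q \<omega> $$ jk) \<in> borel_measurable M" using gaussian_mat_measurable[OF G, of "fst jk" "snd jk"] by auto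
          show "{\<omega> \<in> space M. cmod (Q \<omega> $$ jk) > ?\<tau>} \<in> events" by measurable
        qed auto
        finally show ?thesis .
      qed
      have "prob (?F1 \<union> ?F2) \<le> prob ?F1 + prob ?F2" by (rule measure_Un_le[OF F1m area(1)])
      also have "prob ?F1 \<le> 1 / 4 * ?ex"
      proof -
        have "prob ?F1 \<le> (real N)\<^sup>2 * (2 * exp (- ?\<tau>\<^sup>2 / 2))" by (rule prob_gaussian_mat_entries[OF G]) simp
        also have "\<dots> \<le> (real N)\<^sup>2 * (2 * exp (- 4 * real N powr \<delta>0))"
          by (intro mult_left_mono exp_entries_tail) (use elim in auto)
        also have "\<dots> = 2 * ((real N)\<^sup>2 * exp (- 4 * real N powr \<delta>0))" by simp
        also have "\<dots> \<le> 2 * (1 / 8 * ?ex)" by (rule mult_left_mono[OF elim(2)]) simp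
        finally show ?thesis by simp
      qed
      also have "prob ?F2 \<le> 1 / 4 * ?ex"
      proof -
        have "prob ?F2 \<le> c0 * ?ex * (pi * R\<^sup>2) / (\<kappa> / 2)" by (rule area(2))
        also have "\<dots> = c0 * (pi * R\<^sup>2) / (\<kappa> / 2) * ?ex" by simp
        also have "\<dots> \<le> 1 / 4 * ?ex" by (rule mult_right_mono[OF c0']) simp
        finally show ?thesis .
      qed
      finally have PF: "prob (?F1 \<union> ?F2) \<le> ?ex / 2" by simp
      show "\<exists>F\<in>events. prob F \<le> ?ex / 2 \<and>
       (\<forall>\<omega>\<in>space M - F. \<forall>as. char_poly (toeplitz_mat a N + complex_of_real \<delta> \<cdot>\<^sub>m Q \<omega>) = (\<Prod>a\<leftarrow>as. [:- a, 1:]) \<longrightarrow> length as = N \<longrightarrow>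
          \<bar>(\<Sum>a\<leftarrow>as. \<phi> a) - (\<Sum>m<N. \<phi> (?p (unity_root N m)))\<bar> \<le> \<epsilon> * real N)"
      proof (intro bexI[of _ "?F1 \<union> ?F2"] conjI PF ballI allI impI)
        show "?F1 \<union> ?F2 \<in> events" using F1m area(1) by (rule sets.Un)
        fix \<omega> as assume \<omega>: "\<omega> \<in> space M - (?F1 \<union> ?F2)"
          and as: "char_poly (toeplitz_mat a N + complex_of_real \<delta> \<cdot>\<^sub>m Q \<omega>) = (\<Prod>a\<leftarrow>as. [:- a, 1:])" "length as = N"
        let ?A = "toeplitz_mat a N + complex_of_real \<delta> \<cdot>\<^sub>m Q \<omega>"
        have \<omega>s: "\<omega> \<in> space M" using \<omega> by blast
        have eb: "entries_bounded N ?\<tau> (Q \<omega>)"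
        proof -
          have "\<not> (\<exists>j<N. \<exists>k<N. cmod (Q \<omega> $$ (j, k)) > ?\<tau>)" using \<omega> by blast
          thus ?thesis unfolding entries_bounded_def by (meson not_less)
        qed
        have ar: "measure lborel {z. (\<omega>, z) \<in> E} \<le> \<kappa> / 2" using \<omega> by auto
        have Qc: "Q \<omega> \<in> carrier_mat N N" by (rule gaussian_matD(2)[OF G \<omega>s])
        have Ac: "?A \<in> carrier_mat N N" using Qc by (simp add: toeplitz_mat_def)
        define bs where "bs = map (\<lambda>m. ?p (unity_root N m)) [0..<N]"
        \<comment> \<open>Outside S, within the disc, z is at distance at least \<rho> from the
          circulant eigenvalues and \<open>det_close\<close> holds. Both products are then positive
          and their logarithms may be compared.\<close>
        define S where "S = ((\<Union>m<N. ball (?p (unity_root N m)) \<rho>) \<inter> cball 0 R) \<union> {z. (\<omega>, z) \<in> E}"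
        have sec: "{z. (\<omega>, z) \<in> E} \<in> sets borel"
        proof -
          have "{z. (\<omega>, z) \<in> E} = Pair \<omega> -` E" by auto
          also have "\<dots> \<in> sets borel" using sets_Pair1[OF Em, of \<omega>] by simp
          finally show ?thesis .
        qed
        have bsprod: "(\<Prod>b\<leftarrow>bs. cmod (z - b)) = circulant_prod a N z" for z
        proof -
          have "(\<Prod>b\<leftarrow>bs. cmod (z - b)) = (\<Prod>m\<leftarrow>[0..<N]. cmod (?p (unity_root N m) - z))"
            unfolding bs_def by (simp add: comp_def norm_minus_commute)
          also have "\<dots> = circulant_prod a N z"
            unfolding circulant_prod_def by (subst prod.distinct_set_conv_list[symmetric]) (auto simp: atLeast0LessThan)
          finally show ?thesis .
        qed
        have "\<bar>(\<Sum>a\<leftarrow>as. \<phi> a) - (\<Sum>b\<leftarrow>bs. \<phi> b)\<bar> \<le> \<epsilon> * real N"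
        proof (rule cmp[of as N bs S])
          show "length as = N" by (rule as(2))
          show "length bs = N" by (simp add: bs_def)
          show "set as \<subseteq> cball 0 R"
          proof
            fix x assume "x \<in> set as"
            hence "poly (char_poly ?A) x = 0" unfolding as(1) by (induction as) auto
            hence "eigenvalue ?A x" using eigenvalue_root_char_poly[OF Ac] by simp
            hence "cmod x \<le> ?W + 1" by (rule eigenvalue_bound_of_entries[OF summ Qc eb dpos noise])
            thus "x \<in> cball 0 R" using R by simp
          qed
          show "set bs \<subseteq> cball 0 R"
          proof
            fix x assume "x \<in> set bs"
            then obtain m where "x = ?p (unity_root N m)" unfolding bs_def by auto
            hence "cmod x \<le> ?W" using norm_laurent_symbol_le[OF summ, of "unity_root N m"] by simp
            thus "x \<in> cball 0 R" using R by simp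
          qed
          show "S \<in> sets borel" unfolding S_def using sec by (auto intro!: sets.Un sets.Int sets.finite_UN)
          show SR: "S \<subseteq> cball 0 R" unfolding S_def using subE by auto
          have thinm: "(\<Union>m<N. ball (?p (unity_root N m)) \<rho>) \<in> sets lborel" by (auto intro!: sets.finite_UN)
          have fm: "ball c \<rho> \<in> fmeasurable lborel" for c :: complex
            using emeasure_ball_complex[of \<rho> c] \<rho> by (intro fmeasurableI) auto
          have "measure lborel S \<le> measure lborel ((\<Union>m<N. ball (?p (unity_root N m)) \<rho>) \<inter> cball 0 R) + measure lborel {z. (\<omega>, z) \<in> E}"
            unfolding S_def by (rule measure_Un_le) (use sec thinm in auto)
          also have "measure lborel ((\<Union>m<N. ball (?p (unity_root N m)) \<rho>) \<inter> cball 0 R) \<le> measure lborel (\<Union>m<N. ball (?p (unity_root N m)) \<rho>)"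
            by (rule measure_mono_fmeasurable) (use thinm in \<open>auto intro!: fmeasurable.finite_UN fm\<close>)
          also have "\<dots> \<le> \<kappa> / 2" by (rule thin)
          finally show "measure lborel S \<le> \<kappa>" using ar by linarith
          fix z assume z: "z \<in> cball 0 R" "z \<notin> S"
          have far: "\<forall>m<N. \<rho> \<le> cmod (?p (unity_root N m) - z)"
            using z unfolding S_def by (auto simp: dist_norm not_less)
          have close: "det_close a N \<delta> \<eta> z (Q \<omega>)"
            using z far eb \<omega>s unfolding S_def by (auto simp: Ein)
          have P: "circulant_prod a N z > 0"
            unfolding circulant_prod_def using far \<rho> by (intro prod_pos) force
          have det: "cmod (Determinant.det (perturbed_shift a N \<delta> z (Q \<omega>))) = (\<Prod>a\<leftarrow>as. cmod (z - a))"
            unfolding perturbed_shift_eq[OF Qc] cmod_poly_char_poly[OF Ac, symmetric] as(1) by (rule cmod_poly_prod_list)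
          have c1: "exp (- \<eta> * real N) * circulant_prod a N z \<le> (\<Prod>a\<leftarrow>as. cmod (z - a))"
            and c2: "(\<Prod>a\<leftarrow>as. cmod (z - a)) \<le> exp (\<eta> * real N) * circulant_prod a N z"
            using close unfolding det_close_def det by auto
          have P1: "(\<Prod>a\<leftarrow>as. cmod (z - a)) > 0"
            using c1 P mult_pos_pos[OF exp_gt_zero[of "- \<eta> * real N"] P] by linarith
          have l1: "- \<eta> * real N + ln (circulant_prod a N z) \<le> ln (\<Prod>a\<leftarrow>as. cmod (z - a))"
          proof -
            have "ln (exp (- \<eta> * real N) * circulant_prod a N z) \<le> ln (\<Prod>a\<leftarrow>as. cmod (z - a))"
              using c1 P P1 by (subst ln_le_cancel_iff) auto
            thus ?thesis using P by (simp only: ln_mult_pos[OF exp_gt_zero P] ln_exp)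
          qed
          have l2: "ln (\<Prod>a\<leftarrow>as. cmod (z - a)) \<le> \<eta> * real N + ln (circulant_prod a N z)"
          proof -
            have "ln (\<Prod>a\<leftarrow>as. cmod (z - a)) \<le> ln (exp (\<eta> * real N) * circulant_prod a N z)"
              using c2 P P1 by (subst ln_le_cancel_iff) auto
            thus ?thesis using P by (simp only: ln_mult_pos[OF exp_gt_zero P] ln_exp)
          qed
          have "(\<Sum>a\<leftarrow>as. ln (cmod (z - a))) = ln (\<Prod>a\<leftarrow>as. cmod (z - a))"
            by (rule ln_prod_list_cmod[OF P1, symmetric])
          moreover have "(\<Sum>b\<leftarrow>bs. ln (cmod (z - b))) = ln (circulant_prod a N z)"
            using ln_prod_list_cmod[of z bs] P unfolding bsprod by simp
          ultimately show "\<bar>(\<Sum>a\<leftarrow>as. ln (cmod (z - a))) - (\<Sum>b\<leftarrow>bs. ln (cmod (z - b)))\<bar> \<le> \<eta> * real N"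
            using l1 l2 by (intro abs_leI) linarith+
        qed
        moreover have "(\<Sum>b\<leftarrow>bs. \<phi> b) = (\<Sum>m<N. \<phi> (?p (unity_root N m)))"
          unfolding bs_def by (simp add: comp_def interv_sum_list_conv_sum_set_nat atLeast0LessThan)
        ultimately show "\<bar>(\<Sum>a\<leftarrow>as. \<phi> a) - (\<Sum>m<N. \<phi> (?p (unity_root N m)))\<bar> \<le> \<epsilon> * real N" by simp
      qed
    qed
  qed
qed

section \<open>Riemann sums and cutoff functions\<close>

text \<open>Take for \<open>e N\<close> the largest k \<le> N whose threshold N has passed; the
  bound by N keeps the set finite. This turns statements with a fixed error into one with an error
  that tends to 0.\<close>

lemma eventually_diagonal:
  assumes "\<And>k. eventually (P k) sequentially"
  obtains e :: "nat \<Rightarrow> nat" where "filterlim e at_top sequentially" "eventually (\<lambda>N. P (e N) N) sequentially"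
proof -
  have "\<forall>k. \<exists>T. \<forall>N\<ge>T. P k N" using assms by (auto simp: eventually_sequentially)
  then obtain T where T: "\<And>k N. N \<ge> T k \<Longrightarrow> P k N" by metis
  define e where "e = (\<lambda>N. Max {k. k \<le> N \<and> T k \<le> N})"
  have fin: "finite {k. k \<le> N \<and> T k \<le> N}" for N by simp
  show ?thesis
  proof (rule that[of e])
    show "filterlim e at_top sequentially"
      unfolding filterlim_at_top
    proof
      fix k
      show "eventually (\<lambda>N. k \<le> e N) sequentially"
        using eventually_ge_at_top[of "max k (T k)"]
        by eventually_elim (auto simp: e_def intro!: Max_ge fin)
    qed
    show "eventually (\<lambda>N. P (e N) N) sequentially"
      using eventually_ge_at_top[of "T 0"]
    proof eventually_elim
      case (elim N)
      hence "{k. k \<le> N \<and> T k \<le> N} \<noteq> {}" by auto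
      from Max_in[OF fin this] have "T (e N) \<le> N" unfolding e_def by simp
      thus ?case by (rule T)
    qed
  qed
qed

lemma sum_indicator_cells:
  fixes h :: real
  assumes "h > 0"
  shows "(\<Sum>m<n. indicator {real m * h..<real (Suc m) * h} t :: real) = indicator {0..<real n * h} t"
proof (induction n)
  case (Suc n)
  have "real n * h \<le> real (Suc n) * h" "0 \<le> real n * h" using assms by (auto simp: algebra_simps)
  thus ?case using Suc by (auto simp: indicator_def)
qed simp

text \<open>On a cell of length h = T / N the error is at most \<Lambda> h^2, and there are N
  cells.\<close>

lemma riemann_sum_lipschitz:
  fixes g :: "real \<Rightarrow> real"
  assumes lip: "\<And>s t. \<bar>g s - g t\<bar> \<le> \<Lambda> * \<bar>s - t\<bar>" and N: "N > 0" and T: "T > 0" and \<Lambda>: "\<Lambda> \<ge> 0"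
  shows "\<bar>(T / real N) * (\<Sum>m<N. g (T * real m / real N)) - (LINT t|lborel. indicator {0..<T} t * g t)\<bar> \<le> \<Lambda> * T\<^sup>2 / real N"
proof -
  define h where "h = T / real N"
  have h: "h > 0" using N T by (simp add: h_def)
  have Nh: "real N * h = T" using N by (simp add: h_def)
  let ?I = "\<lambda>m t. indicator {real m * h..<real (Suc m) * h} t :: real"
  have cont: "continuous_on UNIV g"
  proof (rule lipschitz_on_continuous_on)
    show "\<Lambda>-lipschitz_on UNIV g" by (rule lipschitz_onI) (use lip \<Lambda> in \<open>auto simp: dist_real_def\<close>)
  qed
  have [measurable]: "g \<in> borel_measurable borel" using cont by (rule borel_measurable_continuous_onI)
  have int1: "integrable lborel (?I m)" for m
  proof (rule integrable_real_indicator)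
    have "real m * h \<le> real (Suc m) * h" using h by (intro mult_right_mono) auto
    from emeasure_lborel_Ico[OF this] show "emeasure lborel {real m * h..<real (Suc m) * h} < \<infinity>"
      by (simp only: ennreal_less_top infinity_ennreal_def)
  qed simp
  have ii: "integrable lborel (\<lambda>t. ?I m t * (g (real m * h) - g t))" for m
  proof (rule Bochner_Integration.integrable_bound[where f = "\<lambda>t. \<Lambda> * h * ?I m t"])
    show "integrable lborel (\<lambda>t. \<Lambda> * h * ?I m t)" by (intro integrable_mult_right int1)
    show "AE t in lborel. norm (?I m t * (g (real m * h) - g t)) \<le> norm (\<Lambda> * h * ?I m t)"
    proof (rule AE_I2)
      fix t
      have "\<bar>g (real m * h) - g t\<bar> \<le> \<Lambda> * h" if "t \<in> {real m * h..<real (Suc m) * h}"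
      proof -
        have "\<bar>real m * h - t\<bar> \<le> h" using that by (auto simp: algebra_simps)
        thus ?thesis using lip[of "real m * h" t] \<Lambda> by (meson mult_left_mono order.trans)
      qed
      thus "norm (?I m t * (g (real m * h) - g t)) \<le> norm (\<Lambda> * h * ?I m t)" by (auto simp: indicator_def)
    qed
  qed simp
  have ig: "integrable lborel (\<lambda>t. ?I m t * g t)" for m
  proof -
    have "integrable lborel (\<lambda>t. ?I m t * g (real m * h))"
      by (intro integrable_mult_left int1)
    from Bochner_Integration.integrable_diff[OF this ii[of m]] show ?thesis by (simp add: right_diff_distrib)
  qed
  have cell: "\<bar>h * g (real m * h) - (LINT t|lborel. ?I m t * g t)\<bar> \<le> \<Lambda> * h * h" for m
  proof -
    have meas: "measure lborel {real m * h..<real (Suc m) * h} = h" using h by (simp add: algebra_simps)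
    have "h * g (real m * h) - (LINT t|lborel. ?I m t * g t) = (LINT t|lborel. ?I m t * g (real m * h)) - (LINT t|lborel. ?I m t * g t)"
      using h by (simp add: meas del: of_nat_Suc)
    also have "\<dots> = (LINT t|lborel. ?I m t * g (real m * h) - ?I m t * g t)"
      by (intro Bochner_Integration.integral_diff[symmetric] ig integrable_mult_left int1)
    also have "\<dots> = (LINT t|lborel. ?I m t * (g (real m * h) - g t))" by (simp only: right_diff_distrib)
    also have "\<bar>\<dots>\<bar> \<le> (LINT t|lborel. \<bar>?I m t * (g (real m * h) - g t)\<bar>)" by (rule integral_abs_bound)
    also have "\<dots> \<le> (LINT t|lborel. \<Lambda> * h * ?I m t)"
    proof (rule integral_mono)
      show "integrable lborel (\<lambda>t. \<bar>?I m t * (g (real m * h) - g t)\<bar>)" by (intro integrable_abs ii)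
      show "integrable lborel (\<lambda>t. \<Lambda> * h * ?I m t)" by (intro integrable_mult_right int1)
      fix t
      have "\<bar>g (real m * h) - g t\<bar> \<le> \<Lambda> * h" if "t \<in> {real m * h..<real (Suc m) * h}"
      proof -
        have "\<bar>real m * h - t\<bar> \<le> h" using that by (auto simp: algebra_simps)
        thus ?thesis using lip[of "real m * h" t] \<Lambda> by (meson mult_left_mono order.trans)
      qed
      thus "\<bar>?I m t * (g (real m * h) - g t)\<bar> \<le> \<Lambda> * h * ?I m t" by (auto simp: indicator_def)
    qed
    also have "\<dots> = \<Lambda> * h * h" by (simp add: meas del: of_nat_Suc)
    finally show ?thesis .
  qed
  have "(LINT t|lborel. indicator {0..<T} t * g t) = (LINT t|lborel. (\<Sum>m<N. ?I m t * g t))"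
    unfolding sum_distrib_right[symmetric] sum_indicator_cells[OF h] Nh ..
  also have "\<dots> = (\<Sum>m<N. LINT t|lborel. ?I m t * g t)" by (rule Bochner_Integration.integral_sum) (rule ig)
  finally have int_eq: "(LINT t|lborel. indicator {0..<T} t * g t) = (\<Sum>m<N. LINT t|lborel. ?I m t * g t)" .
  have "(T / real N) * (\<Sum>m<N. g (T * real m / real N)) = (\<Sum>m<N. h * g (real m * h))"
    by (simp add: sum_distrib_left h_def mult.commute)
  hence eq: "(T / real N) * (\<Sum>m<N. g (T * real m / real N)) - (LINT t|lborel. indicator {0..<T} t * g t)
     = (\<Sum>m<N. h * g (real m * h) - (LINT t|lborel. ?I m t * g t))"
    unfolding int_eq by (simp only: sum_subtractf)
  have "\<bar>\<Sum>m<N. h * g (real m * h) - (LINT t|lborel. ?I m t * g t)\<bar>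
      \<le> (\<Sum>m<N. \<bar>h * g (real m * h) - (LINT t|lborel. ?I m t * g t)\<bar>)" by (rule sum_abs)
  also have "\<dots> \<le> (\<Sum>m<N. \<Lambda> * h * h)" by (rule sum_mono) (rule cell)
  also have "\<dots> = \<Lambda> * T\<^sup>2 / real N" using N by (simp add: h_def power2_eq_square)
  finally show ?thesis unfolding eq .
qed

text \<open>\<open>infdist\<close> to the empty set is 0, which would make the inner cutoff of the
  whole plane 0 and the outer cutoff of the empty set 1. The convergence lemmas therefore ask for a
  nonempty complement and a nonempty set respectively.\<close>

definition inner_cutoff :: "complex set \<Rightarrow> nat \<Rightarrow> complex \<Rightarrow> real" where
  "inner_cutoff \<Omega> n z = min 1 (real (Suc n) * infdist z (- \<Omega>))"

definition outer_cutoff :: "complex set \<Rightarrow> nat \<Rightarrow> complex \<Rightarrow> real" where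
  "outer_cutoff \<Omega> n z = max 0 (1 - real (Suc n) * infdist z (closure \<Omega>))"

lemma inner_cutoff_lipschitz: "(real (Suc n))-lipschitz_on UNIV (inner_cutoff \<Omega> n)"
proof (rule lipschitz_onI)
  fix x y :: complex
  have "\<bar>min 1 a - min 1 b\<bar> \<le> \<bar>a - b\<bar>" for a b :: real by (auto simp: min_def)
  hence "dist (inner_cutoff \<Omega> n x) (inner_cutoff \<Omega> n y) \<le> \<bar>real (Suc n) * infdist x (- \<Omega>) - real (Suc n) * infdist y (- \<Omega>)\<bar>"
    unfolding inner_cutoff_def dist_real_def .
  also have "\<dots> = real (Suc n) * \<bar>infdist x (- \<Omega>) - infdist y (- \<Omega>)\<bar>"
    by (simp only: right_diff_distrib[symmetric] abs_mult abs_of_nat)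
  also have "\<dots> \<le> real (Suc n) * dist x y" by (intro mult_left_mono infdist_triangle_abs) auto
  finally show "dist (inner_cutoff \<Omega> n x) (inner_cutoff \<Omega> n y) \<le> real (Suc n) * dist x y" .
qed auto

lemma outer_cutoff_lipschitz: "(real (Suc n))-lipschitz_on UNIV (outer_cutoff \<Omega> n)"
proof (rule lipschitz_onI)
  fix x y :: complex
  have "\<bar>max 0 (1 - a) - max 0 (1 - b)\<bar> \<le> \<bar>a - b\<bar>" for a b :: real by (auto simp: max_def)
  hence "dist (outer_cutoff \<Omega> n x) (outer_cutoff \<Omega> n y) \<le> \<bar>real (Suc n) * infdist x (closure \<Omega>) - real (Suc n) * infdist y (closure \<Omega>)\<bar>"
    unfolding outer_cutoff_def dist_real_def .
  also have "\<dots> = real (Suc n) * \<bar>infdist x (closure \<Omega>) - infdist y (closure \<Omega>)\<bar>"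
    by (simp only: right_diff_distrib[symmetric] abs_mult abs_of_nat)
  also have "\<dots> \<le> real (Suc n) * dist x y" by (intro mult_left_mono infdist_triangle_abs) auto
  finally show "dist (outer_cutoff \<Omega> n x) (outer_cutoff \<Omega> n y) \<le> real (Suc n) * dist x y" .
qed auto

lemma inner_cutoff_bounds: "0 \<le> inner_cutoff \<Omega> n z" "inner_cutoff \<Omega> n z \<le> indicator \<Omega> z" "\<bar>inner_cutoff \<Omega> n z\<bar> \<le> 1"
proof -
  show 1: "0 \<le> inner_cutoff \<Omega> n z" by (simp add: inner_cutoff_def infdist_nonneg)
  show "inner_cutoff \<Omega> n z \<le> indicator \<Omega> z" by (auto simp: inner_cutoff_def indicator_def)
  thus "\<bar>inner_cutoff \<Omega> n z\<bar> \<le> 1" using 1 by (simp add: inner_cutoff_def)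
qed

lemma outer_cutoff_bounds: "0 \<le> outer_cutoff \<Omega> n z" "indicator \<Omega> z \<le> outer_cutoff \<Omega> n z" "\<bar>outer_cutoff \<Omega> n z\<bar> \<le> 1"
proof -
  show 1: "0 \<le> outer_cutoff \<Omega> n z" by (simp add: outer_cutoff_def)
  show "indicator \<Omega> z \<le> outer_cutoff \<Omega> n z"
    using closure_subset[of \<Omega>] by (auto simp: outer_cutoff_def indicator_def)
  have "outer_cutoff \<Omega> n z \<le> 1" by (simp add: outer_cutoff_def infdist_nonneg)
  thus "\<bar>outer_cutoff \<Omega> n z\<bar> \<le> 1" using 1 by simp
qed

lemma inner_cutoff_tendsto:
  assumes "open \<Omega>" "- \<Omega> \<noteq> {}"
  shows "(\<lambda>n. inner_cutoff \<Omega> n z) \<longlonglongrightarrow> indicator \<Omega> z"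
proof (cases "z \<in> \<Omega>")
  case True
  have "infdist z (- \<Omega>) > 0" using assms True by (intro infdist_pos_not_in_closed) auto
  then obtain n0 :: nat where n0: "1 / infdist z (- \<Omega>) \<le> real n0" using real_arch_simple by blast
  have "eventually (\<lambda>n. inner_cutoff \<Omega> n z = 1) sequentially"
    using eventually_ge_at_top[of n0]
  proof eventually_elim
    case (elim n)
    have "1 / infdist z (- \<Omega>) \<le> real (Suc n)" using n0 elim by linarith
    hence "1 \<le> real (Suc n) * infdist z (- \<Omega>)" using \<open>infdist z (- \<Omega>) > 0\<close> by (simp only: divide_le_eq if_True)
    thus ?case by (simp add: inner_cutoff_def del: of_nat_Suc)
  qed
  thus ?thesis using True by (simp add: tendsto_eventually)
next
  case False
  hence "inner_cutoff \<Omega> n z = 0" for n by (simp add: inner_cutoff_def)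
  thus ?thesis using False by simp
qed

lemma outer_cutoff_tendsto:
  assumes "\<Omega> \<noteq> {}"
  shows "(\<lambda>n. outer_cutoff \<Omega> n z) \<longlonglongrightarrow> indicator (closure \<Omega>) z"
proof (cases "z \<in> closure \<Omega>")
  case True
  hence "outer_cutoff \<Omega> n z = 1" for n by (simp add: outer_cutoff_def)
  thus ?thesis using True by simp
next
  case False
  have "infdist z (closure \<Omega>) > 0" using assms False by (intro infdist_pos_not_in_closed) auto
  then obtain n0 :: nat where n0: "1 / infdist z (closure \<Omega>) \<le> real n0" using real_arch_simple by blast
  have "eventually (\<lambda>n. outer_cutoff \<Omega> n z = 0) sequentially"
    using eventually_ge_at_top[of n0]
  proof eventually_elim
    case (elim n)
    have "1 / infdist z (closure \<Omega>) \<le> real (Suc n)" using n0 elim by linarith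
    hence "1 \<le> real (Suc n) * infdist z (closure \<Omega>)" using \<open>infdist z (closure \<Omega>) > 0\<close> by (simp only: divide_le_eq if_True)
    thus ?case by (simp add: outer_cutoff_def del: of_nat_Suc)
  qed
  thus ?thesis using False by (simp add: tendsto_eventually)
qed

lemma inner_cutoff_support:
  assumes "\<Omega> \<subseteq> cball 0 R" "cmod z > R"
  shows "inner_cutoff \<Omega> n z = 0"
proof -
  have "z \<notin> \<Omega>" using assms by auto
  thus ?thesis by (simp add: inner_cutoff_def)
qed

lemma outer_cutoff_support:
  assumes "closure \<Omega> \<subseteq> cball 0 R" "\<Omega> \<noteq> {}" "cmod z > R + 1"
  shows "outer_cutoff \<Omega> n z = 0"
proof -
  have "1 \<le> (INF x\<in>closure \<Omega>. dist z x)"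
  proof (rule cINF_greatest)
    fix x assume "x \<in> closure \<Omega>"
    hence "cmod x \<le> R" using assms by auto
    thus "1 \<le> dist z x" using assms(3) norm_triangle_ineq2[of z x] by (simp add: dist_norm)
  qed (use assms in simp)
  hence i: "1 \<le> infdist z (closure \<Omega>)" using assms by (simp add: infdist_notempty)
  have "1 * 1 \<le> real (Suc n) * infdist z (closure \<Omega>)" by (intro mult_mono i) auto
  thus ?thesis by (simp add: outer_cutoff_def del: of_nat_Suc)
qed

section \<open>Counting eigenvalues\<close>

text \<open>The enumeration \<open>r\<close> of the roots is arbitrary and may depend on \<omega> in
  a nonmeasurable way. The sum is nevertheless a pointwise limit of integrals over z of a jointly
  measurable function built from the determinant.\<close>

lemma sum_test_function_measurable:
  fixes \<phi> :: "complex \<Rightarrow> real" and L B R0 :: real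
  assumes G: "gaussian_random_mat M N Q"
    and lip: "L-lipschitz_on UNIV \<phi>" and B: "\<And>z. \<bar>\<phi> z\<bar> \<le> B" and supp: "\<And>z. cmod z > R0 \<Longrightarrow> \<phi> z = 0"
    and r: "\<And>\<omega>. \<omega> \<in> space M \<Longrightarrow> char_poly (toeplitz_mat a N + complex_of_real \<delta> \<cdot>\<^sub>m Q \<omega>) = (\<Prod>a\<leftarrow>r \<omega>. [:- a, 1:])"
  shows "(\<lambda>\<omega>. \<Sum>a\<leftarrow>r \<omega>. \<phi> a) \<in> borel_measurable M"
proof -
  let ?h = "\<lambda>n. inverse (real (Suc n))"
  let ?D = "\<lambda>\<omega> z. cmod (Determinant.det (perturbed_shift a N \<delta> z (Q \<omega>)))"
  define u where "u = (\<lambda>n \<omega>. (LINT z|lborel. cross_diff (?h n) \<phi> z * ln (?D \<omega> z)) / (?h n)\<^sup>2 / log_kernel_mass)"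
  show ?thesis
  proof (rule borel_measurable_LIMSEQ_real[where u = u])
    fix \<omega> assume \<omega>: "\<omega> \<in> space M"
    have Qc: "Q \<omega> \<in> carrier_mat N N" by (rule gaussian_matD(2)[OF G \<omega>])
    have Ac: "toeplitz_mat a N + complex_of_real \<delta> \<cdot>\<^sub>m Q \<omega> \<in> carrier_mat N N" using Qc by (simp add: toeplitz_mat_def)
    have "?D \<omega> z = (\<Prod>a\<leftarrow>r \<omega>. cmod (z - a))" for z
      unfolding perturbed_shift_eq[OF Qc] cmod_poly_char_poly[OF Ac, symmetric] r[OF \<omega>] by (rule cmod_poly_prod_list)
    thus "(\<lambda>n. u n \<omega>) \<longlonglongrightarrow> (\<Sum>a\<leftarrow>r \<omega>. \<phi> a)"
      unfolding u_def using sum_test_function_eq_limit[OF lip B supp, where as = "r \<omega>"] by (simp only:)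
  next
    fix n
    let ?L = "M \<Otimes>\<^sub>M (lborel :: complex measure)"
    have snd: "snd \<in> borel_measurable ?L" using measurable_snd[of M "lborel :: complex measure"] by simp
    have c: "cross_diff (?h n) \<phi> \<in> borel_measurable borel"
      using test_function_measurable[OF lip B supp] by (rule cross_diff_measurable)
    have "(\<lambda>x. cross_diff (?h n) \<phi> (snd x) * ln (?D (fst x) (snd x))) \<in> borel_measurable ?L"
      by (rule borel_measurable_times[OF measurable_compose[OF snd c] borel_measurable_ln[OF perturbed_det_measurable[OF G]]])
    hence "(\<lambda>(\<omega>, z). cross_diff (?h n) \<phi> z * ln (?D \<omega> z)) \<in> borel_measurable ?L"
      by (simp only: case_prod_beta')
    from lborel.borel_measurable_lebesgue_integral[OF this]
    have "(\<lambda>\<omega>. LINT z|lborel. cross_diff (?h n) \<phi> z * ln (?D \<omega> z)) \<in> borel_measurable M" .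
    thus "u n \<in> borel_measurable M" unfolding u_def by (intro borel_measurable_divide) auto
  qed
qed

lemma sum_list_indicator: "(\<Sum>a\<leftarrow>as. indicator \<Omega> a :: real) = real (length (filter (\<lambda>a. a \<in> \<Omega>) as))"
  by (induction as) auto

lemma tendsto_sum_list:
  fixes f :: "nat \<Rightarrow> 'a \<Rightarrow> real"
  assumes "\<And>a. (\<lambda>n. f n a) \<longlonglongrightarrow> g a"
  shows "(\<lambda>n. \<Sum>a\<leftarrow>as. f n a) \<longlonglongrightarrow> (\<Sum>a\<leftarrow>as. g a)"
  by (induction as) (auto intro!: tendsto_add assms)

text \<open>The count is a pointwise limit of sums of inner cutoffs over the roots. Measurability
  matters because \<open>measure\<close> is 0 on nonmeasurable sets, so a lower bound for the
  probability depends on it.\<close>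

lemma eigenvalue_count_measurable:
  assumes G: "gaussian_random_mat M N Q" and \<Omega>: "open \<Omega>" "- \<Omega> \<noteq> {}" "\<Omega> \<subseteq> cball 0 R"
  shows "(\<lambda>\<omega>. real (eigenvalue_count (toeplitz_mat a N + complex_of_real \<delta> \<cdot>\<^sub>m Q \<omega>) \<Omega>)) \<in> borel_measurable M"
proof -
  let ?A = "\<lambda>\<omega>. toeplitz_mat a N + complex_of_real \<delta> \<cdot>\<^sub>m Q \<omega>"
  have Ac: "?A \<omega> \<in> carrier_mat N N" if "\<omega> \<in> space M" for \<omega>
    using gaussian_matD(2)[OF G that] by (simp add: toeplitz_mat_def)
  have "\<exists>r. \<forall>\<omega>\<in>space M. char_poly (?A \<omega>) = (\<Prod>a\<leftarrow>r \<omega>. [:- a, 1:])"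
    using char_poly_factorized[OF Ac] by (intro bchoice) blast
  then obtain r where r: "\<And>\<omega>. \<omega> \<in> space M \<Longrightarrow> char_poly (?A \<omega>) = (\<Prod>a\<leftarrow>r \<omega>. [:- a, 1:])" by blast
  show ?thesis
  proof (rule borel_measurable_LIMSEQ_real[where u = "\<lambda>n \<omega>. \<Sum>a\<leftarrow>r \<omega>. inner_cutoff \<Omega> n a"])
    show "(\<lambda>\<omega>. \<Sum>a\<leftarrow>r \<omega>. inner_cutoff \<Omega> n a) \<in> borel_measurable M" for n
      by (rule sum_test_function_measurable[OF G inner_cutoff_lipschitz inner_cutoff_bounds(3) inner_cutoff_support[OF \<Omega>(3)] r])
    fix \<omega> assume \<omega>: "\<omega> \<in> space M"
    have "(\<lambda>n. \<Sum>a\<leftarrow>r \<omega>. inner_cutoff \<Omega> n a) \<longlonglongrightarrow> (\<Sum>a\<leftarrow>r \<omega>. indicator \<Omega> a)"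
      by (rule tendsto_sum_list[OF inner_cutoff_tendsto[OF \<Omega>(1,2)]])
    thus "(\<lambda>n. \<Sum>a\<leftarrow>r \<omega>. inner_cutoff \<Omega> n a) \<longlonglongrightarrow> real (eigenvalue_count (?A \<omega>) \<Omega>)"
      unfolding sum_list_indicator eigenvalue_count_eq_length_filter[OF Ac[OF \<omega>] r[OF \<omega>]] .
  qed
qed

text \<open>On the half-open interval \<open>cis\<close> is a bijection onto the circle, so Lebesgue
  measure of angles is arc length.\<close>

definition symbol_angles :: "(int \<Rightarrow> complex) \<Rightarrow> complex set \<Rightarrow> real set" where
  "symbol_angles a U = {t \<in> {0..<2 * pi}. laurent_symbol a (cis t) \<in> U}"

section \<open>The symbol along the circle in the angle variable\<close>

context
  fixes a :: "int \<Rightarrow> complex"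
  assumes summ: "(\<lambda>\<nu>. (1 + \<bar>real_of_int \<nu>\<bar>) * cmod (a \<nu>)) summable_on UNIV"
begin

lemma symbol_curve_continuous: "continuous_on UNIV (\<lambda>t. laurent_symbol a (cis t))"
proof (rule lipschitz_on_continuous_on)
  show "(weight_sum a)-lipschitz_on UNIV (\<lambda>t. laurent_symbol a (cis t))"
    by (rule lipschitz_onI) (use laurent_symbol_lipschitz[OF summ] weight_sum_nonneg[OF summ] in \<open>auto simp: dist_norm\<close>)
qed

lemma symbol_curve_measurable: "(\<lambda>t. laurent_symbol a (cis t)) \<in> borel_measurable borel"
  by (rule borel_measurable_continuous_onI[OF symbol_curve_continuous])

lemma symbol_angles_borel: "U \<in> sets borel \<Longrightarrow> symbol_angles a U \<in> sets borel"
proof -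
  assume U: "U \<in> sets borel"
  have "symbol_angles a U = {0..<2 * pi} \<inter> ((\<lambda>t. laurent_symbol a (cis t)) -` U \<inter> space borel)"
    unfolding symbol_angles_def by auto
  thus ?thesis using measurable_sets[OF symbol_curve_measurable U] by simp
qed

lemma cis_param:
  assumes "\<zeta> \<in> sphere 0 1"
  obtains t where "t \<in> {0..<2 * pi}" "\<zeta> = cis t"
proof
  show "Arg2pi \<zeta> \<in> {0..<2 * pi}" using Arg2pi_ge_0 Arg2pi_lt_2pi by simp
  have "\<zeta> = of_real (cmod \<zeta>) * exp (\<i> * of_real (Arg2pi \<zeta>))" by (rule Arg2pi_eq)
  thus "\<zeta> = cis (Arg2pi \<zeta>)" using assms by (simp add: cis_conv_exp)
qed

lemma circle_integral_eq:
  assumes U: "open U"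
  shows "(LINT \<theta>:{\<zeta> \<in> sphere 0 1. laurent_symbol a \<zeta> \<in> U}|circle_measure. 1) = measure lborel (symbol_angles a U)"
proof -
  let ?A = "{\<zeta> \<in> sphere 0 1. laurent_symbol a \<zeta> \<in> U}"
  \<comment> \<open>The series is controlled on the unit circle only, so \<open>?A\<close> is not
    obtained as a preimage under a Borel map of the plane. It is shown to be Borel as the circle
    minus the image of a compact set of angles, which is why the interval is closed here.\<close>
  let ?T = "{0..2 * pi} \<inter> (\<lambda>t. laurent_symbol a (cis t)) -` (- U)"
  have "closed ((\<lambda>t. laurent_symbol a (cis t)) -` (- U))"
    using symbol_curve_continuous U by (intro closed_vimage) auto
  hence "compact ?T" by (intro compact_Int_closed) auto
  hence "compact (cis ` ?T)" by (intro compact_continuous_image continuous_intros)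
  hence cl: "closed (cis ` ?T)" by (rule compact_imp_closed)
  have "?A = sphere 0 1 - cis ` ?T"
  proof (intro equalityI subsetI)
    fix \<zeta> assume "\<zeta> \<in> ?A" thus "\<zeta> \<in> sphere 0 1 - cis ` ?T" by auto
  next
    fix \<zeta> :: complex assume \<zeta>: "\<zeta> \<in> sphere 0 1 - cis ` ?T"
    then obtain t where t: "t \<in> {0..<2 * pi}" "\<zeta> = cis t" using cis_param[of \<zeta>] by blast
    show "\<zeta> \<in> ?A"
    proof (rule ccontr)
      assume "\<zeta> \<notin> ?A"
      hence "laurent_symbol a (cis t) \<in> - U" using \<zeta> t by auto
      hence "t \<in> ?T" using t by auto
      thus False using \<zeta> t by auto
    qed
  qed
  also have "\<dots> \<in> sets borel" using cl by (intro sets.Diff) (auto intro: borel_closed)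
  finally have A: "?A \<in> sets borel" .
  have cis_m: "cis \<in> borel_measurable borel" by (intro borel_measurable_continuous_onI continuous_intros)
  have cis_m': "cis \<in> measurable (restrict_space lborel {0..<2 * pi}) borel"
    by (rule measurable_restrict_space1) (use cis_m in simp)
  have "(LINT \<theta>:?A|circle_measure. 1) = (LINT \<zeta>|distr (restrict_space lborel {0..<2 * pi}) borel cis. indicator ?A \<zeta> :: real)"
    unfolding set_lebesgue_integral_def circle_measure_def by simp
  also have "\<dots> = (LINT t|restrict_space lborel {0..<2 * pi}. indicator ?A (cis t))"
    by (rule integral_distr[OF cis_m']) (use A in simp)
  also have "\<dots> = (LINT t|lborel. indicator {0..<2 * pi} t *\<^sub>R (indicator ?A (cis t) :: real))"
    by (rule integral_restrict_space) simp
  also have "\<dots> = (LINT t|lborel. indicator (symbol_angles a U) t)"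
    by (intro Bochner_Integration.integral_cong refl) (auto simp: indicator_def symbol_angles_def)
  also have "\<dots> = measure lborel (symbol_angles a U)"
    by simp
  finally show ?thesis .
qed

lemma cutoff_integral_tendsto:
  fixes c :: "nat \<Rightarrow> complex \<Rightarrow> real"
  assumes m: "\<And>n. c n \<in> borel_measurable borel" and b: "\<And>n z. \<bar>c n z\<bar> \<le> 1"
    and lim: "\<And>z. (\<lambda>n. c n z) \<longlonglongrightarrow> indicator U z" and U: "U \<in> sets borel"
  shows "(\<lambda>n. LINT t|lborel. indicator {0..<2 * pi} t * c n (laurent_symbol a (cis t))) \<longlonglongrightarrow> measure lborel (symbol_angles a U)"
proof -
  have "(\<lambda>n. LINT t|lborel. indicator {0..<2 * pi} t * c n (laurent_symbol a (cis t)))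
     \<longlonglongrightarrow> (LINT t|lborel. indicator (symbol_angles a U) t)"
  proof (rule integral_dominated_convergence[where w = "indicator {0..<2 * pi}"])
    show "indicator (symbol_angles a U) \<in> borel_measurable lborel" using symbol_angles_borel[OF U] by simp
    show "(\<lambda>t. indicator {0..<2 * pi} t * c n (laurent_symbol a (cis t))) \<in> borel_measurable lborel" for n
      using measurable_compose[OF symbol_curve_measurable m[of n]] by (simp add: borel_measurable_times)
    show "integrable lborel (indicator {0..<2 * pi} :: real \<Rightarrow> real)" by (rule integrable_real_indicator) auto
    show "AE t in lborel. (\<lambda>n. indicator {0..<2 * pi} t * c n (laurent_symbol a (cis t))) \<longlonglongrightarrow> indicator (symbol_angles a U) t"
    proof (rule AE_I2)
      fix t
      have "(\<lambda>n. indicator {0..<2 * pi} t * c n (laurent_symbol a (cis t))) \<longlonglongrightarrow> indicator {0..<2 * pi} t * indicator U (laurent_symbol a (cis t))"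
        by (intro tendsto_intros lim)
      moreover have "indicator {0..<2 * pi} t * indicator U (laurent_symbol a (cis t)) = (indicator (symbol_angles a U) t :: real)"
        by (auto simp: indicator_def symbol_angles_def)
      ultimately show "(\<lambda>n. indicator {0..<2 * pi} t * c n (laurent_symbol a (cis t))) \<longlonglongrightarrow> indicator (symbol_angles a U) t"
        by simp
    qed
    show "AE t in lborel. norm (indicator {0..<2 * pi} t * c n (laurent_symbol a (cis t))) \<le> indicator {0..<2 * pi} t" for n
      using b by (intro AE_I2) (auto simp: indicator_def)
  qed
  thus ?thesis by simp
qed

text \<open>Each of the finitely many frontier points on the curve has one preimage on the circle
  and hence one angle. The angles mapped to the frontier form a finite set, which is null, so the
  limits of the inner and outer cutoff integrals agree.\<close>

lemma symbol_angles_closure: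
  assumes \<Omega>: "open \<Omega>"
    and fin: "finite (frontier \<Omega> \<inter> laurent_symbol a ` sphere 0 1)"
    and uniq: "\<And>z. z \<in> frontier \<Omega> \<inter> laurent_symbol a ` sphere 0 1 \<Longrightarrow> \<exists>!\<zeta>. \<zeta> \<in> sphere 0 1 \<and> laurent_symbol a \<zeta> = z"
  shows "measure lborel (symbol_angles a (closure \<Omega>)) = measure lborel (symbol_angles a \<Omega>)"
proof -
  let ?Z = "{\<zeta> \<in> sphere 0 1. laurent_symbol a \<zeta> \<in> frontier \<Omega>}"
  have inj: "inj_on (laurent_symbol a) ?Z"
  proof (rule inj_onI)
    fix x y assume xy: "x \<in> ?Z" "y \<in> ?Z" "laurent_symbol a x = laurent_symbol a y"
    hence "laurent_symbol a x \<in> frontier \<Omega> \<inter> laurent_symbol a ` sphere 0 1" by auto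
    from uniq[OF this] show "x = y" using xy by auto
  qed
  have "laurent_symbol a ` ?Z \<subseteq> frontier \<Omega> \<inter> laurent_symbol a ` sphere 0 1" by auto
  hence finZ: "finite ?Z" using inj finite_subset[OF _ fin] finite_imageD by blast
  have cis_inj: "inj_on cis (symbol_angles a (frontier \<Omega>))"
  proof (rule inj_onI)
    fix s t assume st: "s \<in> symbol_angles a (frontier \<Omega>)" "t \<in> symbol_angles a (frontier \<Omega>)" "cis s = cis t"
    hence "cos (s - t) = 1"
      by (metis cis.sel(1) cis_divide cis_neq_zero divide_self one_complex.sel(1))
    then obtain n :: int where n: "s - t = of_int n * 2 * pi" unfolding cos_one_2pi_int by auto
    have "\<bar>s - t\<bar> < 2 * pi" using st unfolding symbol_angles_def by auto
    hence "\<bar>of_int n\<bar> * (2 * pi) < 1 * (2 * pi)" unfolding n by (simp add: abs_mult)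
    hence "\<bar>real_of_int n\<bar> < 1" by (subst (asm) mult_less_cancel_right) auto
    hence "n = 0" by linarith
    thus "s = t" using n by simp
  qed
  have "cis ` symbol_angles a (frontier \<Omega>) \<subseteq> ?Z" unfolding symbol_angles_def by auto
  hence finF: "finite (symbol_angles a (frontier \<Omega>))" using cis_inj finite_subset[OF _ finZ] finite_imageD by blast
  have "symbol_angles a (closure \<Omega>) = symbol_angles a \<Omega> \<union> symbol_angles a (frontier \<Omega>)"
    unfolding symbol_angles_def frontier_def using closure_subset[of \<Omega>] interior_open[OF \<Omega>] by auto
  moreover have "emeasure lborel (symbol_angles a (frontier \<Omega>)) = 0"
    using finite_imp_null_set_lborel[OF finF] by auto
  moreover have "symbol_angles a \<Omega> \<in> sets lborel" "symbol_angles a (frontier \<Omega>) \<in> sets lborel"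
    using symbol_angles_borel[of \<Omega>] symbol_angles_borel[of "frontier \<Omega>"] \<Omega> by (auto intro: borel_open borel_closed)
  ultimately have "emeasure lborel (symbol_angles a (closure \<Omega>)) = emeasure lborel (symbol_angles a \<Omega>)"
    by (simp add: emeasure_Un_null_set null_setsI)
  thus ?thesis by (simp add: measure_def)
qed

lemma symbol_riemann_sum:
  fixes \<phi> :: "complex \<Rightarrow> real"
  assumes lip: "L-lipschitz_on UNIV \<phi>" and eps: "\<epsilon> > 0"
  shows "eventually (\<lambda>N. \<bar>(\<Sum>m<N. \<phi> (laurent_symbol a (unity_root N m)))
      - real N / (2 * pi) * (LINT t|lborel. indicator {0..<2 * pi} t * \<phi> (laurent_symbol a (cis t)))\<bar> \<le> \<epsilon> * real N) sequentially"
proof -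
  let ?g = "\<lambda>t. \<phi> (laurent_symbol a (cis t))"
  let ?\<Lambda> = "L * weight_sum a"
  have L0: "L \<ge> 0" by (rule lipschitz_on_nonneg[OF lip])
  have \<Lambda>: "?\<Lambda> \<ge> 0" using L0 weight_sum_nonneg[OF summ] by simp
  have gl: "\<bar>?g s - ?g t\<bar> \<le> ?\<Lambda> * \<bar>s - t\<bar>" for s t
  proof -
    have "\<bar>?g s - ?g t\<bar> \<le> L * cmod (laurent_symbol a (cis s) - laurent_symbol a (cis t))"
      using lipschitz_onD[OF lip, of "laurent_symbol a (cis s)" "laurent_symbol a (cis t)"] by (simp add: dist_norm)
    also have "\<dots> \<le> L * (weight_sum a * \<bar>s - t\<bar>)" by (intro mult_left_mono laurent_symbol_lipschitz[OF summ] L0)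
    finally show ?thesis by (simp add: mult.assoc)
  qed
  obtain n0 :: nat where n0: "?\<Lambda> * (2 * pi)\<^sup>2 / (2 * pi * \<epsilon>) \<le> real n0" using real_arch_simple by blast
  show ?thesis using eventually_ge_at_top[of "max 1 n0"]
  proof eventually_elim
    case (elim N)
    hence N: "N > 0" "n0 \<le> N" by auto
    let ?I = "LINT t|lborel. indicator {0..<2 * pi} t * ?g t"
    let ?S = "\<Sum>m<N. \<phi> (laurent_symbol a (unity_root N m))"
    have "\<bar>(2 * pi / real N) * (\<Sum>m<N. ?g (2 * pi * real m / real N)) - ?I\<bar> \<le> ?\<Lambda> * (2 * pi)\<^sup>2 / real N"
      by (rule riemann_sum_lipschitz[OF gl N(1) _ \<Lambda>]) simp
    hence R: "\<bar>(2 * pi / real N) * ?S - ?I\<bar> \<le> ?\<Lambda> * (2 * pi)\<^sup>2 / real N" unfolding unity_root_def .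
    have "?\<Lambda> * (2 * pi)\<^sup>2 / real N \<le> 2 * pi * \<epsilon>"
    proof -
      have "?\<Lambda> * (2 * pi)\<^sup>2 / (2 * pi * \<epsilon>) \<le> real N" using n0 N(2) by linarith
      hence "?\<Lambda> * (2 * pi)\<^sup>2 \<le> real N * (2 * pi * \<epsilon>)" using eps by (subst (asm) pos_divide_le_eq) auto
      thus ?thesis using N(1) by (subst pos_divide_le_eq) (auto simp: mult.commute)
    qed
    hence "\<bar>(2 * pi / real N) * ?S - ?I\<bar> \<le> 2 * pi * \<epsilon>" using R by linarith
    hence "real N / (2 * pi) * \<bar>(2 * pi / real N) * ?S - ?I\<bar> \<le> real N / (2 * pi) * (2 * pi * \<epsilon>)"
      by (intro mult_left_mono) auto
    also have "\<dots> = \<epsilon> * real N" by simp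
    also have "real N / (2 * pi) * \<bar>(2 * pi / real N) * ?S - ?I\<bar> = \<bar>real N / (2 * pi) * ((2 * pi / real N) * ?S - ?I)\<bar>"
      by (simp add: abs_mult)
    also have "real N / (2 * pi) * ((2 * pi / real N) * ?S - ?I) = ?S - real N / (2 * pi) * ?I"
      using N(1) by (simp add: right_diff_distrib)
    finally show ?case .
  qed
qed

text \<open>For a fixed accuracy \<epsilon> the threshold for N does not depend on the probability
  space, the matrix or \<delta>, so these results can later be combined along a diagonal.\<close>

lemma eigenvalue_count_concentration:
  fixes \<delta>0 \<delta>1 \<epsilon> :: real
  assumes \<Omega>: "open \<Omega>" "\<Omega> \<noteq> {}" "closure \<Omega> \<subseteq> cball 0 R"
    and fin: "finite (frontier \<Omega> \<inter> laurent_symbol a ` sphere 0 1)"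
    and uniq: "\<And>z. z \<in> frontier \<Omega> \<inter> laurent_symbol a ` sphere 0 1 \<Longrightarrow> \<exists>!\<zeta>. \<zeta> \<in> sphere 0 1 \<and> laurent_symbol a \<zeta> = z"
    and d: "0 < \<delta>0" "\<delta>0 < 1" "\<delta>1 > 3 / 2" and eps: "\<epsilon> > 0"
  shows "eventually (\<lambda>N. \<forall>(M :: 'w measure) Q \<delta>. gaussian_random_mat M N Q \<longrightarrow>
     exp (- (real N powr \<delta>0)) \<le> \<delta> \<longrightarrow> \<delta> \<le> real N powr (- \<delta>1) \<longrightarrow>
     measure M {\<omega> \<in> space M. \<bar>real (eigenvalue_count (toeplitz_mat a N + complex_of_real \<delta> \<cdot>\<^sub>m Q \<omega>) \<Omega>)
         - real N / (2 * pi) * measure lborel (symbol_angles a \<Omega>)\<bar> \<le> \<epsilon> * real N}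
       \<ge> 1 - exp (- (real N powr \<delta>0))) sequentially"
proof -
  let ?p = "laurent_symbol a"
  let ?m = "measure lborel (symbol_angles a \<Omega>)"
  let ?I = "\<lambda>\<phi>. LINT t|lborel. indicator {0..<2 * pi} t * \<phi> (?p (cis t))"
  have \<Omega>R: "\<Omega> \<subseteq> cball 0 R" using \<Omega>(3) closure_subset by blast
  have ne: "- \<Omega> \<noteq> {}"
  proof
    assume "- \<Omega> = {}"
    hence "\<Omega> = UNIV" by auto
    thus False using bounded_subset[OF bounded_cball \<Omega>R] not_bounded_UNIV by blast
  qed
  \<comment> \<open>The accuracy \<epsilon> is divided among three comparisons: spectrum with roots
    of unity, Riemann sum with integral, cutoff with indicator. The last one is multiplied by N / (2
    pi) later, hence the factor 2 pi here.\<close>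
  have e3: "2 * pi * \<epsilon> / 3 > 0" using eps by simp
  have inm: "inner_cutoff \<Omega> n \<in> borel_measurable borel" for n
    by (rule borel_measurable_continuous_onI[OF lipschitz_on_continuous_on[OF inner_cutoff_lipschitz]])
  have outm: "outer_cutoff \<Omega> n \<in> borel_measurable borel" for n
    by (rule borel_measurable_continuous_onI[OF lipschitz_on_continuous_on[OF outer_cutoff_lipschitz]])
  have "(\<lambda>n. ?I (inner_cutoff \<Omega> n)) \<longlonglongrightarrow> ?m"
    by (rule cutoff_integral_tendsto[OF inm inner_cutoff_bounds(3) inner_cutoff_tendsto[OF \<Omega>(1) ne]]) (use \<Omega> in \<open>auto intro: borel_open\<close>)
  from LIMSEQ_D[OF this e3] obtain n1 where n1: "\<bar>?I (inner_cutoff \<Omega> n1) - ?m\<bar> < 2 * pi * \<epsilon> / 3" by force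
  have "(\<lambda>n. ?I (outer_cutoff \<Omega> n)) \<longlonglongrightarrow> measure lborel (symbol_angles a (closure \<Omega>))"
    by (rule cutoff_integral_tendsto[OF outm outer_cutoff_bounds(3) outer_cutoff_tendsto[OF \<Omega>(2)]]) (auto intro: borel_closed)
  moreover have "measure lborel (symbol_angles a (closure \<Omega>)) = ?m"
    by (rule symbol_angles_closure[OF \<Omega>(1) fin]) (rule uniq)
  ultimately have "(\<lambda>n. ?I (outer_cutoff \<Omega> n)) \<longlonglongrightarrow> ?m" by (simp only:)
  from LIMSEQ_D[OF this e3] obtain n2 where n2: "\<bar>?I (outer_cutoff \<Omega> n2) - ?m\<bar> < 2 * pi * \<epsilon> / 3" by force
  define \<phi> where "\<phi> = inner_cutoff \<Omega> n1"
  define \<psi> where "\<psi> = outer_cutoff \<Omega> n2"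
  have eps3: "\<epsilon> / 3 > 0" using eps by simp
  have supp1: "\<forall>z. cmod z > R \<longrightarrow> inner_cutoff \<Omega> n1 z = 0"
    using inner_cutoff_support[OF \<Omega>R] by blast
  have supp2: "\<forall>z. cmod z > R + 1 \<longrightarrow> outer_cutoff \<Omega> n2 z = 0"
    using outer_cutoff_support[OF \<Omega>(3,2)] by blast
  note close1 = spectrum_test_function_close[where 'w = 'w, OF summ d inner_cutoff_lipschitz[of n1 \<Omega>]
      inner_cutoff_bounds(3) supp1 eps3, folded \<phi>_def]
  note close2 = spectrum_test_function_close[where 'w = 'w, OF summ d outer_cutoff_lipschitz[of n2 \<Omega>]
      outer_cutoff_bounds(3) supp2 eps3, folded \<psi>_def]
  note rs1 = symbol_riemann_sum[OF inner_cutoff_lipschitz[of n1 \<Omega>] eps3, folded \<phi>_def]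
  note rs2 = symbol_riemann_sum[OF outer_cutoff_lipschitz[of n2 \<Omega>] eps3, folded \<psi>_def]
  show ?thesis using close1 close2 rs1 rs2
  proof eventually_elim
    case (elim N)
    show ?case
    proof (intro allI impI)
      fix M :: "'w measure" and Q \<delta>
      assume G: "gaussian_random_mat M N Q" and \<delta>: "exp (- (real N powr \<delta>0)) \<le> \<delta>" "\<delta> \<le> real N powr (- \<delta>1)"
      interpret prob_space M by (rule gaussian_matD(1)[OF G])
      let ?A = "\<lambda>\<omega>. toeplitz_mat a N + complex_of_real \<delta> \<cdot>\<^sub>m Q \<omega>"
      let ?ex = "exp (- (real N powr \<delta>0))"
      let ?S = "{\<omega> \<in> space M. \<bar>real (eigenvalue_count (?A \<omega>) \<Omega>) - real N / (2 * pi) * ?m\<bar> \<le> \<epsilon> * real N}"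
      have Sm: "?S \<in> events"
      proof -
        have [measurable]: "(\<lambda>\<omega>. real (eigenvalue_count (?A \<omega>) \<Omega>)) \<in> borel_measurable M"
          by (rule eigenvalue_count_measurable[OF G \<Omega>(1) ne \<Omega>R])
        show ?thesis by measurable
      qed
      obtain F1 where F1: "F1 \<in> events" "prob F1 \<le> ?ex / 2"
        "\<And>\<omega> as. \<omega> \<in> space M - F1 \<Longrightarrow> char_poly (?A \<omega>) = (\<Prod>a\<leftarrow>as. [:- a, 1:]) \<Longrightarrow> length as = N \<Longrightarrow>
          \<bar>(\<Sum>a\<leftarrow>as. \<phi> a) - (\<Sum>m<N. \<phi> (?p (unity_root N m)))\<bar> \<le> \<epsilon> / 3 * real N"
        using elim(1) G \<delta> by meson
      obtain F2 where F2: "F2 \<in> events" "prob F2 \<le> ?ex / 2"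
        "\<And>\<omega> as. \<omega> \<in> space M - F2 \<Longrightarrow> char_poly (?A \<omega>) = (\<Prod>a\<leftarrow>as. [:- a, 1:]) \<Longrightarrow> length as = N \<Longrightarrow>
          \<bar>(\<Sum>a\<leftarrow>as. \<psi> a) - (\<Sum>m<N. \<psi> (?p (unity_root N m)))\<bar> \<le> \<epsilon> / 3 * real N"
        using elim(2) G \<delta> by meson
      have scale: "\<bar>real N / (2 * pi) * x - real N / (2 * pi) * y\<bar> \<le> \<epsilon> / 3 * real N" if "\<bar>x - y\<bar> < 2 * pi * \<epsilon> / 3" for x y
      proof -
        have "\<bar>real N / (2 * pi) * x - real N / (2 * pi) * y\<bar> = real N / (2 * pi) * \<bar>x - y\<bar>"
          by (simp only: right_diff_distrib[symmetric] abs_mult) simp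
        also have "\<dots> \<le> real N / (2 * pi) * (2 * pi * \<epsilon> / 3)" using that by (intro mult_left_mono) auto
        also have "\<dots> = \<epsilon> / 3 * real N" by simp
        finally show ?thesis .
      qed
      have sub: "space M - (F1 \<union> F2) \<subseteq> ?S"
      proof
        fix \<omega> assume \<omega>: "\<omega> \<in> space M - (F1 \<union> F2)"
        have Ac: "?A \<omega> \<in> carrier_mat N N" using gaussian_matD(2)[OF G] \<omega> by (simp add: toeplitz_mat_def)
        obtain as where as: "char_poly (?A \<omega>) = (\<Prod>a\<leftarrow>as. [:- a, 1:])" "length as = N"
          using char_poly_factorized[OF Ac] by blast
        have cnt: "real (eigenvalue_count (?A \<omega>) \<Omega>) = (\<Sum>a\<leftarrow>as. indicator \<Omega> a)"
          unfolding eigenvalue_count_eq_length_filter[OF Ac as(1)] sum_list_indicator ..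
        have lo: "(\<Sum>a\<leftarrow>as. \<phi> a) \<le> real (eigenvalue_count (?A \<omega>) \<Omega>)"
          unfolding cnt \<phi>_def by (intro sum_list_mono inner_cutoff_bounds)
        have up: "real (eigenvalue_count (?A \<omega>) \<Omega>) \<le> (\<Sum>a\<leftarrow>as. \<psi> a)"
          unfolding cnt \<psi>_def by (intro sum_list_mono outer_cutoff_bounds)
        have 1: "\<bar>(\<Sum>a\<leftarrow>as. \<phi> a) - (\<Sum>m<N. \<phi> (?p (unity_root N m)))\<bar> \<le> \<epsilon> / 3 * real N"
          using F1(3)[OF _ as] \<omega> by blast
        have 2: "\<bar>(\<Sum>a\<leftarrow>as. \<psi> a) - (\<Sum>m<N. \<psi> (?p (unity_root N m)))\<bar> \<le> \<epsilon> / 3 * real N"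
          using F2(3)[OF _ as] \<omega> by blast
        have 3: "\<bar>real N / (2 * pi) * ?I \<phi> - real N / (2 * pi) * ?m\<bar> \<le> \<epsilon> / 3 * real N"
          by (rule scale[OF n1[folded \<phi>_def]])
        have 4: "\<bar>real N / (2 * pi) * ?I \<psi> - real N / (2 * pi) * ?m\<bar> \<le> \<epsilon> / 3 * real N"
          by (rule scale[OF n2[folded \<psi>_def]])
        have tri: "\<bar>c - m\<bar> \<le> \<epsilon> * real N"
          if "s1 \<le> c" "c \<le> s2" "\<bar>s1 - t1\<bar> \<le> \<epsilon> / 3 * real N" "\<bar>s2 - t2\<bar> \<le> \<epsilon> / 3 * real N"
            "\<bar>t1 - i1\<bar> \<le> \<epsilon> / 3 * real N" "\<bar>t2 - i2\<bar> \<le> \<epsilon> / 3 * real N"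
            "\<bar>i1 - m\<bar> \<le> \<epsilon> / 3 * real N" "\<bar>i2 - m\<bar> \<le> \<epsilon> / 3 * real N" for c m s1 s2 t1 t2 i1 i2 :: real
        proof -
          define E where "E = \<epsilon> / 3 * real N"
          have "\<epsilon> * real N = 3 * E" by (simp add: E_def)
          thus ?thesis using that unfolding E_def[symmetric] by linarith
        qed
        show "\<omega> \<in> ?S" using tri[OF lo up 1 2 elim(3,4) 3 4] \<omega> by blast
      qed
      have "prob (F1 \<union> F2) \<le> prob F1 + prob F2" by (rule measure_Un_le[OF F1(1) F2(1)])
      hence "prob (F1 \<union> F2) \<le> ?ex" using F1(2) F2(2) by linarith
      moreover have "prob (space M - (F1 \<union> F2)) = 1 - prob (F1 \<union> F2)"
        by (rule prob_compl) (use F1 F2 in auto)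
      moreover have "prob (space M - (F1 \<union> F2)) \<le> prob ?S" by (rule finite_measure_mono[OF sub Sm])
      ultimately show "prob ?S \<ge> 1 - ?ex" by linarith
    qed
  qed
qed

end

theorem theorem1p1:
  fixes a :: "int \<Rightarrow> complex" and m :: "int \<Rightarrow> real" and C :: real
    and p :: "complex \<Rightarrow> complex" and \<Omega> :: "complex set" and \<delta>0 \<delta>1 :: real
  assumes "C > 0"
    and "\<And>\<nu>. cmod (a \<nu>) \<le> C * m \<nu>"
    and "\<And>\<nu>. m \<nu> > 0"
    and "(\<lambda>\<nu>. (1 + \<bar>real_of_int \<nu>\<bar>) * m \<nu>) summable_on UNIV"
    and "\<And>\<nu>. m (- \<nu>) = m \<nu>"
    and p_def: "p = laurent_symbol a"
    and "open \<Omega>" and "compact (closure \<Omega>)" and "simply_connected \<Omega>"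
    and "smooth_boundary \<Omega>"
    and "finite (frontier \<Omega> \<inter> p ` sphere 0 1)"
    and "\<And>z. z \<in> frontier \<Omega> \<inter> p ` sphere 0 1 \<Longrightarrow> \<exists>!\<zeta>. \<zeta> \<in> sphere 0 1 \<and> p \<zeta> = z"
    and "\<And>\<zeta>. \<zeta> \<in> sphere 0 1 \<Longrightarrow> p \<zeta> \<in> frontier \<Omega> \<Longrightarrow> circle_deriv p \<zeta> \<noteq> 0"
    and "\<And>z. z \<in> frontier \<Omega> \<inter> p ` sphere 0 1 \<Longrightarrow>
           transversal_at (frontier \<Omega>) (p ` sphere 0 1) z"
    and "0 < \<delta>0" and "\<delta>0 < 1" and "\<delta>1 > 3 / 2"
  shows "\<exists>c>0. \<forall>(M :: nat \<Rightarrow> 'w measure) (Q :: nat \<Rightarrow> 'w \<Rightarrow> complex mat) (\<delta> :: nat \<Rightarrow> real).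
     (\<forall>N. gaussian_random_mat (M N) N (Q N)) \<longrightarrow>
     (\<forall>\<^sub>F N in sequentially.
        exp (- (real N powr \<delta>0)) \<le> \<delta> N \<and> \<delta> N \<le> c * real N powr (- \<delta>1)) \<longrightarrow>
     (\<exists>\<epsilon> :: nat \<Rightarrow> real. \<epsilon> \<longlonglongrightarrow> 0 \<and>
        (\<forall>\<^sub>F N in sequentially.
           measure (M N) {\<omega> \<in> space (M N).
             \<bar>real (eigenvalue_count
                      (toeplitz_mat a N + complex_of_real (\<delta> N) \<cdot>\<^sub>m Q N \<omega>) \<Omega>)
               - real N / (2 * pi) *
                 (LINT \<theta>:{\<zeta> \<in> sphere 0 1. p \<zeta> \<in> \<Omega>}|circle_measure. 1)\<bar>
             \<le> \<epsilon> N * real N}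
           \<ge> 1 - exp (- (real N powr \<delta>0))))"
proof -
  have summ: "(\<lambda>\<nu>. (1 + \<bar>real_of_int \<nu>\<bar>) * cmod (a \<nu>)) summable_on UNIV"
  proof (rule summable_on_comparison_test)
    show "(\<lambda>\<nu>. C * ((1 + \<bar>real_of_int \<nu>\<bar>) * m \<nu>)) summable_on UNIV"
      by (intro summable_on_cmult_right assms(4))
    fix \<nu> :: int
    have "(1 + \<bar>real_of_int \<nu>\<bar>) * cmod (a \<nu>) \<le> (1 + \<bar>real_of_int \<nu>\<bar>) * (C * m \<nu>)"
      by (intro mult_left_mono assms(2)) auto
    thus "(1 + \<bar>real_of_int \<nu>\<bar>) * cmod (a \<nu>) \<le> C * ((1 + \<bar>real_of_int \<nu>\<bar>) * m \<nu>)" by (simp add: mult_ac)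
  qed auto
  let ?m = "measure lborel (symbol_angles a \<Omega>)"
  have int: "(LINT \<theta>:{\<zeta> \<in> sphere 0 1. p \<zeta> \<in> \<Omega>}|circle_measure. 1) = ?m"
    unfolding p_def by (rule circle_integral_eq[OF summ \<open>open \<Omega>\<close>])
  have "bounded (closure \<Omega>)" using assms(8) by (rule compact_imp_bounded)
  then obtain R where "\<forall>z\<in>closure \<Omega>. cmod z \<le> R" unfolding bounded_iff by blast
  hence R: "closure \<Omega> \<subseteq> cball 0 R" by auto
  define P where "P = (\<lambda>k N. \<forall>(M :: 'w measure) Q \<delta>. gaussian_random_mat M N Q \<longrightarrow>
     exp (- (real N powr \<delta>0)) \<le> \<delta> \<longrightarrow> \<delta> \<le> real N powr (- \<delta>1) \<longrightarrow>
     measure M {\<omega> \<in> space M. \<bar>real (eigenvalue_count (toeplitz_mat a N + complex_of_real \<delta> \<cdot>\<^sub>m Q \<omega>) \<Omega>)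
         - real N / (2 * pi) * ?m\<bar> \<le> inverse (real (Suc k)) * real N}
       \<ge> 1 - exp (- (real N powr \<delta>0)))"
  have ev: "eventually (P k) sequentially" for k
  proof (cases "\<Omega> = {}")
    \<comment> \<open>For the empty set the outer cutoff does not tend to the indicator; here both
      the count and the arc length are 0.\<close>
    case True
    have "P k N" for N
      unfolding P_def
    proof (intro allI impI)
      fix M :: "'w measure" and Q \<delta>
      assume G: "gaussian_random_mat M N Q"
      interpret prob_space M by (rule gaussian_matD(1)[OF G])
      show "measure M {\<omega> \<in> space M. \<bar>real (eigenvalue_count (toeplitz_mat a N + complex_of_real \<delta> \<cdot>\<^sub>m Q \<omega>) \<Omega>)
         - real N / (2 * pi) * ?m\<bar> \<le> inverse (real (Suc k)) * real N} \<ge> 1 - exp (- (real N powr \<delta>0))"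
        using True by (simp add: eigenvalue_count_def symbol_angles_def prob_space)
    qed
    thus ?thesis by (intro always_eventually allI)
  next
    case False
    show ?thesis unfolding P_def
      by (rule eigenvalue_count_concentration[OF summ \<open>open \<Omega>\<close> False R])
         (use assms(11,12) assms(15-17) in \<open>auto simp: p_def\<close>)
  qed
  \<comment> \<open>The sequence depends on neither \<open>M\<close>, \<open>Q\<close> nor \<delta>,
    which are quantified inside \<open>P\<close>.\<close>
  obtain e :: "nat \<Rightarrow> nat" where e: "filterlim e at_top sequentially" "eventually (\<lambda>N. P (e N) N) sequentially"
    using eventually_diagonal[of P] ev by blast
  show ?thesis
  \<comment> \<open>The constant c = 1 is small enough, since \<delta>1 > 3/2 makes \<delta> N times
    the entry bound tend to 0 with a power of N.\<close>
  proof (intro exI[of _ "1 :: real"] conjI allI impI)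
    fix M :: "nat \<Rightarrow> 'w measure" and Q :: "nat \<Rightarrow> 'w \<Rightarrow> complex mat" and \<delta> :: "nat \<Rightarrow> real"
    assume G: "\<forall>N. gaussian_random_mat (M N) N (Q N)"
      and \<delta>: "\<forall>\<^sub>F N in sequentially. exp (- (real N powr \<delta>0)) \<le> \<delta> N \<and> \<delta> N \<le> 1 * real N powr (- \<delta>1)"
    show "\<exists>\<epsilon> :: nat \<Rightarrow> real. \<epsilon> \<longlonglongrightarrow> 0 \<and>
        (\<forall>\<^sub>F N in sequentially.
           measure (M N) {\<omega> \<in> space (M N).
             \<bar>real (eigenvalue_count
                      (toeplitz_mat a N + complex_of_real (\<delta> N) \<cdot>\<^sub>m Q N \<omega>) \<Omega>)
               - real N / (2 * pi) *
                 (LINT \<theta>:{\<zeta> \<in> sphere 0 1. p \<zeta> \<in> \<Omega>}|circle_measure. 1)\<bar>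
             \<le> \<epsilon> N * real N}
           \<ge> 1 - exp (- (real N powr \<delta>0)))"
    proof (intro exI[of _ "\<lambda>N. inverse (real (Suc (e N)))"] conjI)
      show "(\<lambda>N. inverse (real (Suc (e N)))) \<longlonglongrightarrow> 0"
        by (rule filterlim_compose[OF LIMSEQ_inverse_real_of_nat e(1)])
      show "\<forall>\<^sub>F N in sequentially.
           measure (M N) {\<omega> \<in> space (M N).
             \<bar>real (eigenvalue_count
                      (toeplitz_mat a N + complex_of_real (\<delta> N) \<cdot>\<^sub>m Q N \<omega>) \<Omega>)
               - real N / (2 * pi) *
                 (LINT \<theta>:{\<zeta> \<in> sphere 0 1. p \<zeta> \<in> \<Omega>}|circle_measure. 1)\<bar>
             \<le> inverse (real (Suc (e N))) * real N}
           \<ge> 1 - exp (- (real N powr \<delta>0))"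
        using e(2) \<delta> unfolding int
      proof eventually_elim
        case (elim N)
        thus ?case using G unfolding P_def by simp
      qed
    qed
  qed simp
qed

end
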